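(* Let $s>0$. Let $(X_i)_{i\ge1}$, $(\Lambda_i)_{i\ge1}$ and $(W_i)_{i\ge1}$ be mutually independent sequences, where $X_i=(E_1+\cdots+E_i)^s$ with $E_1,E_2,\dots$ i.i.d. mean-one exponential variables, the $\Lambda_i$ are i.i.d. standard Gumbel, and the $W_i$ are i.i.d. copies of the variable $W$ defined in the context. Define $$\widehat D = 1+\sum_{i\ge 1}\mathbf 1_{\{\Lambda_i+\log W_i+\lambda_sX_i<M\}},\qquad M=\max_{i\in\mathbb N}\left(\Lambda_i+\log W_i-\lambda_sX_i\right)$$ (the limit in distribution of the degree of a uniformly chosen vertex in the shortest path tree of the complete graph $K_n$ with i.i.d. edge weights distributed as $E^s$, $E$ mean-one exponential). Then: (a) for $s=1$, $\widehat D$ is a geometric random variable with parameter $\frac12$, i.e. $\mathbb P(\widehat D=k)=2^{-k}$ for $k\ge 1$; (b) for $s<1$, $\log\mathbb P(\widehat D=k)\sim-\lambda_sk^s$ as $k\to\infty$; (c) for $s>1$, $\log\mathbb P(\widehat D=k)\sim-(1-1/s)\,k\log k$ as $k\to\infty$.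
   Context: A standard Gumbel variable $\Lambda$ satisfies $\mathbb P(\Lambda\le x)=\exp(-e^{-x})$. Put $\lambda_s=\Gamma(1+1/s)^s$, where $\Gamma$ is the Gamma function. The law of the random variable $W$ is the unique one with $W>0$ a.s., $\mathbb E(W)=1$ and $$W\overset{d}{=}\sum_{i\ge1}e^{-\lambda_sX_i}W_i,$$ where $(X_i)_{i\ge1}$ is distributed as in the claim and, independently, $W_1,W_2,\dots$ are i.i.d. copies of $W$. The notation $a_k\sim b_k$ means $a_k/b_k\to1$. *)

theory Defs
  imports "HOL-Probability.Probability" "HOL-Library.Landau_Symbols"
begin

definition lam :: "real \<Rightarrow> real" where
  "lam s = Gamma (1 + 1 / s) powr s"

text \<open>All sequences indexed by $i \ge 1$ in the source are indexed from 0 here, so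
  \<open>arrival s e i\<close> is $X_{i+1} = (E_1 + \cdots + E_{i+1})^s$ with $E_{j+1} = e_j$.\<close>

definition arrival :: "real \<Rightarrow> (nat \<Rightarrow> real) \<Rightarrow> nat \<Rightarrow> real" where
  "arrival s e i = (\<Sum>j\<le>i. e j) powr s"

definition exp_law :: "real measure" where
  "exp_law = density lborel (exponential_density 1)"

text \<open>The defining properties of the law of $W$; the fixed-point equation is written on the
  canonical product space, so that the \<open>e j\<close> are i.i.d. mean-one exponentials and, independently,
  the \<open>w i\<close> are i.i.d. with law \<open>\<mu>\<close>. The series converges almost surely whenever the
  other conditions hold (its terms are a.s. positive and their expectations sum to 1), so the
  unspecified value of a divergent real series is irrelevant.\<close>

definition W_law :: "real \<Rightarrow> real measure \<Rightarrow> bool" where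
  "W_law s \<mu> \<longleftrightarrow>
     real_distribution \<mu> \<and>
     (AE x in \<mu>. 0 < x) \<and>
     integrable \<mu> (\<lambda>x. x) \<and> (\<integral>x. x \<partial>\<mu>) = 1 \<and>
     distr ((\<Pi>\<^sub>M j\<in>(UNIV :: nat set). exp_law) \<Otimes>\<^sub>M (\<Pi>\<^sub>M i\<in>(UNIV :: nat set). \<mu>)) borel
       (\<lambda>(e, w). \<Sum>i. exp (- lam s * arrival s e i) * w i) = \<mu>"

text \<open>The maximum $M$ is attained almost surely. It is rendered as a supremum in the extended
  reals, which equals the maximum whenever the latter exists and is meaningful on the
  exceptional null set too. Likewise the number of indices, a.s. finite, is counted as
  an extended nonnegative real.\<close>

definition max_val :: "real \<Rightarrow> (nat \<Rightarrow> real) \<Rightarrow> (nat \<Rightarrow> real) \<Rightarrow> (nat \<Rightarrow> real) \<Rightarrow> ereal" where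
  "max_val s x l w = (SUP i. ereal (l i + ln (w i) - lam s * x i))"

definition Dhat :: "real \<Rightarrow> (nat \<Rightarrow> real) \<Rightarrow> (nat \<Rightarrow> real) \<Rightarrow> (nat \<Rightarrow> real) \<Rightarrow> ennreal" where
  "Dhat s x l w =
     1 + (\<Sum>i. of_bool (ereal (l i + ln (w i) + lam s * x i) < max_val s x l w))"

end

theory Submission
  imports Defs "HOL-Real_Asymp.Real_Asymp"
begin

text \<open>
  The points \<open>(T, G)\<close> with \<open>T = E\<^sub>1 + \<dots> + E\<^sub>i\<close> and \<open>G = \<Lambda>\<^sub>i + log W\<^sub>i\<close> form a marked
  Poisson process. All points satisfying \<open>G + \<lambda> T\<^sup>s < m\<close> lie strictly inside the region
  \<open>G - \<lambda> T\<^sup>s \<le> m\<close>, so given \<open>M = m\<close> the number of counted points \<open>D - 1\<close> is still Poisson, with mean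
  \<open>\<nu>(m) = \<integral> F (m - \<lambda> t\<^sup>s) dt\<close> where \<open>F\<close> is the distribution function of \<open>G\<close>. The fixed-point equation for \<open>W\<close>
  says precisely that \<open>M\<close> has the law of \<open>G\<close>, that is
  \<open>F (x) = exp (- \<integral> (1 - F (x + \<lambda> t\<^sup>s)) dt)\<close>. Hence \<open>D - 1\<close> is mixed Poisson with mean \<open>\<nu>(G)\<close>.

  For \<open>s = 1\<close> the equation gives \<open>F' = F (1 - F)\<close> and \<open>exp (- \<nu>) = 1 - F\<close>, so \<open>\<nu>(G)\<close> is exponential and
  the mixture geometric. In general \<open>\<nu>(m) \<sim> (m / \<lambda>)\<^bsup>1/s\<^esup>\<close> and \<open>P (G > m)\<close> is of order \<open>exp (- m)\<close>. For \<open>s < 1\<close>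
  the cheapest way to see \<open>k\<close> points is \<open>\<nu>(G) \<approx> k\<close>, at cost \<open>\<lambda> k\<^sup>s\<close>; for \<open>s > 1\<close> it is \<open>G\<close> of
  order \<open>k\<close> up to logarithms together with an atypically large Poisson variable.
\<close>

section \<open>Products along a Poisson process\<close>

text \<open>No Poisson process is constructed: all that is used of it is the limit of the expected
  products of \<open>H\<close> over the first \<open>n\<close> points, obtained from a recursion on
  the gaps. Averaging a factor \<open>h t g\<close> over an independent mark gives such an
  \<open>H\<close>. Two choices of \<open>h\<close> suffice: an exponential gives the equation for
  the Laplace transform of W, and a factor with values 0, z and 1 gives the joint law of a count and
  the maximum.

  The obstacle is that M = m is in general a null event, so the conditional Poisson law is not
  directly available. It is replaced by an exact formula for the count under a fixed level a on the
  event M \<le> b, for a \<le> b. Differences of it discretise M, and continuity of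
  \<open>nu\<close> allows the mesh to tend to 0.

  For s other than 1 no closed form of \<open>F\<close> is used. Its upper tail is bounded through
  E(W) = 1, windows of \<open>F\<close> are bounded below because W is positive, and the decay of
  \<open>F\<close> at minus infinity comes from feeding the fixed-point equation with the value
  \<open>F 0\<close>.\<close>

lemma prob_space_exp_law: "prob_space exp_law"
  unfolding exp_law_def by (rule prob_space_exponential_density) simp

lemma sets_exp_law [measurable_cong, simp]: "sets exp_law = sets borel"
  by (simp add: exp_law_def)

lemma space_exp_law [simp]: "space exp_law = UNIV"
  by (simp add: exp_law_def)

text \<open>The offset \<open>u\<close> is the time already elapsed: conditioning on the first gap
  only moves it, so that a recursion in \<open>n\<close> closes.\<close>

definition poisson_prod :: "(real \<Rightarrow> real) \<Rightarrow> nat \<Rightarrow> real \<Rightarrow> real" where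
  "poisson_prod H n u =
     (\<integral>e. (\<Prod>i<n. H (u + (\<Sum>j\<le>i. e j))) \<partial>(\<Pi>\<^sub>M j\<in>(UNIV :: nat set). exp_law))"

lemma poisson_prod_0: "poisson_prod H 0 u = 1"
proof -
  interpret prob_space "\<Pi>\<^sub>M j\<in>(UNIV :: nat set). exp_law"
    by (intro prob_space_PiM prob_space_exp_law)
  show ?thesis by (simp add: poisson_prod_def prob_space)
qed

lemma poisson_prod_measurable [measurable]:
  assumes [measurable]: "H \<in> borel_measurable borel"
  shows "poisson_prod H n \<in> borel_measurable borel"
proof -
  interpret prob_space "\<Pi>\<^sub>M j\<in>(UNIV :: nat set). exp_law"
    by (intro prob_space_PiM prob_space_exp_law)
  show ?thesis unfolding poisson_prod_def by measurable
qed

lemma poisson_prod_bounds: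
  assumes [measurable]: "H \<in> borel_measurable borel"
    and H: "\<And>t. 0 \<le> H t" "\<And>t. H t \<le> 1"
  shows "0 \<le> poisson_prod H n u" "poisson_prod H n u \<le> 1"
proof -
  interpret prob_space "\<Pi>\<^sub>M j\<in>(UNIV :: nat set). exp_law"
    by (intro prob_space_PiM prob_space_exp_law)
  show "0 \<le> poisson_prod H n u"
    unfolding poisson_prod_def by (intro Bochner_Integration.integral_nonneg prod_nonneg) (simp add: H)
  have "norm (poisson_prod H n u) \<le> 1"
    unfolding poisson_prod_def
    by (rule order.trans[OF integral_norm_bound integral_le_const])
       (auto intro!: integrable_const_bound[where B=1] prod_le_1 AE_I2 simp: H abs_prod)
  thus "poisson_prod H n u \<le> 1" by simp
qed

text \<open>\<open>PiM_iter\<close> splits the first gap off the sequence; the other gaps are again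
  i.i.d., now started at time \<open>u + t\<close>.\<close>

lemma poisson_prod_Suc:
  assumes [measurable]: "H \<in> borel_measurable borel"
    and H: "\<And>t. 0 \<le> H t" "\<And>t. H t \<le> 1"
  shows "poisson_prod H (Suc n) u = (\<integral>t. H (u + t) * poisson_prod H n (u + t) \<partial>exp_law)"
proof -
  let ?S = "\<Pi>\<^sub>M j\<in>(UNIV :: nat set). exp_law"
  interpret E: prob_space exp_law by (rule prob_space_exp_law)
  interpret S: sequence_space exp_law ..
  interpret PS: prob_space ?S by (intro prob_space_PiM prob_space_exp_law)
  interpret P: pair_prob_space exp_law ?S ..
  let ?f = "\<lambda>u e. (\<Prod>i<n. H (u + (\<Sum>j\<le>i. e j)))"
  have "poisson_prod H (Suc n) u =
      (\<integral>e. (\<Prod>i<Suc n. H (u + (\<Sum>j\<le>i. e j))) \<partial>distr (exp_law \<Otimes>\<^sub>M ?S) ?S (\<lambda>(s, \<omega>). case_nat s \<omega>))"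
    by (simp only: S.PiM_iter poisson_prod_def)
  also have "\<dots> = (\<integral>x. (\<Prod>i<Suc n. H (u + (\<Sum>j\<le>i. case_nat (fst x) (snd x) j))) \<partial>(exp_law \<Otimes>\<^sub>M ?S))"
    by (subst integral_distr) (auto simp: case_prod_beta)
  also have "\<dots> = (\<integral>x. H (u + fst x) * ?f (u + fst x) (snd x) \<partial>(exp_law \<Otimes>\<^sub>M ?S))"
    by (simp only: prod.lessThan_Suc_shift sum.atMost_Suc_shift) (simp add: add.assoc sum.atMost_shift)
  also have "\<dots> = (\<integral>t. (\<integral>e. H (u + t) * ?f (u + t) e \<partial>?S) \<partial>exp_law)"
  proof (subst P.integral_fst'[symmetric])
    show "integrable (exp_law \<Otimes>\<^sub>M ?S) (\<lambda>x. H (u + fst x) * ?f (u + fst x) (snd x))"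
      by (intro P.integrable_const_bound[where B=1] AE_I2)
         (auto simp: H abs_mult abs_prod intro!: mult_le_one prod_le_1 prod_nonneg)
  qed simp
  finally show ?thesis by (simp add: poisson_prod_def)
qed

text \<open>If a rate-one Poisson process keeps a point at \<open>t\<close> with probability
  \<open>1 - H t\<close>, this is the probability that no point after \<open>u\<close> is
  kept.\<close>

definition void_prob :: "(real \<Rightarrow> real) \<Rightarrow> real \<Rightarrow> real" where
  "void_prob H u = exp (- (LBINT t:{u..}. 1 - H t))"

lemma exp_law_integral_exp: "(\<integral>t. exp (- (u + t)) \<partial>exp_law) = exp (- u) / 2"
proof -
  have "(\<integral>\<^sup>+t. ennreal (exp (- (u + t))) \<partial>exp_law)
      = (\<integral>\<^sup>+t. ennreal (exp (- u - 2 * t)) * indicator {0..} t \<partial>lborel)"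
    unfolding exp_law_def
    by (subst nn_integral_density)
       (auto intro!: nn_integral_cong simp: exponential_density_def ennreal_mult[symmetric] exp_add[symmetric]
          split: split_indicator)
  also have "\<dots> = ennreal (0 - (- exp (- u - 2 * 0) / 2))"
    by (rule nn_integral_FTC_atLeast) (auto intro!: derivative_eq_intros, real_asymp)
  finally show ?thesis
    by (intro integral_eq_nn_integral[THEN trans]) auto
qed

lemma exp_law_integrable:
  fixes f :: "real \<Rightarrow> real"
  assumes "f \<in> borel_measurable borel" "\<And>t. \<bar>f t\<bar> \<le> 1"
  shows "integrable exp_law f"
proof -
  interpret E: prob_space exp_law by (rule prob_space_exp_law)
  show ?thesis
    by (rule E.integrable_const_bound[where B=1]) (use assms in \<open>auto cong: measurable_cong_sets\<close>)
qed

context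
  fixes H :: "real \<Rightarrow> real"
  assumes cont: "continuous_on UNIV H"
    and H: "\<And>t. 0 \<le> H t" "\<And>t. H t \<le> 1"
    and int: "integrable lborel (\<lambda>t. 1 - H t)"
begin

lemma H_meas: "H \<in> borel_measurable borel"
  using cont by (rule borel_measurable_continuous_onI)

lemma void_int: "set_integrable lborel A (\<lambda>t. 1 - H t)" if "A \<in> sets borel"
  using int that unfolding set_integrable_def by (intro integrable_mult_indicator) auto

text \<open>Moves the dependence on \<open>u\<close> into an integral over a compact interval, to
  which the fundamental theorem of calculus applies.\<close>

lemma void_split:
  assumes "a \<le> u"
  shows "(LBINT t:{u..}. 1 - H t) = (LBINT t:{a..}. 1 - H t) - integral {a..u} (\<lambda>t. 1 - H t)"
proof -
  have "(LBINT t:{a..<u} \<union> {u..}. 1 - H t) = (LBINT t:{a..<u}. 1 - H t) + (LBINT t:{u..}. 1 - H t)"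
    by (intro set_integral_Un void_int) auto
  moreover have "{a..<u} \<union> {u..} = {a..}" using assms by auto
  moreover have "(LBINT t:{a..<u}. 1 - H t) = (LBINT t:{a..u}. 1 - H t)"
  proof (rule set_integral_null_delta)
    have "sym_diff {a..<u} {a..u} \<subseteq> {u}" by auto
    thus "sym_diff {a..<u} {a..u} \<in> null_sets lborel"
      by (rule null_sets_subset[rotated 2]) auto
  qed (use int in auto)
  moreover have "(LBINT t:{a..u}. 1 - H t) = integral {a..u} (\<lambda>t. 1 - H t)"
    by (intro set_borel_integral_eq_integral(2) void_int) auto
  ultimately show ?thesis by simp
qed

lemma void_prob_bounds: "0 < void_prob H u" "void_prob H u \<le> 1"
  by (auto simp: void_prob_def set_lebesgue_integral_def H intro!: Bochner_Integration.integral_nonneg)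

lemma void_prob_eq:
  assumes "a \<le> u"
  shows "void_prob H u = exp (- ((LBINT t:{a..}. 1 - H t) - integral {a..u} (\<lambda>t. 1 - H t)))"
  unfolding void_prob_def by (rule arg_cong[of _ _ "\<lambda>x. exp (- x)"]) (rule void_split[OF assms])

text \<open>The base point \<open>u - 1\<close> of the compact integral puts \<open>u\<close> in the
  interior, which upgrades a derivative within an interval to a full one.\<close>

lemma void_prob_deriv: "(void_prob H has_real_derivative (1 - H u) * void_prob H u) (at u)"
proof -
  let ?a = "u - 1" and ?b = "u + 1"
  have "((\<lambda>x. integral {?a..x} (\<lambda>t. 1 - H t)) has_real_derivative (1 - H u)) (at u within {?a..?b})"
    by (rule integral_has_real_derivative) (auto intro!: continuous_intros continuous_on_subset[OF cont])
  hence d: "((\<lambda>x. integral {?a..x} (\<lambda>t. 1 - H t)) has_real_derivative (1 - H u)) (at u)"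
    by (simp add: at_within_Icc_at)
  have "((\<lambda>x. exp (- ((LBINT t:{?a..}. 1 - H t) - integral {?a..x} (\<lambda>t. 1 - H t)))) has_real_derivative
          (1 - H u) * void_prob H u) (at u)"
    by (subst void_prob_eq[of ?a]) (auto intro!: derivative_eq_intros d)
  moreover have "eventually (\<lambda>x. exp (- ((LBINT t:{?a..}. 1 - H t) - integral {?a..x} (\<lambda>t. 1 - H t))) = void_prob H x) (nhds u)"
    using eventually_nhds_in_open[of "{?a<..}" u]
    by (auto elim!: eventually_mono simp: void_prob_eq[of ?a])
  ultimately show ?thesis
    by (subst (asm) DERIV_cong_ev[OF refl _ refl])
qed

lemma void_prob_meas: "void_prob H \<in> borel_measurable borel"
  by (intro borel_measurable_continuous_onI continuous_at_imp_continuous_on ballI)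
     (meson DERIV_isCont void_prob_deriv)

lemma void_prob_tendsto: "(void_prob H \<longlongrightarrow> 1) at_top"
proof -
  have eq: "integral {0..u} (\<lambda>t. 1 - H t) = (LBINT t:{..u}. (1 - H t) * indicator {0..} t)" for u
  proof -
    have "integral {0..u} (\<lambda>t. 1 - H t) = (LBINT t:{0..u}. 1 - H t)"
      by (intro set_borel_integral_eq_integral(2)[symmetric] void_int) auto
    also have "\<dots> = (LBINT t:{..u}. (1 - H t) * indicator {0..} t)"
      unfolding set_lebesgue_integral_def by (intro Bochner_Integration.integral_cong) (auto split: split_indicator)
    finally show ?thesis .
  qed
  have "((\<lambda>u. LBINT t:{..u}. (1 - H t) * indicator {0..} t) \<longlongrightarrow> (LBINT t. (1 - H t) * indicator {0..} t)) at_top"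
    unfolding set_lebesgue_integral_def
    by (intro tendsto_integral_at_top) (auto intro!: integrable_real_mult_indicator int)
  also have "(LBINT t. (1 - H t) * indicator {0..} t) = (LBINT t:{0..}. 1 - H t)"
    unfolding set_lebesgue_integral_def by (simp add: mult.commute)
  finally have "((\<lambda>u. exp (- ((LBINT t:{0..}. 1 - H t) - integral {0..u} (\<lambda>t. 1 - H t)))) \<longlongrightarrow> exp (- 0)) at_top"
    unfolding eq[symmetric] by (auto intro!: tendsto_eq_intros)
  moreover have "eventually (\<lambda>u. exp (- ((LBINT t:{0..}. 1 - H t) - integral {0..u} (\<lambda>t. 1 - H t))) = void_prob H u) at_top"
    using eventually_ge_at_top[of 0] by eventually_elim (simp add: void_prob_eq[of 0])
  ultimately show ?thesis by (simp cong: filterlim_cong)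
qed

text \<open>Writing V for \<open>void_prob H\<close>, the equation V' = (1 - H) V makes
  \<open>- exp (- t) * V (u + t)\<close> an antiderivative of
  \<open>exp (- t) * H (u + t) * V (u + t)\<close>, and it vanishes at infinity.\<close>

lemma void_prob_fixpoint: "(\<integral>t. H (u + t) * void_prob H (u + t) \<partial>exp_law) = void_prob H u"
proof -
  note [measurable] = H_meas void_prob_meas
  have "(\<integral>\<^sup>+t. ennreal (H (u + t) * void_prob H (u + t)) \<partial>exp_law)
      = (\<integral>\<^sup>+t. ennreal (exp (- t) * H (u + t) * void_prob H (u + t)) * indicator {0..} t \<partial>lborel)"
    unfolding exp_law_def
    by (subst nn_integral_density)
       (auto intro!: nn_integral_cong
          simp: exponential_density_def ennreal_mult[symmetric] H void_prob_bounds less_imp_le mult.assoc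
          split: split_indicator)
  also have "\<dots> = ennreal (0 - (- exp (- 0) * void_prob H (u + 0)))"
  proof (rule nn_integral_FTC_atLeast)
    show "((\<lambda>t. - exp (- t) * void_prob H (u + t)) has_real_derivative
            exp (- x) * H (u + x) * void_prob H (u + x)) (at x)" for x
      by (auto intro!: derivative_eq_intros DERIV_chain2[OF void_prob_deriv] simp: algebra_simps)
    have 1: "((\<lambda>t::real. - exp (- t)) \<longlongrightarrow> 0) at_top" by real_asymp
    have "filterlim (\<lambda>t. u + t) at_top at_top" by real_asymp
    hence 2: "((\<lambda>t. void_prob H (u + t)) \<longlongrightarrow> 1) at_top"
      by (rule filterlim_compose[OF void_prob_tendsto])
    show "((\<lambda>t. - exp (- t) * void_prob H (u + t)) \<longlongrightarrow> 0) at_top"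
      using tendsto_mult[OF 1 2] by simp
  qed (auto simp: H void_prob_bounds less_imp_le)
  finally show ?thesis
    by (intro integral_eq_nn_integral[THEN trans])
       (auto simp: H void_prob_bounds less_imp_le)
qed

text \<open>The one-step operator is monotone because \<open>H\<close> is nonnegative, and it fixes
  \<open>void_prob H\<close>, which lies below the starting value 1.\<close>

lemma poisson_prod_lower: "void_prob H u \<le> poisson_prod H n u"
  supply H_meas [measurable] void_prob_meas [measurable]
proof (induction n arbitrary: u)
  case 0
  show ?case by (simp add: poisson_prod_0 void_prob_bounds)
next
  case (Suc n)
  have "void_prob H u = (\<integral>t. H (u + t) * void_prob H (u + t) \<partial>exp_law)"
    by (simp add: void_prob_fixpoint)
  also have "\<dots> \<le> (\<integral>t. H (u + t) * poisson_prod H n (u + t) \<partial>exp_law)"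
    by (intro integral_mono exp_law_integrable mult_left_mono Suc.IH)
       (auto simp: H abs_mult void_prob_bounds less_imp_le poisson_prod_bounds intro!: mult_le_one)
  finally show ?case by (simp add: poisson_prod_Suc H)
qed

text \<open>The one-step operator \<open>f \<mapsto> (\<lambda>u. \<integral>t. H (u + t) * f (u + t) \<partial>exp_law)\<close> fixes \<open>void_prob H\<close> and
  at least halves \<open>exp (- u)\<close>, which turns a bound for large \<open>u\<close> into convergence.\<close>

lemma poisson_prod_upper:
  assumes "\<And>u. u \<ge> c \<Longrightarrow> void_prob H u \<ge> 1 - \<epsilon>" "\<epsilon> \<ge> 0"
  shows "poisson_prod H n u \<le> void_prob H u + \<epsilon> + (1 / 2) ^ n * exp (c - u)"
  supply H_meas [measurable] void_prob_meas [measurable]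
proof (induction n arbitrary: u)
  case 0
  \<comment> \<open>The starting value 1 is covered by \<epsilon> at times after \<open>c\<close>
    and by the exponential at times before \<open>c\<close>.\<close>
  show ?case
  proof (cases "u \<ge> c")
    case True
    thus ?thesis using assms(1)[OF True] exp_ge_zero[of "c - u"] by (simp add: poisson_prod_0 del: exp_ge_zero)
  next
    case False
    hence "1 \<le> exp (c - u)" by simp
    thus ?thesis using void_prob_bounds(1)[of u] assms(2)
      by (simp only: poisson_prod_0 power_0 mult_1)
  qed
next
  case (Suc n)
  interpret E: prob_space exp_law by (rule prob_space_exp_law)
  \<comment> \<open>A nonintegrable function has Bochner integral 0, whereas this integral is
    \<open>exp (- u) / 2\<close>.\<close>
  have ie: "integrable exp_law (\<lambda>t. exp (- (u + t)))"
  proof (rule ccontr)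
    assume "\<not> ?thesis"
    hence "(\<integral>t. exp (- (u + t)) \<partial>exp_law) = 0" by (rule not_integrable_integral_eq)
    thus False unfolding exp_law_integral_exp by simp
  qed
  have ie': "integrable exp_law (\<lambda>t. (1 / 2) ^ n * exp c * exp (- (u + t)))"
    using ie by simp
  have iv: "integrable exp_law (\<lambda>t. H (u + t) * void_prob H (u + t))"
    by (intro exp_law_integrable)
       (auto simp: H abs_mult void_prob_bounds less_imp_le intro!: mult_le_one)
  have "poisson_prod H (Suc n) u = (\<integral>t. H (u + t) * poisson_prod H n (u + t) \<partial>exp_law)"
    by (simp add: poisson_prod_Suc H)
  also have "\<dots> \<le> (\<integral>t. H (u + t) * void_prob H (u + t) + \<epsilon> + (1 / 2) ^ n * exp c * exp (- (u + t)) \<partial>exp_law)"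
  proof (intro integral_mono)
    show "integrable exp_law (\<lambda>t. H (u + t) * poisson_prod H n (u + t))"
      by (intro exp_law_integrable)
         (auto simp: H abs_mult poisson_prod_bounds intro!: mult_le_one)
    show "integrable exp_law (\<lambda>t. H (u + t) * void_prob H (u + t) + \<epsilon> + (1 / 2) ^ n * exp c * exp (- (u + t)))"
      using iv ie' by (intro Bochner_Integration.integrable_add) auto
    fix t
    have "H (u + t) * poisson_prod H n (u + t)
        \<le> H (u + t) * (void_prob H (u + t) + (\<epsilon> + (1 / 2) ^ n * exp (c - (u + t))))"
      using Suc.IH[of "u + t"] by (intro mult_left_mono) (auto simp: H)
    also have "\<dots> \<le> H (u + t) * void_prob H (u + t) + (\<epsilon> + (1 / 2) ^ n * exp (c - (u + t)))"
      using mult_left_le_one_le[OF _ H(1) H(2), of "\<epsilon> + (1 / 2) ^ n * exp (c - (u + t))" "u + t"] assms(2)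
      by (simp add: algebra_simps)
    finally show "H (u + t) * poisson_prod H n (u + t)
        \<le> H (u + t) * void_prob H (u + t) + \<epsilon> + (1 / 2) ^ n * exp c * exp (- (u + t))"
      by (simp add: mult.assoc flip: exp_add) (simp add: algebra_simps)
  qed
  also have "\<dots> = void_prob H u + \<epsilon> + (1 / 2) ^ n * exp c * (exp (- u) / 2)"
    using iv ie' E.prob_space by (simp add: void_prob_fixpoint exp_law_integral_exp del: minus_add_distrib)
  also have "\<dots> = void_prob H u + \<epsilon> + (1 / 2) ^ Suc n * exp (c - u)"
    by (simp add: exp_diff exp_minus field_simps)
  finally show ?case .
qed

theorem poisson_prod_tendsto: "(\<lambda>n. poisson_prod H n u) \<longlonglongrightarrow> void_prob H u"
proof (rule LIMSEQ_I)
  fix r :: real assume r: "0 < r"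
  have "eventually (\<lambda>u. void_prob H u > 1 - r / 2) at_top"
    using void_prob_tendsto r by (intro order_tendstoD(1)[of _ 1]) auto
  then obtain c where c: "\<And>u. u \<ge> c \<Longrightarrow> void_prob H u \<ge> 1 - r / 2"
    by (auto simp: eventually_at_top_linorder intro: less_imp_le)
  have "(\<lambda>n. (1 / 2) ^ n * exp (c - u)) \<longlonglongrightarrow> 0" by real_asymp
  hence "eventually (\<lambda>n. (1 / 2) ^ n * exp (c - u) < r / 2) sequentially"
    using r by (intro order_tendstoD(2)[of _ 0]) auto
  then obtain N where N: "\<And>n. n \<ge> N \<Longrightarrow> (1 / 2) ^ n * exp (c - u) < r / 2"
    by (auto simp: eventually_at_top_linorder)
  have "norm (poisson_prod H n u - void_prob H u) < r" if "n \<ge> N" for n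
    using N[OF that] poisson_prod_lower[of u n] poisson_prod_upper[of c "r / 2" n u] c r by auto
  thus "\<exists>no. \<forall>n\<ge>no. norm (poisson_prod H n u - void_prob H u) < r" by blast
qed

end

section \<open>Independent marks attached to the points\<close>

lemma PiM_integral_prod:
  fixes f :: "nat \<Rightarrow> 'a \<Rightarrow> real"
  assumes "prob_space \<eta>" and f [measurable]: "\<And>i. f i \<in> borel_measurable \<eta>"
    and bound: "\<And>i x. \<bar>f i x\<bar> \<le> 1"
  shows "(\<integral>g. (\<Prod>i<n. f i (g i)) \<partial>(\<Pi>\<^sub>M i\<in>(UNIV :: nat set). \<eta>)) = (\<Prod>i<n. \<integral>x. f i x \<partial>\<eta>)"
proof -
  interpret eta: prob_space \<eta> by fact
  interpret P: product_prob_space "\<lambda>_. \<eta>" "UNIV :: nat set" ..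
  have "(\<integral>g. (\<Prod>i<n. f i (g i)) \<partial>(\<Pi>\<^sub>M i\<in>(UNIV :: nat set). \<eta>))
      = (\<integral>g. (\<Prod>i<n. f i (g i)) \<partial>distr (\<Pi>\<^sub>M i\<in>(UNIV :: nat set). \<eta>) (\<Pi>\<^sub>M i\<in>{..<n}. \<eta>) (\<lambda>x. restrict x {..<n}))"
    by (subst integral_distr) (auto intro!: measurable_restrict)
  also have "\<dots> = (\<integral>g. (\<Prod>i<n. f i (g i)) \<partial>(\<Pi>\<^sub>M i\<in>{..<n}. \<eta>))"
    by (subst P.distr_PiM_restrict_finite) auto
  also have "\<dots> = (\<Prod>i<n. \<integral>x. f i x \<partial>\<eta>)"
    by (intro P.product_integral_prod) (auto intro!: eta.integrable_const_bound[where B=1] simp: bound)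
  finally show ?thesis .
qed

text \<open>The first component holds the gaps, whose partial sums are the points; the second holds
  the marks.\<close>

definition marked_poisson :: "real measure \<Rightarrow> ((nat \<Rightarrow> real) \<times> (nat \<Rightarrow> real)) measure" where
  "marked_poisson \<eta> = (\<Pi>\<^sub>M j\<in>(UNIV :: nat set). exp_law) \<Otimes>\<^sub>M (\<Pi>\<^sub>M i\<in>(UNIV :: nat set). \<eta>)"

lemma prob_space_marked_poisson: "prob_space \<eta> \<Longrightarrow> prob_space (marked_poisson \<eta>)"
  unfolding marked_poisson_def by (intro prob_space_pair prob_space_PiM prob_space_exp_law)

lemma sets_marked_poisson:
  "sets \<eta> = sets borel \<Longrightarrow> sets (marked_poisson \<eta>) =
    sets ((\<Pi>\<^sub>M j\<in>(UNIV :: nat set). borel :: real measure) \<Otimes>\<^sub>M (\<Pi>\<^sub>M i\<in>(UNIV :: nat set). borel :: real measure))"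
  unfolding marked_poisson_def by (intro sets_pair_measure_cong sets_PiM_cong) auto

lemma space_marked_poisson [simp]: "sets \<eta> = sets borel \<Longrightarrow> space (marked_poisson \<eta>) = UNIV"
  by (auto simp: marked_poisson_def space_pair_measure space_PiM dest: sets_eq_imp_space_eq)

text \<open>Fubini: for fixed gaps the marks are independent, so each factor may be replaced by its
  mean at the corresponding point.\<close>

lemma marked_poisson_prod:
  fixes h :: "real \<Rightarrow> real \<Rightarrow> real"
  assumes "prob_space \<eta>" and sets [measurable_cong]: "sets \<eta> = sets borel"
    and h_meas: "(\<lambda>(t, g). h t g) \<in> borel_measurable (borel \<Otimes>\<^sub>M borel)"
    and h: "\<And>t g. 0 \<le> h t g" "\<And>t g. h t g \<le> 1"
  shows "(\<integral>x. (\<Prod>i<n. h (\<Sum>j\<le>i. fst x j) (snd x i)) \<partial>marked_poisson \<eta>)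
       = poisson_prod (\<lambda>t. \<integral>g. h t g \<partial>\<eta>) n 0"
proof -
  let ?S = "\<Pi>\<^sub>M j\<in>(UNIV :: nat set). exp_law"
  let ?N = "\<Pi>\<^sub>M i\<in>(UNIV :: nat set). \<eta>"
  interpret eta: prob_space \<eta> by fact
  interpret S: prob_space ?S by (intro prob_space_PiM prob_space_exp_law)
  interpret N: prob_space ?N by (intro prob_space_PiM assms)
  interpret P: pair_prob_space ?S ?N ..
  have [measurable]: "(\<lambda>x. h (f x) (g x)) \<in> borel_measurable M"
    if "f \<in> borel_measurable M" "g \<in> borel_measurable M" for f g and M :: "'x measure"
    using measurable_compose[OF measurable_Pair[OF that] h_meas] by simp
  have hm [measurable]: "h t \<in> borel_measurable \<eta>" for t
    using measurable_compose[OF measurable_Pair[OF measurable_const[of t] measurable_ident_sets[OF sets]] h_meas]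
    by simp
  have "(\<integral>x. (\<Prod>i<n. h (\<Sum>j\<le>i. fst x j) (snd x i)) \<partial>marked_poisson \<eta>)
      = (\<integral>e. (\<integral>g. (\<Prod>i<n. h (\<Sum>j\<le>i. e j) (g i)) \<partial>?N) \<partial>?S)"
    unfolding marked_poisson_def
  proof (subst P.integral_fst'[symmetric])
    show "integrable (?S \<Otimes>\<^sub>M ?N) (\<lambda>x. \<Prod>i<n. h (\<Sum>j\<le>i. fst x j) (snd x i))"
      by (intro P.integrable_const_bound[where B=1] AE_I2)
         (auto simp: h abs_prod intro!: prod_le_1)
  qed simp
  also have "\<dots> = (\<integral>e. (\<Prod>i<n. \<integral>g. h (\<Sum>j\<le>i. e j) g \<partial>\<eta>) \<partial>?S)"
    by (subst PiM_integral_prod) (auto simp: h assms(1))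
  finally show ?thesis by (simp add: poisson_prod_def)
qed

text \<open>The infinite product enters only through its almost sure limit \<open>q\<close>, so one
  statement, proved by dominated convergence, serves both the Laplace transform of a series and the
  generating function of a count.\<close>

theorem marked_poisson_tendsto:
  fixes h :: "real \<Rightarrow> real \<Rightarrow> real"
  assumes "prob_space \<eta>" and sets: "sets \<eta> = sets borel"
    and h_meas: "(\<lambda>(t, g). h t g) \<in> borel_measurable (borel \<Otimes>\<^sub>M borel)"
    and h: "\<And>t g. 0 \<le> h t g" "\<And>t g. h t g \<le> 1"
    and cont: "continuous_on UNIV (\<lambda>t. \<integral>g. h t g \<partial>\<eta>)"
    and int: "integrable lborel (\<lambda>t. 1 - (\<integral>g. h t g \<partial>\<eta>))"
    and lim: "AE x in marked_poisson \<eta>. (\<lambda>n. \<Prod>i<n. h (\<Sum>j\<le>i. fst x j) (snd x i)) \<longlonglongrightarrow> q x"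
    and q: "q \<in> borel_measurable (marked_poisson \<eta>)"
  shows "(\<integral>x. q x \<partial>marked_poisson \<eta>) = exp (- (LBINT t:{0..}. 1 - (\<integral>g. h t g \<partial>\<eta>)))"
proof -
  interpret eta: prob_space \<eta> by fact
  interpret P: prob_space "marked_poisson \<eta>" using assms(1) by (rule prob_space_marked_poisson)
  note sets_marked_poisson[OF sets, measurable_cong]
  have [measurable]: "(\<lambda>x. h (f x) (g x)) \<in> borel_measurable M"
    if "f \<in> borel_measurable M" "g \<in> borel_measurable M" for f g and M :: "'x measure"
    using measurable_compose[OF measurable_Pair[OF that] h_meas] by simp
  have "(\<lambda>n. \<integral>x. (\<Prod>i<n. h (\<Sum>j\<le>i. fst x j) (snd x i)) \<partial>marked_poisson \<eta>) \<longlonglongrightarrow> (\<integral>x. q x \<partial>marked_poisson \<eta>)"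
    by (rule integral_dominated_convergence[where w="\<lambda>_. 1"])
       (use lim q in \<open>auto simp: h abs_prod intro!: prod_le_1 AE_I2\<close>)
  moreover have "(\<lambda>n. \<integral>x. (\<Prod>i<n. h (\<Sum>j\<le>i. fst x j) (snd x i)) \<partial>marked_poisson \<eta>)
      \<longlonglongrightarrow> void_prob (\<lambda>t. \<integral>g. h t g \<partial>\<eta>) 0"
  proof -
    have hm [measurable]: "h t \<in> borel_measurable \<eta>" for t
      using measurable_compose[OF measurable_Pair[OF measurable_const[of t] measurable_ident_sets[OF sets]] h_meas]
      by simp
    have ih: "integrable \<eta> (h t)" for t
      by (intro eta.integrable_const_bound[where B=1] AE_I2)
         (auto simp: h)
    have "(\<integral>g. h t g \<partial>\<eta>) \<le> 1" for t
      using eta.integral_le_const[OF ih, of _ 1] by (simp add: h)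
    moreover have "0 \<le> (\<integral>g. h t g \<partial>\<eta>)" for t
      by (simp add: h)
    ultimately show ?thesis
      unfolding marked_poisson_prod[OF assms(1,2) h_meas h]
      by (intro poisson_prod_tendsto cont int)
  qed
  ultimately show ?thesis
    unfolding void_prob_def by (rule LIMSEQ_unique)
qed

section \<open>The Laplace transform of \<open>W\<close>\<close>

lemma abs_powr: "\<bar>t\<bar> powr p = t powr p" for t p :: real
  using ln_minus[of t] by (auto simp: powr_def abs_real_def)

text \<open>The product with \<open>1 + t\<^sup>2\<close> tends to 0, which settles large
  \<open>t\<close>; smaller nonnegative \<open>t\<close> are bounded trivially, and evenness of
  \<open>powr\<close> in its base gives the negative ones.\<close>

lemma stretched_exp_bound:
  fixes c p :: real
  assumes "c > 0" "p > 0"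
  obtains K where "K > 0" "\<And>t. exp (- c * t powr p) \<le> K * inverse (1 + t\<^sup>2)"
proof -
  have "((\<lambda>t. (1 + t\<^sup>2) * exp (- c * t powr p)) \<longlongrightarrow> 0) at_top"
    using assms by real_asymp
  hence "eventually (\<lambda>t. (1 + t\<^sup>2) * exp (- c * t powr p) < 1) at_top"
    by (rule order_tendstoD) simp
  then obtain K where K: "\<And>t. t \<ge> K \<Longrightarrow> (1 + t\<^sup>2) * exp (- c * t powr p) < 1"
    by (auto simp: eventually_at_top_linorder)
  have le: "(1 + t\<^sup>2) * exp (- c * t powr p) \<le> 1 + K\<^sup>2" if "t \<ge> 0" for t
  proof (cases "t \<ge> K")
    case True
    thus ?thesis using K[of t] by (smt (verit) zero_le_power2)
  next
    case False
    have "(1 + t\<^sup>2) * exp (- c * t powr p) \<le> (1 + t\<^sup>2) * 1"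
      using assms by (intro mult_left_mono) auto
    also have "\<dots> \<le> 1 + K\<^sup>2" using False that by (simp add: power_mono)
    finally show ?thesis .
  qed
  have "exp (- c * t powr p) \<le> (1 + K\<^sup>2) * inverse (1 + t\<^sup>2)" for t
  proof -
    have "(1 + t\<^sup>2) * exp (- c * t powr p) \<le> 1 + K\<^sup>2"
      using le[of "\<bar>t\<bar>"] by (simp add: abs_powr)
    thus ?thesis by (simp add: field_simps add_pos_nonneg)
  qed
  moreover have "1 + K\<^sup>2 > 0" by (simp add: add_pos_nonneg)
  ultimately show ?thesis using that by blast
qed

lemma stretched_exp_integrable:
  fixes c p :: real
  assumes "c > 0" "p > 0"
  shows "integrable lborel (\<lambda>t. exp (- c * t powr p))"
proof -
  obtain K where K: "K > 0" "\<And>t. exp (- c * t powr p) \<le> K * inverse (1 + t\<^sup>2)"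
    using stretched_exp_bound[OF assms] by blast
  have "integrable lborel (\<lambda>t::real. K * inverse (1 + t\<^sup>2))"
    using integrable_inverse_1_plus_square by (simp add: set_integrable_def)
  thus ?thesis
    by (rule Bochner_Integration.integrable_bound) (use K in auto)
qed

lemma lam_pos: "s > 0 \<Longrightarrow> lam s > 0"
  using Gamma_real_pos[OF add_pos_pos[OF zero_less_one divide_pos_pos[OF zero_less_one]], of s]
  by (simp add: lam_def)

lemma measurable_summable [measurable (raw)]:
  fixes f :: "'a \<Rightarrow> nat \<Rightarrow> real"
  assumes [measurable]: "\<And>i. (\<lambda>x. f x i) \<in> borel_measurable M"
  shows "Measurable.pred M (\<lambda>x. summable (f x))"
  unfolding summable_iff_convergent Cauchy_convergent_iff[symmetric] by measurable

locale W_fixpoint =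
  fixes s :: real and \<mu> :: "real measure"
  assumes s_pos: "s > 0" and W_law: "W_law s \<mu>"
begin

sublocale real_distribution \<mu>
  using W_law by (simp add: W_law_def)

lemma AE_pos: "AE x in \<mu>. 0 < x"
  using W_law by (simp add: W_law_def)

lemma mean_int [simp]: "integrable \<mu> (\<lambda>x. x)"
  using W_law by (simp add: W_law_def)

lemma mean_eq [simp]: "(\<integral>x. x \<partial>\<mu>) = 1"
  using W_law by (simp add: W_law_def)

definition phi :: "real \<Rightarrow> real" where
  "phi \<theta> = (\<integral>w. exp (- \<theta> * w) \<partial>\<mu>)"

text \<open>In Isabelle \<open>t powr s = \<bar>t\<bar> powr s\<close>, so \<open>kap\<close> is even and continuous on the whole line.\<close>

definition kap :: "real \<Rightarrow> real" where
  "kap t = lam s * t powr s"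

lemma lam_s_pos [simp]: "lam s > 0"
  using lam_pos[OF s_pos] .

lemma kap_nonneg [simp]: "kap t \<ge> 0"
  by (simp add: kap_def less_imp_le)

lemma kap_cont: "continuous_on UNIV kap"
  unfolding kap_def
proof (rule continuous_on_mult_left)
  have "continuous_on UNIV (\<lambda>t::real. \<bar>t\<bar> powr s)"
    using s_pos by (intro continuous_on_powr' continuous_intros) auto
  thus "continuous_on UNIV (\<lambda>t::real. t powr s)"
    by (simp add: abs_powr)
qed

lemma kap_meas [measurable]: "kap \<in> borel_measurable borel"
  using kap_cont by (rule borel_measurable_continuous_onI)

lemma exp_kap_integrable: "integrable lborel (\<lambda>t. exp (- kap t))"
  unfolding kap_def using stretched_exp_integrable[of "lam s" s] s_pos by simp

lemma exp_W_integrable: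
  assumes "\<theta> \<ge> 0"
  shows "integrable \<mu> (\<lambda>w. exp (- \<theta> * w))"
  by (rule integrable_const_bound[where B=1]) (use AE_pos assms in \<open>auto elim!: eventually_mono\<close>)

lemma phi_pos: "\<theta> \<ge> 0 \<Longrightarrow> 0 < phi \<theta>"
proof (rule ccontr)
  assume "\<theta> \<ge> 0" "\<not> 0 < phi \<theta>"
  moreover have "phi \<theta> \<ge> 0" by (simp add: phi_def)
  ultimately have "(\<integral>w. exp (- \<theta> * w) \<partial>\<mu>) = 0" unfolding phi_def by linarith
  hence "AE w in \<mu>. exp (- \<theta> * w) = 0"
    using exp_W_integrable[OF \<open>\<theta> \<ge> 0\<close>] by (subst (asm) integral_nonneg_eq_0_iff_AE) auto
  thus False by simp
qed

lemma phi_le_1: "\<theta> \<ge> 0 \<Longrightarrow> phi \<theta> \<le> 1"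
  unfolding phi_def
  by (rule integral_le_const[OF exp_W_integrable]) (use AE_pos in \<open>auto elim!: eventually_mono\<close>)

text \<open>The Lipschitz constant 1 is the mean of W: for w > 0 the difference of the two
  exponentials is at most (\<theta> - \<theta>') w.\<close>

lemma phi_diff_le:
  assumes "0 \<le> \<theta>'" "\<theta>' \<le> \<theta>"
  shows "phi \<theta>' - phi \<theta> \<le> \<theta> - \<theta>'" "phi \<theta> \<le> phi \<theta>'"
proof -
  have "phi \<theta>' - phi \<theta> = (\<integral>w. exp (- \<theta>' * w) - exp (- \<theta> * w) \<partial>\<mu>)"
    unfolding phi_def using assms
    by (intro Bochner_Integration.integral_diff[symmetric] exp_W_integrable) auto
  also have "\<dots> \<le> (\<integral>w. (\<theta> - \<theta>') * w \<partial>\<mu>)"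
  proof (rule integral_mono_AE)
    show "AE w in \<mu>. exp (- \<theta>' * w) - exp (- \<theta> * w) \<le> (\<theta> - \<theta>') * w"
      using AE_pos
    proof eventually_elim
      case (elim w)
      have "exp (- \<theta>' * w) * (1 - exp (- ((\<theta> - \<theta>') * w))) \<le> 1 * ((\<theta> - \<theta>') * w)"
        using elim assms exp_ge_add_one_self[of "- ((\<theta> - \<theta>') * w)"]
        by (intro mult_mono) auto
      thus ?case by (simp add: algebra_simps flip: exp_add)
    qed
  qed (use assms in \<open>auto intro!: exp_W_integrable[simplified]\<close>)
  finally show "phi \<theta>' - phi \<theta> \<le> \<theta> - \<theta>'" by simp
  show "phi \<theta> \<le> phi \<theta>'"
    unfolding phi_def
    by (intro integral_mono_AE exp_W_integrable)
       (use assms AE_pos in \<open>auto elim!: eventually_mono intro!: mult_right_mono\<close>)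
qed

lemma phi_0: "phi 0 = 1"
  using prob_space by (simp add: phi_def)

lemma phi_ge: "\<theta> \<ge> 0 \<Longrightarrow> 1 - phi \<theta> \<le> \<theta>"
  using phi_diff_le(1)[of 0 \<theta>] by (simp add: phi_0)

lemma phi_cont: "continuous_on {0..} phi"
proof -
  have "dist (phi x) (phi y) \<le> 1 * dist x y" if "x \<ge> 0" "y \<ge> 0" for x y
    using phi_diff_le[of x y] phi_diff_le[of y x] that by (cases "x \<le> y") (auto simp: dist_real_def)
  hence "1-lipschitz_on {0..} phi" by (auto intro!: lipschitz_onI)
  thus ?thesis by (rule lipschitz_on_continuous_on)
qed

lemma phi_kap_cont: "\<theta> \<ge> 0 \<Longrightarrow> continuous_on UNIV (\<lambda>t. phi (\<theta> * exp (- kap t)))"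
  by (intro continuous_on_compose2[OF phi_cont] continuous_intros kap_cont) auto

lemma phi_kap_integrable:
  assumes "\<theta> \<ge> 0"
  shows "integrable lborel (\<lambda>t. 1 - phi (\<theta> * exp (- kap t)))"
proof (rule Bochner_Integration.integrable_bound)
  show "integrable lborel (\<lambda>t. \<theta> * exp (- kap t))" using exp_kap_integrable by simp
  show "(\<lambda>t. 1 - phi (\<theta> * exp (- kap t))) \<in> borel_measurable lborel"
    using borel_measurable_continuous_onI[OF phi_kap_cont[OF assms]] by simp
  show "AE t in lborel. norm (1 - phi (\<theta> * exp (- kap t))) \<le> norm (\<theta> * exp (- kap t))"
    using assms by (auto simp: phi_ge phi_le_1)
qed

text \<open>The absolute values make the partial sums monotone at every sample point. Hence the
  products always converge, to 0 where the series diverges, and no convergence of the series has to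
  be known beforehand.\<close>

lemma W_weighted_sum_limit:
  fixes \<theta> :: real
  assumes "\<theta> > 0"
  defines "a \<equiv> \<lambda>(x :: (nat \<Rightarrow> real) \<times> (nat \<Rightarrow> real)) i. exp (- kap (\<Sum>j\<le>i. fst x j)) * \<bar>snd x i\<bar>"
  shows "(\<integral>x. (if summable (a x) then exp (- \<theta> * suminf (a x)) else 0) \<partial>marked_poisson \<mu>)
       = exp (- (LBINT t:{0..}. 1 - phi (\<theta> * exp (- kap t))))"
proof -
  have sets: "sets \<mu> = sets borel" by simp
  note sets_marked_poisson[OF sets, measurable_cong]
  define h where "h = (\<lambda>t w. exp (- \<theta> * exp (- kap t) * \<bar>w\<bar>))"
  have hbar: "(\<integral>g. h t g \<partial>\<mu>) = phi (\<theta> * exp (- kap t))" for t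
    unfolding h_def phi_def
  proof (rule integral_cong_AE)
    show "AE w in \<mu>. exp (- \<theta> * exp (- kap t) * \<bar>w\<bar>) = exp (- (\<theta> * exp (- kap t)) * w)"
      using AE_pos by eventually_elim simp
  qed auto
  have lim: "(\<lambda>n. \<Prod>i<n. h (\<Sum>j\<le>i. fst x j) (snd x i)) \<longlonglongrightarrow>
      (if summable (a x) then exp (- \<theta> * suminf (a x)) else 0)" for x
  proof -
    have eq: "(\<Prod>i<n. h (\<Sum>j\<le>i. fst x j) (snd x i)) = exp (- \<theta> * (\<Sum>i<n. a x i))" for n
      by (simp add: h_def a_def exp_sum sum_distrib_left mult.assoc flip: sum_negf)
    show ?thesis
    proof (cases "summable (a x)")
      case True
      have "(\<lambda>n. exp (- \<theta> * (\<Sum>i<n. a x i))) \<longlonglongrightarrow> exp (- \<theta> * suminf (a x))"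
        by (intro tendsto_intros summable_LIMSEQ True)
      thus ?thesis using True by (simp add: eq)
    next
      case False
      have "filterlim (\<lambda>n. \<Sum>i<n. a x i) at_top sequentially"
      proof (rule ccontr)
        assume "\<not> ?thesis"
        then obtain Z where "\<not> eventually (\<lambda>n. Z \<le> (\<Sum>i<n. a x i)) sequentially"
          by (auto simp: filterlim_at_top)
        hence ex: "\<exists>m\<ge>n. (\<Sum>i<m. a x i) < Z" for n
          by (auto simp: eventually_sequentially not_le)
        have "(\<Sum>i<n. a x i) \<le> Z" for n
        proof -
          obtain m where "m \<ge> n" "(\<Sum>i<m. a x i) < Z" using ex[of n] by blast
          moreover have "(\<Sum>i<n. a x i) \<le> (\<Sum>i<m. a x i)"
            using \<open>m \<ge> n\<close> by (intro sum_mono2) (auto simp: a_def)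
          ultimately show ?thesis by simp
        qed
        hence "summable (a x)" by (intro summableI_nonneg_bounded[of _ Z]) (auto simp: a_def)
        thus False using False by simp
      qed
      hence "(\<lambda>n. exp (- \<theta> * (\<Sum>i<n. a x i))) \<longlonglongrightarrow> 0"
        using assms(1)
        by (intro filterlim_compose[OF exp_at_bot] filterlim_tendsto_neg_mult_at_bot[OF tendsto_const]) auto
      thus ?thesis using False by (simp add: eq)
    qed
  qed
  have [measurable]: "(\<lambda>x. a x i) \<in> borel_measurable (marked_poisson \<mu>)" for i
    unfolding a_def by measurable
  show ?thesis
    unfolding hbar[symmetric]
  proof (rule marked_poisson_tendsto[where h = h])
    show "continuous_on UNIV (\<lambda>t. expectation (h t))"
      unfolding hbar using assms(1) by (intro phi_kap_cont) auto
    show "integrable lborel (\<lambda>t. 1 - expectation (h t))"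
      unfolding hbar using assms(1) by (intro phi_kap_integrable) auto
    show "(\<lambda>x. if summable (a x) then exp (- \<theta> * suminf (a x)) else 0) \<in> borel_measurable (marked_poisson \<mu>)"
      by measurable
    show "(\<lambda>(t, g). h t g) \<in> borel_measurable (borel \<Otimes>\<^sub>M borel)"
      unfolding h_def by measurable
  qed (use lim assms(1) in \<open>auto simp: h_def prob_space_axioms\<close>)
qed

text \<open>The set where the series converges contains the set where the limit of the products is positive;
  its probability is at least \<open>exp (- \<theta> K)\<close> for every \<open>\<theta> > 0\<close>.\<close>

lemma W_series_summable:
  "AE x in marked_poisson \<mu>. summable (\<lambda>i. exp (- kap (\<Sum>j\<le>i. fst x j)) * \<bar>snd x i\<bar>)"
proof -
  have sets: "sets \<mu> = sets borel" by simp
  note sets_marked_poisson[OF sets, measurable_cong]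
  interpret P: prob_space "marked_poisson \<mu>"
    using prob_space_axioms by (rule prob_space_marked_poisson)
  define a where "a = (\<lambda>(x :: (nat \<Rightarrow> real) \<times> (nat \<Rightarrow> real)) i. exp (- kap (\<Sum>j\<le>i. fst x j)) * \<bar>snd x i\<bar>)"
  have [measurable]: "(\<lambda>x. a x i) \<in> borel_measurable (marked_poisson \<mu>)" for i
    unfolding a_def by measurable
  define K where "K = (LBINT t:{0..}. exp (- kap t))"
  let ?A = "{x \<in> space (marked_poisson \<mu>). summable (a x)}"
  have "exp (- \<theta> * K) \<le> P.prob ?A" if "\<theta> > 0" for \<theta> :: real
  proof -
    \<comment> \<open>Mean one enters here: \<open>1 - phi \<theta> \<le> \<theta>\<close> bounds
      the exponent linearly in \<theta>, so that \<theta> can decrease to 0 afterwards.\<close>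
    have "(LBINT t:{0..}. 1 - phi (\<theta> * exp (- kap t))) \<le> (LBINT t:{0..}. \<theta> * exp (- kap t))"
    proof (rule set_integral_mono)
      show "set_integrable lborel {0..} (\<lambda>t. 1 - phi (\<theta> * exp (- kap t)))"
        using phi_kap_integrable[of \<theta>] that unfolding set_integrable_def
        by (intro integrable_mult_indicator) auto
      show "set_integrable lborel {0..} (\<lambda>t. \<theta> * exp (- kap t))"
        using exp_kap_integrable unfolding set_integrable_def
        by (intro integrable_mult_indicator) auto
    qed (use that in \<open>auto intro!: phi_ge\<close>)
    also have "\<dots> = \<theta> * K" by (simp add: K_def)
    finally have "exp (- \<theta> * K) \<le> exp (- (LBINT t:{0..}. 1 - phi (\<theta> * exp (- kap t))))" by simp
    also have "\<dots> = (\<integral>x. (if summable (a x) then exp (- \<theta> * suminf (a x)) else 0) \<partial>marked_poisson \<mu>)"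
      unfolding a_def by (rule W_weighted_sum_limit[OF that, symmetric])
    also have "\<dots> \<le> (\<integral>x. indicator ?A x \<partial>marked_poisson \<mu>)"
    proof (rule integral_mono)
      have *: "summable (a x) \<Longrightarrow> 0 \<le> \<theta> * suminf (a x)" for x
        using that by (intro mult_nonneg_nonneg suminf_nonneg) (auto simp: a_def)
      show "integrable (marked_poisson \<mu>) (\<lambda>x. if summable (a x) then exp (- \<theta> * suminf (a x)) else 0)"
        by (intro P.integrable_const_bound[where B=1] AE_I2) (use * in auto)
      show "(if summable (a x) then exp (- \<theta> * suminf (a x)) else 0) \<le> indicator ?A x"
        if "x \<in> space (marked_poisson \<mu>)" for x
        using that * by auto
      show "integrable (marked_poisson \<mu>) (\<lambda>x. indicator ?A x :: real)"
        by (rule P.integrable_const_bound[where B=1]) (auto simp: indicator_def simp del: space_marked_poisson)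
    qed
    also have "\<dots> = P.prob ?A" by simp
    finally show ?thesis .
  qed
  hence "eventually (\<lambda>\<theta>. exp (- \<theta> * K) \<le> P.prob ?A) (at_right 0)"
    by (auto simp: eventually_at_right_less[of 0] elim!: eventually_mono intro: eventually_mono[OF eventually_at_right_less])
  moreover have "((\<lambda>\<theta>. exp (- \<theta> * K)) \<longlongrightarrow> exp (- 0 * K)) (at_right 0)"
    by (intro tendsto_intros)
  ultimately have "1 \<le> P.prob ?A"
    using tendsto_upperbound[of "\<lambda>\<theta>. exp (- \<theta> * K)" 1 "at_right 0" "P.prob ?A"] by simp
  hence "P.prob ?A = 1" using P.prob_le_1[of ?A] by linarith
  moreover have "?A \<in> sets (marked_poisson \<mu>)" by measurable
  ultimately have "AE x in marked_poisson \<mu>. x \<in> ?A" by (simp only: P.AE_in_set_eq_1)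
  thus ?thesis by (auto simp: a_def elim!: eventually_mono)
qed

lemma AE_marks_pos: "AE x in marked_poisson \<mu>. \<forall>i. 0 < snd x i"
proof -
  interpret S: prob_space "\<Pi>\<^sub>M j\<in>(UNIV :: nat set). exp_law"
    by (intro prob_space_PiM prob_space_exp_law)
  interpret N: prob_space "\<Pi>\<^sub>M j\<in>(UNIV :: nat set). \<mu>"
    by (intro prob_space_PiM prob_space_axioms)
  interpret P: pair_prob_space "\<Pi>\<^sub>M j\<in>(UNIV :: nat set). exp_law" "\<Pi>\<^sub>M j\<in>(UNIV :: nat set). \<mu>" ..
  have "AE w in (\<Pi>\<^sub>M j\<in>(UNIV :: nat set). \<mu>). \<forall>i. 0 < w i"
    unfolding AE_all_countable by (intro allI AE_PiM_component prob_space_axioms AE_pos) auto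
  thus ?thesis
    unfolding marked_poisson_def by (subst P.AE_pair_iff[symmetric]) auto
qed

text \<open>The distributional equation is tested against \<open>exp (- \<theta> * y)\<close>.
  Positivity of the marks and summability, both almost sure, identify the series in
  \<open>W_law\<close> with the one carrying absolute values.\<close>

theorem phi_fixpoint:
  assumes "\<theta> > 0"
  shows "phi \<theta> = exp (- (LBINT t:{0..}. 1 - phi (\<theta> * exp (- kap t))))"
proof -
  have sets: "sets \<mu> = sets borel" by simp
  note sets_marked_poisson[OF sets, measurable_cong]
  define Y where "Y = (\<lambda>x :: (nat \<Rightarrow> real) \<times> (nat \<Rightarrow> real). \<Sum>i. exp (- lam s * arrival s (fst x) i) * snd x i)"
  have Ym [measurable]: "Y \<in> borel_measurable (marked_poisson \<mu>)"
    unfolding Y_def arrival_def by measurable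
  have mu: "\<mu> = distr (marked_poisson \<mu>) borel Y"
    using W_law by (simp add: W_law_def Y_def marked_poisson_def case_prod_beta')
  define a where "a = (\<lambda>(x :: (nat \<Rightarrow> real) \<times> (nat \<Rightarrow> real)) i. exp (- kap (\<Sum>j\<le>i. fst x j)) * \<bar>snd x i\<bar>)"
  have am [measurable]: "(\<lambda>x. a x i) \<in> borel_measurable (marked_poisson \<mu>)" for i
    unfolding a_def by measurable
  have "phi \<theta> = (\<integral>y. exp (- \<theta> * y) \<partial>distr (marked_poisson \<mu>) borel Y)"
    unfolding phi_def using mu by simp
  also have "\<dots> = (\<integral>x. exp (- \<theta> * Y x) \<partial>marked_poisson \<mu>)"
    by (subst integral_distr) auto
  also have "\<dots> = (\<integral>x. (if summable (a x) then exp (- \<theta> * suminf (a x)) else 0) \<partial>marked_poisson \<mu>)"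
  proof (rule integral_cong_AE)
    show "AE x in marked_poisson \<mu>. exp (- \<theta> * Y x) = (if summable (a x) then exp (- \<theta> * suminf (a x)) else 0)"
      using W_series_summable AE_marks_pos
    proof eventually_elim
      case (elim x)
      have "Y x = suminf (a x)"
        unfolding Y_def a_def using elim(2) by (simp add: kap_def arrival_def less_imp_le)
      thus ?case using elim(1) by (simp add: a_def)
    qed
  qed measurable
  also have "\<dots> = exp (- (LBINT t:{0..}. 1 - phi (\<theta> * exp (- kap t))))"
    unfolding a_def by (rule W_weighted_sum_limit[OF assms])
  finally show ?thesis .
qed

end

section \<open>The distribution function \<open>F\<close> and the intensity \<open>nu\<close>\<close>

lemma set_lborel_integral_const: "a \<le> b \<Longrightarrow> (LBINT t:{a..b}. c) = (b - a) * (c :: real)"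
  by (simp add: set_lebesgue_integral_def)

lemma indicator_Icc_integrable: "integrable lborel (indicat_real {a..b :: real})"
  by (rule integrable_real_indicator) (auto simp: emeasure_lborel_Icc_eq)

lemma Icc_integrable: "set_integrable lborel {0..} (\<lambda>t::real. indicator {0..b} t :: real)"
  unfolding set_integrable_def by (intro integrable_mult_indicator indicator_Icc_integrable) auto

lemma exp_decay_integrable: "\<beta> > 0 \<Longrightarrow> set_integrable lborel {0..} (\<lambda>t::real. exp (- \<beta> * t))"
proof -
  assume "\<beta> > 0"
  hence "set_integrable lborel {0..} (\<lambda>t::real. exp (- \<beta> * t powr 1))"
    unfolding set_integrable_def by (intro integrable_mult_indicator stretched_exp_integrable) auto
  thus ?thesis by (rule set_integrable_cong[THEN iffD1, rotated -1]) auto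
qed

context W_fixpoint
begin

text \<open>If \<open>\<Lambda>\<close> is standard Gumbel, then \<open>P (\<Lambda> + log W \<le> x) = E (exp (- exp (- x) W))\<close>.\<close>

definition F :: "real \<Rightarrow> real" where
  "F x = phi (exp (- x))"

lemma F_pos [simp]: "0 < F x"
  by (simp add: F_def phi_pos)

lemma F_nonneg [simp]: "0 \<le> F x"
  by (simp add: less_imp_le)

lemma F_le_1 [simp]: "F x \<le> 1"
  by (simp add: F_def phi_le_1)

lemma F_ge: "1 - F x \<le> exp (- x)"
  by (simp add: F_def phi_ge)

lemma F_mono: "x \<le> y \<Longrightarrow> F x \<le> F y"
  by (simp add: F_def phi_diff_le(2))

lemma F_cont: "continuous_on A F"
  unfolding F_def by (intro continuous_on_compose2[OF phi_cont] continuous_intros) auto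

lemma F_meas [measurable]: "F \<in> borel_measurable borel"
  by (rule borel_measurable_continuous_onI[OF F_cont])

lemma F_lim: "(F \<longlongrightarrow> 1) at_top"
proof (rule tendsto_sandwich[OF _ _ _ tendsto_const])
  show "((\<lambda>x :: real. 1 - exp (- x)) \<longlongrightarrow> 1) at_top" by real_asymp
  show "eventually (\<lambda>x. 1 - exp (- x) \<le> F x) at_top"
    using F_ge by (auto simp: algebra_simps)
qed simp

text \<open>In the variable x = - ln \<theta>, damping by \<open>exp (- kap t)\<close> becomes
  translation by \<open>kap t\<close>; this turns the equation for \<open>phi\<close> into one for
  \<open>F\<close>.\<close>

lemma F_kap: "F (x + kap t) = phi (exp (- x) * exp (- kap t))"
  by (simp add: F_def mult_exp_exp)

lemma F_fix: "F x = exp (- (LBINT t:{0..}. 1 - F (x + kap t)))"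
  unfolding F_kap unfolding F_def by (rule phi_fixpoint) simp

lemma one_minus_F_integrable: "integrable lborel (\<lambda>t. 1 - F (x + kap t))"
  unfolding F_kap by (rule phi_kap_integrable) simp

text \<open>The constant is E(W exp(-W)). With b \<le> a the two values of exp(-x), exp(-bw) -
  exp(-aw) \<ge> (a - b) w exp(-aw), and a \<le> 1 because m \<ge> 0. So windows of \<open>F\<close>
  have mass at least of the order predicted by an exponential tail.\<close>

lemma F_incr_lower:
  obtains c where "c > 0"
    "\<And>m \<delta>. m \<ge> 0 \<Longrightarrow> \<delta> \<ge> 0 \<Longrightarrow> F (m + \<delta>) - F m \<ge> c * (exp (- m) - exp (- (m + \<delta>)))"
proof
  let ?c = "\<integral>w. \<bar>w\<bar> * exp (- \<bar>w\<bar>) \<partial>\<mu>"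
  have int: "integrable \<mu> (\<lambda>w. \<bar>w\<bar> * exp (- \<bar>w\<bar>))"
    by (rule Bochner_Integration.integrable_bound[OF mean_int]) (auto intro!: mult_left_le)
  have "?c \<noteq> 0"
  proof
    assume "?c = 0"
    hence "AE w in \<mu>. \<bar>w\<bar> * exp (- \<bar>w\<bar>) = 0"
      using int by (subst (asm) integral_nonneg_eq_0_iff_AE) auto
    hence "AE w in \<mu>. False" using AE_pos by eventually_elim auto
    thus False by simp
  qed
  moreover have "?c \<ge> 0" by (intro Bochner_Integration.integral_nonneg) auto
  ultimately show "?c > 0" by linarith
  fix m \<delta> :: real assume m: "m \<ge> 0" and \<delta>: "\<delta> \<ge> 0"
  define a b where "a = exp (- m)" and "b = exp (- (m + \<delta>))"
  have ab: "0 \<le> b" "b \<le> a" "a \<le> 1" using m \<delta> by (auto simp: a_def b_def)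
  have "?c * (a - b) = (\<integral>w. \<bar>w\<bar> * exp (- \<bar>w\<bar>) * (a - b) \<partial>\<mu>)" by simp
  also have "\<dots> \<le> (\<integral>w. exp (- b * w) - exp (- a * w) \<partial>\<mu>)"
  proof (rule integral_mono_AE)
    show "integrable \<mu> (\<lambda>w. \<bar>w\<bar> * exp (- \<bar>w\<bar>) * (a - b))" using int by simp
    show "integrable \<mu> (\<lambda>w. exp (- b * w) - exp (- a * w))"
      by (intro Bochner_Integration.integrable_diff exp_W_integrable) (use ab in auto)
    show "AE w in \<mu>. \<bar>w\<bar> * exp (- \<bar>w\<bar>) * (a - b) \<le> exp (- b * w) - exp (- a * w)"
      using AE_pos
    proof eventually_elim
      case (elim w)
      have "exp (- a * w) * ((a - b) * w) \<le> exp (- a * w) * (exp ((a - b) * w) - 1)"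
        using exp_ge_add_one_self[of "(a - b) * w"] by (intro mult_left_mono) (auto simp: algebra_simps)
      also have "\<dots> = exp (- b * w) - exp (- a * w)"
        by (simp add: right_diff_distrib mult_exp_exp algebra_simps)
      finally have "exp (- a * w) * ((a - b) * w) \<le> exp (- b * w) - exp (- a * w)" .
      moreover have "exp (- w) * ((a - b) * w) \<le> exp (- a * w) * ((a - b) * w)"
        using elim ab by (intro mult_right_mono mult_nonneg_nonneg) (auto intro: mult_left_le_one_le)
      ultimately have "exp (- w) * ((a - b) * w) \<le> exp (- b * w) - exp (- a * w)"
        by linarith
      thus ?case using elim by (simp add: mult_ac)
    qed
  qed
  also have "\<dots> = F (m + \<delta>) - F m"
    unfolding F_def phi_def a_def[symmetric] b_def[symmetric]
    using ab by (intro Bochner_Integration.integral_diff exp_W_integrable) auto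
  finally show "F (m + \<delta>) - F m \<ge> ?c * (exp (- m) - exp (- (m + \<delta>)))"
    by (simp add: a_def b_def)
qed

lemma F_less_1 [simp]: "F x < 1"
proof -
  obtain c where c: "c > 0"
    "\<And>m \<delta>. m \<ge> 0 \<Longrightarrow> \<delta> \<ge> 0 \<Longrightarrow> F (m + \<delta>) - F m \<ge> c * (exp (- m) - exp (- (m + \<delta>)))"
    using F_incr_lower by blast
  let ?m = "max 0 x"
  have "0 < c * (exp (- ?m) - exp (- (?m + 1)))" using c(1) by simp
  also have "\<dots> \<le> F (?m + 1) - F ?m" by (rule c(2)) auto
  finally have "F ?m < 1" using F_le_1[of "?m + 1"] by linarith
  thus ?thesis using F_mono[of x ?m] by linarith
qed

text \<open>With y = bw the difference of exponentials is at most (a/b - 1) y exp(-y), and y exp(-y)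
  \<le> exp(-y/2). Halving b is a shift of the argument of \<open>F\<close> by \<open>ln 2\<close>.
  The bound is thus by \<open>F\<close> itself and can be integrated over \<open>t\<close>.\<close>

lemma F_incr_upper:
  assumes "\<delta> \<ge> 0"
  shows "F (x + \<delta>) - F x \<le> (exp \<delta> - 1) * F (x + \<delta> + ln 2)"
proof -
  define a b where "a = exp (- x)" and "b = exp (- (x + \<delta>))"
  have ab: "0 < b" "b \<le> a" using assms by (auto simp: a_def b_def)
  have b2: "exp (- (x + \<delta> + ln 2)) = b / 2"
    by (simp add: b_def exp_diff exp_minus exp_add field_simps)
  have "F (x + \<delta>) - F x = (\<integral>w. exp (- b * w) - exp (- a * w) \<partial>\<mu>)"
    unfolding F_def phi_def a_def[symmetric] b_def[symmetric]
    using ab by (intro Bochner_Integration.integral_diff[symmetric] exp_W_integrable) auto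
  also have "\<dots> \<le> (\<integral>w. (a / b - 1) * exp (- (b / 2) * w) \<partial>\<mu>)"
  proof (rule integral_mono_AE)
    show "integrable \<mu> (\<lambda>w. exp (- b * w) - exp (- a * w))"
      by (intro Bochner_Integration.integrable_diff exp_W_integrable) (use ab in auto)
    show "integrable \<mu> (\<lambda>w. (a / b - 1) * exp (- (b / 2) * w))"
      by (intro integrable_mult_right exp_W_integrable) (use ab in auto)
    show "AE w in \<mu>. exp (- b * w) - exp (- a * w) \<le> (a / b - 1) * exp (- (b / 2) * w)"
      using AE_pos
    proof eventually_elim
      case (elim w)
      let ?y = "b * w"
      have "exp (- b * w) - exp (- a * w) = exp (- ?y) * (1 - exp (- ((a - b) * w)))"
        by (simp add: right_diff_distrib mult_exp_exp algebra_simps)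
      also have "\<dots> \<le> exp (- ?y) * ((a - b) * w)"
        using exp_ge_add_one_self[of "- ((a - b) * w)"] by (intro mult_left_mono) auto
      also have "\<dots> = (a / b - 1) * (?y * exp (- ?y))"
        using ab by (simp add: field_simps)
      also have "\<dots> \<le> (a / b - 1) * exp (- (b / 2) * w)"
      proof (rule mult_left_mono)
        \<comment> \<open>The difference of the two sides is the square of 1 - y/4.\<close>
        have "?y \<le> (1 + ?y / 4)\<^sup>2"
          using zero_le_power2[of "1 - ?y / 4"] by (simp add: power2_eq_square algebra_simps)
        also have "\<dots> \<le> (exp (?y / 4))\<^sup>2"
          using exp_ge_add_one_self[of "?y / 4"] ab elim by (intro power_mono) auto
        also have "\<dots> = exp (?y / 2)" by (simp flip: exp_double)
        finally have "?y * exp (- ?y) \<le> exp (?y / 2) * exp (- ?y)"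
          by (intro mult_right_mono) auto
        thus "?y * exp (- ?y) \<le> exp (- (b / 2) * w)"
          by (simp add: mult_exp_exp)
      qed (use ab in simp)
      finally show ?case .
    qed
  qed
  also have "\<dots> = (a / b - 1) * F (x + \<delta> + ln 2)"
    unfolding F_def b2 phi_def by simp
  also have "a / b = exp \<delta>" by (simp add: a_def b_def flip: exp_diff)
  finally show ?thesis .
qed

text \<open>The inverse of \<open>kap\<close> on the nonnegative half-line: the time at which the
  curve \<open>m - kap t\<close> crosses 0.\<close>

definition tau :: "real \<Rightarrow> real" where
  "tau m = (m / lam s) powr (1 / s)"

lemma tau_nonneg [simp]: "tau m \<ge> 0"
  by (simp add: tau_def)

lemma kap_tau: "m \<ge> 0 \<Longrightarrow> kap (tau m) = m"
  using s_pos by (simp add: kap_def tau_def powr_powr less_imp_neq[OF lam_s_pos, symmetric] abs_of_pos[OF lam_s_pos])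

lemma kap_mono: "0 \<le> t \<Longrightarrow> t \<le> u \<Longrightarrow> kap t \<le> kap u"
  using s_pos by (simp add: kap_def powr_mono2)

text \<open>In the fixed-point equation at \<open>- x\<close>, keep only times up to
  \<open>tau x\<close>; there the argument \<open>- x + kap t\<close> is at most 0, so the integrand
  is at least \<open>1 - F 0\<close>.\<close>

lemma F_decay:
  assumes "x \<ge> 0"
  shows "F (- x) \<le> exp (- (1 - F 0) * tau x)"
proof -
  have "(1 - F 0) * tau x = (LBINT t:{0..tau x}. 1 - F 0)"
    by (subst set_lborel_integral_const) auto
  also have "\<dots> \<le> (LBINT t:{0..}. 1 - F (- x + kap t))"
    unfolding set_lebesgue_integral_def
  proof (rule integral_mono)
    show "integrable lborel (\<lambda>t. indicator {0..} t *\<^sub>R (1 - F (- x + kap t)))"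
      by (intro integrable_mult_indicator one_minus_F_integrable) auto
    fix t
    have "F (- x + kap t) \<le> F 0" if "0 \<le> t" "t \<le> tau x"
      using kap_mono[OF that] kap_tau[OF assms] by (intro F_mono) simp
    thus "indicat_real {0..tau x} t *\<^sub>R (1 - F 0) \<le> indicat_real {0..} t *\<^sub>R (1 - F (- x + kap t))"
      by (auto split: split_indicator)
  qed auto
  finally have "exp (- (LBINT t:{0..}. 1 - F (- x + kap t))) \<le> exp (- (1 - F 0) * tau x)"
    by (simp only: exp_le_cancel_iff mult_minus_left neg_le_iff_le)
  thus ?thesis by (simp only: F_fix[of "- x", symmetric])
qed

definition nu :: "real \<Rightarrow> real" where
  "nu m = (LBINT t:{0..}. F (m - kap t))"

text \<open>Beyond \<open>(1 + \<epsilon>) * tau m\<close> the gap \<open>kap t - m\<close> is at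
  least \<open>d * kap t\<close>, and \<open>tau\<close> of that is
  \<open>d powr (1 / s) * t\<close>; so \<open>F_decay\<close> yields an exponential in
  \<open>t\<close> whose rate does not depend on \<open>m\<close>. This uniformity gives both
  integrability and the additive error in \<open>nu_upper\<close>.\<close>

lemma F_kap_bound:
  assumes "\<epsilon> > 0"
  obtains \<beta> where "\<beta> > 0"
    "\<And>m t. m \<ge> 0 \<Longrightarrow> t \<ge> 0 \<Longrightarrow> F (m - kap t) \<le> indicator {0..(1 + \<epsilon>) * tau m} t + exp (- \<beta> * t)"
proof
  define d where "d = 1 - (1 + \<epsilon>) powr (- s)"
  have "(1 + \<epsilon>) powr (- s) < 1" using assms s_pos by (simp add: powr_less_one)
  hence d: "d > 0" by (simp add: d_def)
  let ?\<beta> = "(1 - F 0) * d powr (1 / s)"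
  show "?\<beta> > 0" using d by simp
  fix m t :: real assume m: "m \<ge> 0" and t: "t \<ge> 0"
  show "F (m - kap t) \<le> indicator {0..(1 + \<epsilon>) * tau m} t + exp (- ?\<beta> * t)"
  proof (cases "t \<le> (1 + \<epsilon>) * tau m")
    case True
    thus ?thesis using t F_le_1[of "m - kap t"] by (auto intro: add_increasing2)
  next
    case False
    have "tau m \<le> t / (1 + \<epsilon>)" using False assms by (simp add: field_simps)
    hence "kap (tau m) \<le> kap (t / (1 + \<epsilon>))" by (intro kap_mono) auto
    hence "m \<le> kap (t / (1 + \<epsilon>))" using kap_tau[OF m] by simp
    also have "\<dots> = lam s * (t powr s * (1 - d))"
      using t assms by (simp add: kap_def d_def powr_divide powr_minus field_simps)
    finally have le: "lam s * (d * t powr s) \<le> kap t - m"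
      by (simp add: kap_def algebra_simps)
    have nn: "0 \<le> lam s * (d * t powr s)" using d by (simp add: less_imp_le)
    have "d powr (1 / s) * t = (d * t powr s) powr (1 / s)"
      using d t s_pos by (simp add: powr_mult powr_powr)
    also have "\<dots> \<le> tau (kap t - m)"
      unfolding tau_def using le d s_pos
      by (intro powr_mono2) (auto simp: pos_le_divide_eq mult.commute less_imp_le)
    finally have "(1 - F 0) * (d powr (1 / s) * t) \<le> (1 - F 0) * tau (kap t - m)"
      by (intro mult_left_mono) auto
    hence "exp (- (1 - F 0) * tau (kap t - m)) \<le> exp (- ?\<beta> * t)"
      by (simp only: exp_le_cancel_iff mult_minus_left neg_le_iff_le mult.assoc)
    moreover have "F (m - kap t) \<le> exp (- (1 - F 0) * tau (kap t - m))"
      using F_decay[of "kap t - m", OF order.trans[OF nn le]] by simp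
    ultimately have "F (m - kap t) \<le> exp (- ?\<beta> * t)" by (rule order.trans[rotated])
    thus ?thesis using False by simp
  qed
qed

text \<open>Integrability on the whole line is the form in which
  \<open>marked_poisson_tendsto\<close> asks for it; \<open>kap\<close> is even, so the bound at
  \<open>\<bar>t\<bar>\<close> suffices.\<close>

lemma F_kap_integrable_UNIV: "integrable lborel (\<lambda>t. F (m - kap t))"
proof -
  obtain \<beta> where \<beta>: "\<beta> > 0"
    "\<And>m t. m \<ge> 0 \<Longrightarrow> t \<ge> 0 \<Longrightarrow> F (m - kap t) \<le> indicator {0..(1 + 1) * tau m} t + exp (- \<beta> * t)"
    using F_kap_bound[of 1] by auto
  let ?m = "max 0 m"
  let ?b = "(1 + 1) * tau ?m"
  show ?thesis
  proof (rule Bochner_Integration.integrable_bound)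
    show "integrable lborel (\<lambda>t. indicator {- ?b..?b} t + exp (- \<beta> * t powr 1))"
      using \<beta>(1) by (intro Bochner_Integration.integrable_add indicator_Icc_integrable stretched_exp_integrable) auto
    have "F (m - kap t) \<le> indicator {- ?b..?b} t + exp (- \<beta> * t powr 1)" for t
    proof -
      have eq: "kap t = kap \<bar>t\<bar>" by (simp add: kap_def abs_powr)
      have "F (m - kap t) \<le> indicator {0..?b} \<bar>t\<bar> + exp (- \<beta> * \<bar>t\<bar>)"
        using F_mono[of "m - kap t" "?m - kap t"] \<beta>(2)[of ?m "\<bar>t\<bar>"] by (simp add: eq)
      also have "indicator {0..?b} \<bar>t\<bar> = (indicator {- ?b..?b} t :: real)"
        by (auto simp: indicator_def abs_le_iff)
      also have "\<bar>t\<bar> = t powr 1" using abs_powr[of t 1] by simp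
      finally show ?thesis .
    qed
    thus "AE t in lborel. norm (F (m - kap t)) \<le> norm (indicator {- ?b..?b} t + exp (- \<beta> * t powr 1))"
      by (auto intro!: AE_I2 order.trans[OF _ abs_ge_self])
  qed measurable
qed

lemma F_kap_integrable: "set_integrable lborel {0..} (\<lambda>t. F (m - kap t))"
  unfolding set_integrable_def by (intro integrable_mult_indicator F_kap_integrable_UNIV) auto

lemma nu_mono: "m \<le> m' \<Longrightarrow> nu m \<le> nu m'"
  unfolding nu_def by (intro set_integral_mono F_kap_integrable F_mono) auto

lemma nu_nonneg [simp]: "nu m \<ge> 0"
  unfolding nu_def set_lebesgue_integral_def by (intro Bochner_Integration.integral_nonneg) auto

lemma nu_upper:
  assumes "\<epsilon> > 0"
  obtains C where "C \<ge> 0" "\<And>m. m \<ge> 0 \<Longrightarrow> nu m \<le> (1 + \<epsilon>) * tau m + C"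
proof -
  obtain \<beta> where \<beta>: "\<beta> > 0"
    "\<And>m t. m \<ge> 0 \<Longrightarrow> t \<ge> 0 \<Longrightarrow> F (m - kap t) \<le> indicator {0..(1 + \<epsilon>) * tau m} t + exp (- \<beta> * t)"
    using F_kap_bound[OF assms] by blast
  show ?thesis
  proof (rule that)
    show "(LBINT t:{0..}. exp (- \<beta> * t)) \<ge> 0"
      unfolding set_lebesgue_integral_def by (intro Bochner_Integration.integral_nonneg) auto
    fix m :: real assume m: "m \<ge> 0"
    have "nu m \<le> (LBINT t:{0..}. indicator {0..(1 + \<epsilon>) * tau m} t + exp (- \<beta> * t))"
      unfolding nu_def
      by (intro set_integral_mono F_kap_integrable set_integral_add Icc_integrable exp_decay_integrable \<beta> m) auto
    also have "\<dots> = (LBINT t:{0..}. indicator {0..(1 + \<epsilon>) * tau m} t) + (LBINT t:{0..}. exp (- \<beta> * t))"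
      by (intro set_integral_add Icc_integrable exp_decay_integrable \<beta>)
    also have "(LBINT t:{0..}. indicator {0..(1 + \<epsilon>) * tau m} t) = (LBINT t:{0..(1 + \<epsilon>) * tau m}. (1::real))"
      unfolding set_lebesgue_integral_def by (intro Bochner_Integration.integral_cong) (auto split: split_indicator)
    also have "\<dots> = (1 + \<epsilon>) * tau m"
      using assms by (subst set_lborel_integral_const) auto
    finally show "nu m \<le> (1 + \<epsilon>) * tau m + (LBINT t:{0..}. exp (- \<beta> * t))" .
  qed
qed

text \<open>Up to time \<open>r * tau m\<close> the argument \<open>m - kap t\<close> is still at
  least \<open>m * (1 - r powr s)\<close>.\<close>

lemma nu_lower:
  assumes "0 \<le> r" "r \<le> 1" "m \<ge> 0"
  shows "nu m \<ge> r * tau m * F (m * (1 - r powr s))"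
proof -
  let ?c = "F (m * (1 - r powr s))"
  have "r * tau m * ?c = (LBINT t:{0..r * tau m}. ?c)"
    using assms by (subst set_lborel_integral_const) auto
  also have "\<dots> \<le> nu m"
    unfolding nu_def set_lebesgue_integral_def
  proof (rule integral_mono)
    show "integrable lborel (\<lambda>t. indicator {0..} t *\<^sub>R F (m - kap t))"
      using F_kap_integrable unfolding set_integrable_def .
    fix t
    have "?c \<le> F (m - kap t)" if "0 \<le> t" "t \<le> r * tau m"
    proof (rule F_mono)
      have "kap t \<le> kap (r * tau m)" using that by (rule kap_mono)
      also have "\<dots> = r powr s * kap (tau m)" using assms by (simp add: kap_def powr_mult)
      finally show "m * (1 - r powr s) \<le> m - kap t"
        using kap_tau[OF assms(3)] by (simp add: algebra_simps)
    qed
    thus "indicat_real {0..r * tau m} t *\<^sub>R ?c \<le> indicat_real {0..} t *\<^sub>R F (m - kap t)"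
      by (auto split: split_indicator)
  qed (simp add: indicator_Icc_integrable)
  finally show ?thesis .
qed

lemma nu_incr:
  assumes "\<delta> \<ge> 0"
  shows "nu (m + \<delta>) - nu m \<le> (exp \<delta> - 1) * nu (m + \<delta> + ln 2)"
proof -
  have "nu (m + \<delta>) - nu m = (LBINT t:{0..}. F (m + \<delta> - kap t) - F (m - kap t))"
    unfolding nu_def by (intro set_integral_diff(2)[symmetric] F_kap_integrable)
  also have "\<dots> \<le> (LBINT t:{0..}. (exp \<delta> - 1) * F (m + \<delta> + ln 2 - kap t))"
    using F_incr_upper[OF assms, of "m - kap t" for t]
    by (intro set_integral_mono set_integral_diff F_kap_integrable set_integrable_mult_right)
       (simp add: algebra_simps)
  finally show ?thesis by (simp add: nu_def)
qed

lemma nu_cont: "continuous_on UNIV nu"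
proof (rule continuous_at_imp_continuous_on, rule ballI)
  fix x :: real
  let ?C = "nu (x + 2 + ln 2)"
  have "isCont nu x"
    unfolding isCont_def LIM_eq
  proof (intro allI impI)
    fix r :: real assume r: "0 < r"
    have "((\<lambda>\<delta>. (exp \<delta> - 1) * ?C) \<longlongrightarrow> (exp 0 - 1) * ?C) (at_right 0)" by (intro tendsto_intros)
    hence "eventually (\<lambda>\<delta>. (exp \<delta> - 1) * ?C < r) (at_right 0)"
      using r by (intro order_tendstoD(2)) auto
    then obtain b where b: "b > 0" "\<And>\<delta>. 0 < \<delta> \<Longrightarrow> \<delta> < b \<Longrightarrow> (exp \<delta> - 1) * ?C < r"
      by (auto simp: eventually_at_right_field)
    have key: "\<bar>nu v - nu u\<bar> < r" if "u < v" "v - u < min b 1" "v \<le> x + 1" for u v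
    proof -
      have "nu v - nu u \<le> (exp (v - u) - 1) * nu (v + ln 2)"
        using nu_incr[of "v - u" u] that by simp
      also have "\<dots> \<le> (exp (v - u) - 1) * ?C"
        using that by (intro mult_left_mono nu_mono) auto
      also have "\<dots> < r" using that by (intro b) auto
      finally show ?thesis using nu_mono[of u v] that by simp
    qed
    have "norm (nu y - nu x) < r" if "y \<noteq> x" "norm (y - x) < min b 1" for y
      using key[of x y] key[of y x] that by (cases "x < y") auto
    thus "\<exists>d>0. \<forall>y. y \<noteq> x \<and> norm (y - x) < d \<longrightarrow> norm (nu y - nu x) < r"
      using b(1) by (intro exI[of _ "min b 1"]) auto
  qed
  thus "isCont nu x" .
qed

end

section \<open>Counting points below the maximum\<close>

text \<open>The generating functions are computed only for 0 < z < 1. Once the coefficients below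
  \<open>k\<close> are known to agree, dividing by \<open>z ^ k\<close> and letting z decrease to 0
  isolates the next one.\<close>

lemma powser_unique_at_right:
  fixes a b :: "nat \<Rightarrow> real"
  assumes "\<And>z. 0 < z \<Longrightarrow> z < 1 \<Longrightarrow> (\<lambda>k. a k * z ^ k) sums f z"
    and "\<And>z. 0 < z \<Longrightarrow> z < 1 \<Longrightarrow> (\<lambda>k. b k * z ^ k) sums f z"
  shows "a = b"
proof -
  define d where "d k = a k - b k" for k
  have d: "(\<lambda>k. d k * z ^ k) sums 0" if "0 < z" "z < 1" for z
    using sums_diff[OF assms(1)[OF that] assms(2)[OF that]] by (simp add: d_def algebra_simps)
  have "d k = 0" for k
  proof (induction k rule: less_induct)
    case (less k)
    have e: "(\<lambda>i. d (i + k) * z ^ i) sums 0" if z: "0 < z" "z < 1" for z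
    proof -
      have "(\<lambda>i. d (i + k) * z ^ (i + k)) sums (0 - (\<Sum>i<k. d i * z ^ i))"
        using sums_split_initial_segment[OF d[OF z], of k] by simp
      also have "(\<Sum>i<k. d i * z ^ i) = 0" using less by simp
      finally have "(\<lambda>i. d (i + k) * z ^ (i + k) / z ^ k) sums (0 / z ^ k)"
        by (intro sums_divide) simp
      thus ?thesis using z by (simp add: power_add)
    qed
    let ?g = "\<lambda>z. \<Sum>i. d (i + k) * z ^ i"
    have "(?g \<longlongrightarrow> d (0 + k)) (at 0)"
    proof (rule powser_limit_0)
      fix z :: real assume "norm z < 1 / 2"
      hence "summable (\<lambda>i. d (i + k) * z ^ i)"
        by (intro powser_inside[OF sums_summable[OF e[of "1 / 2"]]]) auto
      thus "(\<lambda>i. d (i + k) * z ^ i) sums ?g z" by (rule summable_sums)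
    qed simp
    hence lim: "(?g \<longlongrightarrow> d k) (at_right 0)"
      unfolding add_0 by (rule tendsto_mono[OF at_le[OF subset_UNIV]])
    have "eventually (\<lambda>z. ?g z = 0) (at_right (0 :: real))"
      using eventually_at_right_real[of 0 1]
      by (auto elim!: eventually_mono intro!: sums_unique[symmetric] e)
    hence "(?g \<longlongrightarrow> 0) (at_right 0)" by (rule tendsto_eventually)
    thus ?case using tendsto_unique[OF _ lim] by simp
  qed
  thus ?thesis by (auto simp: d_def fun_eq_iff)
qed

text \<open>The sum is a counting measure, infinite on infinite sets, so equality with a natural
  number includes finiteness. It also makes the counting events measurable.\<close>

lemma suminf_of_bool_eq_iff:
  "(\<Sum>i. of_bool (P i) :: ennreal) = of_nat k \<longleftrightarrow> finite {i. P i} \<and> card {i. P i} = k"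
proof -
  have "(\<Sum>i. of_bool (P i) :: ennreal) = (\<integral>\<^sup>+i. indicator {i. P i} i \<partial>count_space UNIV)"
    by (simp add: nn_integral_count_space_nat indicator_def of_bool_def)
  also have "\<dots> = emeasure (count_space UNIV) {i. P i}" by simp
  also have "\<dots> = (if finite {i. P i} then of_nat (card {i. P i}) else \<top>)"
    by (simp add: emeasure_count_space)
  finally show ?thesis by auto
qed

lemma card_initial_at_top:
  assumes "infinite (I :: nat set)"
  shows "filterlim (\<lambda>n. card (I \<inter> {..<n})) at_top sequentially"
  unfolding filterlim_at_top
proof
  fix K :: nat
  obtain B where B: "finite B" "card B = K" "B \<subseteq> I"
    using infinite_arbitrarily_large[OF assms, of K] by blast
  obtain N where "B \<subseteq> {..<N}" using finite_nat_iff_bounded B(1) by blast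
  hence "K \<le> card (I \<inter> {..<n})" if "n \<ge> N" for n
    using that B by (auto intro!: card_mono)
  thus "eventually (\<lambda>n. K \<le> card (I \<inter> {..<n})) sequentially"
    by (auto simp: eventually_sequentially)
qed

definition pois :: "real \<Rightarrow> nat \<Rightarrow> real" where
  "pois v k = exp (- v) * v ^ k / fact k"

lemma pois_sums: "(\<lambda>k. pois v k * z ^ k) sums exp (- ((1 - z) * v))"
proof -
  have "(\<lambda>k. exp (- v) * ((v * z) ^ k /\<^sub>R fact k)) sums (exp (- v) * exp (v * z))"
    by (intro sums_mult exp_converges)
  moreover have "exp (- v) * ((v * z) ^ k /\<^sub>R fact k) = pois v k * z ^ k" for k
    by (simp add: pois_def power_mult_distrib divide_inverse mult_ac)
  moreover have "exp (- v) * exp (v * z) = exp (- ((1 - z) * v))"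
    by (simp add: mult_exp_exp algebra_simps)
  ultimately show ?thesis by simp
qed

lemma pois_nonneg: "v \<ge> 0 \<Longrightarrow> pois v k \<ge> 0"
  by (simp add: pois_def)

lemma pois_le_1: "v \<ge> 0 \<Longrightarrow> pois v k \<le> 1"
  using sum_le_suminf[of "pois v" "{k}"] pois_sums[of v 1]
  by (auto simp: pois_nonneg sums_iff)

lemma isCont_pois [continuous_intros]: "isCont (\<lambda>v. pois v k) x"
  unfolding pois_def by (intro continuous_intros) auto

text \<open>\<open>\<rho>\<close> is the law of a single mark, the sum of a Gumbel variable and log
  W; only its distribution function \<open>F\<close> enters.\<close>

locale poisson_marks = W_fixpoint +
  fixes \<rho> :: "real measure"
  assumes rho: "real_distribution \<rho>" and cdf_rho: "\<And>x. measure \<rho> {..x} = F x"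
begin

sublocale rho: real_distribution \<rho> by (rule rho)

sublocale C: prob_space "marked_poisson \<rho>"
  using rho.prob_space_axioms by (rule prob_space_marked_poisson)

lemma sets_C [measurable_cong]: "sets (marked_poisson \<rho>) =
    sets ((\<Pi>\<^sub>M j\<in>(UNIV :: nat set). borel :: real measure) \<Otimes>\<^sub>M (\<Pi>\<^sub>M i\<in>(UNIV :: nat set). borel :: real measure))"
  by (rule sets_marked_poisson) simp

lemma prob_rho_lessThan: "measure \<rho> {..<x} = F x"
proof -
  have "cdf \<rho> = F" by (auto simp: cdf_def cdf_rho)
  hence "measure \<rho> {x} = 0"
    using rho.isCont_cdf[of x] F_cont[of UNIV] by (simp add: continuous_on_eq_continuous_at)
  moreover have "measure \<rho> ({..<x} \<union> {x}) = measure \<rho> {..<x} + measure \<rho> {x}"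
    by (rule rho.finite_measure_Union) auto
  moreover have "{..<x} \<union> {x} = {..x}" by auto
  ultimately show ?thesis by (simp add: cdf_rho)
qed

lemma prob_rho_Ioc: "u \<le> v \<Longrightarrow> measure \<rho> {u<..v} = F v - F u"
proof -
  assume "u \<le> v"
  hence "{u<..v} = {..v} - {..u}" by auto
  thus ?thesis using \<open>u \<le> v\<close>
    by (simp add: rho.finite_measure_Diff cdf_rho)
qed

definition arr :: "(nat \<Rightarrow> real) \<times> (nat \<Rightarrow> real) \<Rightarrow> nat \<Rightarrow> real" where
  "arr x i = kap (\<Sum>j\<le>i. fst x j)"

definition hits :: "real \<Rightarrow> (nat \<Rightarrow> real) \<times> (nat \<Rightarrow> real) \<Rightarrow> nat set" where
  "hits a x = {i. snd x i + arr x i < a}"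

text \<open>The event M \<le> b, written without the supremum.\<close>

definition below :: "real \<Rightarrow> (nat \<Rightarrow> real) \<times> (nat \<Rightarrow> real) \<Rightarrow> bool" where
  "below b x \<longleftrightarrow> (\<forall>i. snd x i - arr x i \<le> b)"

text \<open>Finiteness is demanded explicitly because \<open>card\<close> of an infinite set is
  0.\<close>

definition nhits :: "real \<Rightarrow> nat \<Rightarrow> (nat \<Rightarrow> real) \<times> (nat \<Rightarrow> real) \<Rightarrow> bool" where
  "nhits a k x \<longleftrightarrow> finite (hits a x) \<and> card (hits a x) = k"

lemma arr_nonneg [simp]: "arr x i \<ge> 0"
  by (simp add: arr_def)

lemma arr_meas [measurable]: "(\<lambda>x. arr x i) \<in> borel_measurable (marked_poisson \<rho>)"
  unfolding arr_def by measurable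

lemma below_meas [measurable]: "Measurable.pred (marked_poisson \<rho>) (below b)"
  unfolding below_def by measurable

lemma nhits_iff: "nhits a k x \<longleftrightarrow> (\<Sum>i. of_bool (snd x i + arr x i < a) :: ennreal) = of_nat k"
  by (simp add: nhits_def hits_def suminf_of_bool_eq_iff)

lemma nhits_meas [measurable]: "Measurable.pred (marked_poisson \<rho>) (nhits a k)"
  unfolding nhits_iff of_bool_def by measurable

lemma below_mono: "below a x \<Longrightarrow> a \<le> b \<Longrightarrow> below b x"
  unfolding below_def by (meson order.trans)

lemma nhits_below_sets [measurable]: "{x. nhits a k x \<and> below b x} \<in> sets (marked_poisson \<rho>)"
proof -
  have "{x \<in> space (marked_poisson \<rho>). nhits a k x \<and> below b x} \<in> sets (marked_poisson \<rho>)"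
    by measurable
  thus ?thesis by simp
qed

lemma below_sets [measurable]: "{x. below b x} \<in> sets (marked_poisson \<rho>)"
proof -
  have "{x \<in> space (marked_poisson \<rho>). below b x} \<in> sets (marked_poisson \<rho>)" by measurable
  thus ?thesis by simp
qed

lemma suminf_nhits:
  "(\<Sum>k. of_bool (nhits a k x \<and> below b x) * z ^ k) =
    (if below b x \<and> finite (hits a x) then z ^ card (hits a x) else 0 :: real)"
proof (cases "finite (hits a x)")
  case True
  have "(\<Sum>k. of_bool (nhits a k x \<and> below b x) * z ^ k)
      = (\<Sum>k\<in>{card (hits a x)}. of_bool (nhits a k x \<and> below b x) * z ^ k)"
    by (rule suminf_finite) (auto simp: nhits_def)
  thus ?thesis using True by (simp add: nhits_def)
qed (simp add: nhits_def)

text \<open>The expectation is that of \<open>\<Prod>i. h (T i) (snd x i)\<close> with \<open>h\<close> vanishing above the line \<open>b + kap t\<close>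
  and equal to \<open>z\<close> below the line \<open>a - kap t\<close>; disjointness of the two regions gives the product form.\<close>

lemma hits_generating_function:
  assumes z: "0 < z" "z < 1" and ab: "a \<le> b"
  shows "(\<integral>x. (if below b x \<and> finite (hits a x) then z ^ card (hits a x) else 0) \<partial>marked_poisson \<rho>)
       = F b * exp (- ((1 - z) * nu a))"
proof -
  define h where "h t g = (if g \<le> b + kap t then if g < a - kap t then z else 1 else 0)" for t g
  have hbar: "(\<integral>g. h t g \<partial>\<rho>) = F (b + kap t) - (1 - z) * F (a - kap t)" for t
  proof -
    have "a - kap t \<le> b + kap t" using ab kap_nonneg[of t] by linarith
    hence "h t g = indicator {..b + kap t} g - (1 - z) * indicator {..<a - kap t} g" for g
      by (auto simp: h_def indicator_def)
    hence "(\<integral>g. h t g \<partial>\<rho>) = (\<integral>g. indicator {..b + kap t} g - (1 - z) * indicator {..<a - kap t} g \<partial>\<rho>)"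
      by simp
    also have "\<dots> = measure \<rho> {..b + kap t} - (1 - z) * measure \<rho> {..<a - kap t}"
      by (subst Bochner_Integration.integral_diff) (auto simp: rho.emeasure_eq_measure)
    finally show ?thesis by (simp add: cdf_rho prob_rho_lessThan)
  qed
  have ih: "integrable lborel (\<lambda>t. (1 - F (b + kap t)) + (1 - z) * F (a - kap t))"
    by (intro Bochner_Integration.integrable_add integrable_mult_right one_minus_F_integrable F_kap_integrable_UNIV)
  define q where "q x = (if below b x \<and> finite (hits a x) then z ^ card (hits a x) else 0)" for x
  have q: "q x = (\<Sum>k. of_bool (nhits a k x \<and> below b x) * z ^ k)" for x
    by (simp only: q_def suminf_nhits)
  have "(\<integral>x. q x \<partial>marked_poisson \<rho>) = exp (- (LBINT t:{0..}. 1 - (\<integral>g. h t g \<partial>\<rho>)))"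
  proof (rule marked_poisson_tendsto)
    show "(\<lambda>(t, g). h t g) \<in> borel_measurable (borel \<Otimes>\<^sub>M borel)"
      unfolding h_def by measurable
    show "continuous_on UNIV (\<lambda>t. \<integral>g. h t g \<partial>\<rho>)"
      unfolding hbar by (intro continuous_intros continuous_on_compose2[OF F_cont[of UNIV]] kap_cont) auto
    show "integrable lborel (\<lambda>t. 1 - (\<integral>g. h t g \<partial>\<rho>))"
      unfolding hbar using ih by (simp add: algebra_simps)
    show "q \<in> borel_measurable (marked_poisson \<rho>)"
      unfolding q of_bool_def by measurable
    have "(\<lambda>n. \<Prod>i<n. h (\<Sum>j\<le>i. fst x j) (snd x i)) \<longlonglongrightarrow> q x" for x
    proof (cases "below b x")
      case False
      then obtain i where "\<not> snd x i \<le> b + kap (\<Sum>j\<le>i. fst x j)"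
        by (auto simp: below_def arr_def algebra_simps)
      hence "h (\<Sum>j\<le>i. fst x j) (snd x i) = 0" by (simp add: h_def)
      hence "(\<Prod>i<n. h (\<Sum>j\<le>i. fst x j) (snd x i)) = 0" if "n > i" for n
        using that by (intro prod_zero) auto
      hence "eventually (\<lambda>n. (\<Prod>i<n. h (\<Sum>j\<le>i. fst x j) (snd x i)) = q x) sequentially"
        using False by (auto simp: q_def eventually_sequentially intro!: exI[of _ "Suc i"])
      thus ?thesis by (rule tendsto_eventually)
    next
      case True
      have "h (\<Sum>j\<le>i. fst x j) (snd x i) = (if i \<in> hits a x then z else 1)" for i
        using True by (auto simp: h_def below_def arr_def hits_def algebra_simps)
      hence eq: "(\<Prod>i<n. h (\<Sum>j\<le>i. fst x j) (snd x i)) = z ^ card (hits a x \<inter> {..<n})" for n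
        by (simp add: prod.If_cases Int_commute)
      show ?thesis
      proof (cases "finite (hits a x)")
        case fin: True
        then obtain N where "hits a x \<subseteq> {..<N}" using finite_nat_iff_bounded by blast
        hence "hits a x \<inter> {..<n} = hits a x" if "n \<ge> N" for n using that by auto
        hence "eventually (\<lambda>n. (\<Prod>i<n. h (\<Sum>j\<le>i. fst x j) (snd x i)) = q x) sequentially"
          unfolding eq using True fin by (auto simp: q_def eventually_sequentially intro!: exI[of _ N])
        thus ?thesis by (rule tendsto_eventually)
      next
        case False
        have "(\<lambda>n. z ^ card (hits a x \<inter> {..<n})) \<longlonglongrightarrow> 0"
          using z by (intro filterlim_compose[OF LIMSEQ_power_zero card_initial_at_top[OF False]]) auto
        thus ?thesis using False by (simp add: eq q_def)
      qed
    qed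
    thus "AE x in marked_poisson \<rho>. (\<lambda>n. \<Prod>i<n. h (\<Sum>j\<le>i. fst x j) (snd x i)) \<longlonglongrightarrow> q x" by simp
  qed (use z rho.prob_space_axioms in \<open>auto simp: h_def\<close>)
  also have "(LBINT t:{0..}. 1 - (\<integral>g. h t g \<partial>\<rho>)) = (LBINT t:{0..}. (1 - F (b + kap t)) + (1 - z) * F (a - kap t))"
    unfolding hbar by (simp add: algebra_simps)
  also have "\<dots> = (LBINT t:{0..}. 1 - F (b + kap t)) + (1 - z) * nu a"
  proof (subst set_integral_add)
    show "set_integrable lborel {0..} (\<lambda>t. 1 - F (b + kap t))"
      unfolding set_integrable_def by (intro integrable_mult_indicator one_minus_F_integrable) auto
  qed (auto simp: nu_def intro!: set_integrable_mult_right F_kap_integrable)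
  \<comment> \<open>The first integral is the exponent in the fixed-point equation at
    \<open>b\<close>; this is what identifies the law of M.\<close>
  also have "exp (- \<dots>) = F b * exp (- ((1 - z) * nu a))"
    by (subst F_fix[of b]) (simp flip: exp_add)
  finally show ?thesis by (simp add: q_def)
qed

text \<open>Coefficients of \<open>z ^ k\<close> are compared in the generating function. The
  product form expresses that the count under \<open>a\<close> and the event M \<le> b are
  independent when \<open>a \<le> b\<close>.\<close>

lemma prob_hits_below:
  assumes ab: "a \<le> b"
  shows "C.prob {x. nhits a k x \<and> below b x} = F b * pois (nu a) k"
proof -
  define A where "A k = C.prob {x. nhits a k x \<and> below b x}" for k
  have "A = (\<lambda>k. F b * pois (nu a) k)"
  proof (rule powser_unique_at_right)
    fix z :: real assume z: "0 < z" "z < 1"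
    show "(\<lambda>k. F b * pois (nu a) k * z ^ k) sums (F b * exp (- ((1 - z) * nu a)))"
      using sums_mult[OF pois_sums[of "nu a" z], of "F b"] by (simp add: mult_ac)
    define f where "f k x = of_bool (nhits a k x \<and> below b x) * z ^ k" for k x
    have f_eq: "f k = (\<lambda>x. indicator {x. nhits a k x \<and> below b x} x * z ^ k)" for k
      by (simp add: f_def fun_eq_iff indicator_def)
    have f_le: "\<bar>f k x\<bar> \<le> z ^ k" for k x
      using z by (simp add: f_def of_bool_def)
    have zs: "summable (\<lambda>k. z ^ k)" using z by (intro summable_geometric) auto
    have int: "integrable (marked_poisson \<rho>) (f k)" for k
      unfolding f_eq
      by (intro integrable_mult_left integrable_real_indicator nhits_below_sets)
         (simp add: C.emeasure_eq_measure)
    have "(\<lambda>k. \<integral>x. f k x \<partial>marked_poisson \<rho>) sums (\<integral>x. (\<Sum>k. f k x) \<partial>marked_poisson \<rho>)"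
    proof (rule sums_integral[OF int])
      show "AE x in marked_poisson \<rho>. summable (\<lambda>k. norm (f k x))"
        by (intro AE_I2 summable_comparison_test'[OF zs, of 0]) (simp add: f_le)
      have "(\<integral>x. norm (f k x) \<partial>marked_poisson \<rho>) \<le> z ^ k" for k
        by (intro C.integral_le_const integrable_norm int AE_I2) (simp add: f_le)
      thus "summable (\<lambda>k. \<integral>x. norm (f k x) \<partial>marked_poisson \<rho>)"
        by (intro summable_comparison_test'[OF zs, of 0]) simp
    qed
    moreover have "(\<integral>x. f k x \<partial>marked_poisson \<rho>) = A k * z ^ k" for k
      unfolding f_eq A_def by simp
    moreover have "(\<Sum>k. f k x) = (if below b x \<and> finite (hits a x) then z ^ card (hits a x) else 0)" for x
      unfolding f_def by (rule suminf_nhits)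
    ultimately show "(\<lambda>k. A k * z ^ k) sums (F b * exp (- ((1 - z) * nu a)))"
      by (simp only: hits_generating_function[OF z ab])
  qed
  from fun_cong[OF this, of k] show ?thesis by (simp only: A_def)
qed

text \<open>With \<open>b\<close> close to \<open>a\<close> this plays the role of conditioning on M
  near \<open>a\<close>.\<close>

lemma prob_hits_between:
  assumes "a \<le> b"
  shows "C.prob {x. nhits a k x \<and> below b x \<and> \<not> below a x} = (F b - F a) * pois (nu a) k"
proof -
  have "{x. nhits a k x \<and> below b x \<and> \<not> below a x} =
      {x. nhits a k x \<and> below b x} - {x. nhits a k x \<and> below a x}" by auto
  moreover have "{x. nhits a k x \<and> below a x} \<subseteq> {x. nhits a k x \<and> below b x}"
    using below_mono[OF _ assms] by auto
  ultimately show ?thesis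
    using assms by (simp add: C.finite_measure_Diff prob_hits_below algebra_simps)
qed

text \<open>Summing \<open>prob_hits_below\<close> over \<open>k\<close> gives \<open>F b\<close> as
  a lower bound for the probability of M \<le> b, and \<open>F\<close> tends to 1; so M is almost
  surely not infinite.\<close>

lemma AE_below: "AE x in marked_poisson \<rho>. \<exists>n::nat. below (real n) x"
proof -
  have "F b \<le> C.prob {x. below b x}" for b
  proof -
    have "(\<lambda>k. C.prob {x. nhits b k x \<and> below b x}) sums C.prob (\<Union>k. {x. nhits b k x \<and> below b x})"
    proof (rule C.finite_measure_UNION)
      show "disjoint_family (\<lambda>k. {x. nhits b k x \<and> below b x})"
        by (auto simp: disjoint_family_on_def nhits_def)
      show "range (\<lambda>k. {x. nhits b k x \<and> below b x}) \<subseteq> C.events"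
        by (rule image_subsetI) (rule nhits_below_sets)
    qed
    moreover have "(\<lambda>k. C.prob {x. nhits b k x \<and> below b x}) sums F b"
      using sums_mult[OF pois_sums[of "nu b" 1], of "F b"] by (simp add: prob_hits_below)
    ultimately have "F b = C.prob (\<Union>k. {x. nhits b k x \<and> below b x})" by (rule sums_unique2[rotated])
    also have "\<dots> \<le> C.prob {x. below b x}" by (intro C.finite_measure_mono) auto
    finally show ?thesis .
  qed
  note le = this
  have eq: "{x. \<exists>n::nat. below (real n) x} = (\<Union>n::nat. {x. below (real n) x})" by auto
  have [measurable]: "{x. \<exists>n::nat. below (real n) x} \<in> sets (marked_poisson \<rho>)"
    unfolding eq by measurable
  have "F (real n) \<le> C.prob {x. \<exists>n::nat. below (real n) x}" for n
    by (rule order.trans[OF le C.finite_measure_mono]) auto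
  moreover have "(\<lambda>n. F (real n)) \<longlonglongrightarrow> 1"
    by (rule filterlim_compose[OF F_lim filterlim_real_sequentially])
  ultimately have "1 \<le> C.prob {x. \<exists>n::nat. below (real n) x}"
    by (intro LIMSEQ_le_const2) auto
  hence "C.prob {x. \<exists>n::nat. below (real n) x} = 1"
    using C.prob_le_1[of "{x. \<exists>n::nat. below (real n) x}"] by linarith
  hence "AE x in marked_poisson \<rho>. x \<in> {x. \<exists>n::nat. below (real n) x}"
    by (subst C.AE_in_set_eq_1) auto
  thus ?thesis by simp
qed

end

lemma grid_cell_iff:
  fixes r N :: real
  assumes "N > 0"
  shows "of_int l / N < r \<and> r \<le> of_int (l + 1) / N \<longleftrightarrow> l = \<lceil>N * r\<rceil> - 1"
proof -
  have "of_int l / N < r \<and> r \<le> of_int (l + 1) / N \<longleftrightarrow> of_int (l + 1) - 1 < N * r \<and> N * r \<le> of_int (l + 1)"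
    using assms by (simp add: field_simps)
  also have "\<dots> \<longleftrightarrow> \<lceil>N * r\<rceil> = l + 1" by (simp only: ceiling_eq_iff)
  finally show ?thesis by auto
qed

text \<open>The maximum is approximated from below by grid points. Since points are counted with a strict
  inequality, the count is left-continuous in the threshold and no upper approximation is needed.\<close>

definition grid :: "nat \<Rightarrow> int \<Rightarrow> real" where
  "grid n l = of_int l / real (Suc n)"

text \<open>The cells are open on the left and closed on the right, hence the ceiling minus one: the
  left end is strictly below \<open>r\<close>, also when \<open>r\<close> is a grid point.\<close>

definition cell :: "nat \<Rightarrow> real \<Rightarrow> int" where
  "cell n r = \<lceil>real (Suc n) * r\<rceil> - 1"

lemma cell_iff: "grid n l < r \<and> r \<le> grid n (l + 1) \<longleftrightarrow> l = cell n r"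
  unfolding grid_def cell_def by (rule grid_cell_iff) simp

lemma grid_cell_less: "grid n (cell n r) < r"
  using cell_iff[of n "cell n r" r] by simp

lemma grid_cell_tendsto: "(\<lambda>n. grid n (cell n r)) \<longlonglongrightarrow> r"
proof (rule tendsto_sandwich[OF _ _ _ tendsto_const])
  show "eventually (\<lambda>n. grid n (cell n r) \<le> r) sequentially"
    by (intro always_eventually allI less_imp_le grid_cell_less)
  have "r - 1 / real (Suc n) \<le> grid n (cell n r)" for n
    using cell_iff[of n "cell n r" r] by (simp add: grid_def add_divide_distrib)
  thus "eventually (\<lambda>n. r - 1 / real (Suc n) \<le> grid n (cell n r)) sequentially" by simp
  show "(\<lambda>n. r - 1 / real (Suc n)) \<longlonglongrightarrow> r" by real_asymp
qed

lemma grid_cell_measurable [measurable]: "(\<lambda>r. grid n (cell n r)) \<in> borel_measurable borel"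
  unfolding grid_def cell_def by measurable

context poisson_marks
begin

definition Mval :: "(nat \<Rightarrow> real) \<times> (nat \<Rightarrow> real) \<Rightarrow> ereal" where
  "Mval x = (SUP i. ereal (snd x i - arr x i))"

definition mval :: "(nat \<Rightarrow> real) \<times> (nat \<Rightarrow> real) \<Rightarrow> real" where
  "mval x = real_of_ereal (Mval x)"

lemma Mval_meas [measurable]: "Mval \<in> borel_measurable (marked_poisson \<rho>)"
  unfolding Mval_def by measurable

lemma mval_meas [measurable]: "mval \<in> borel_measurable (marked_poisson \<rho>)"
  unfolding mval_def by measurable

lemma below_iff: "below b x \<longleftrightarrow> Mval x \<le> ereal b"
  by (simp add: below_def Mval_def SUP_le_iff)

lemma AE_Mval: "AE x in marked_poisson \<rho>. Mval x = ereal (mval x)"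
  using AE_below
proof eventually_elim
  case (elim x)
  then obtain n :: nat where "Mval x \<le> ereal (real n)" by (auto simp: below_iff)
  moreover have "ereal (snd x 0 - arr x 0) \<le> Mval x"
    unfolding Mval_def by (rule SUP_upper) simp
  ultimately show ?case
    unfolding mval_def by (cases "Mval x") auto
qed

text \<open>Finitely many strict inequalities survive a small decrease of the level. If infinitely
  many points lie under \<open>m\<close>, then \<open>k + 1\<close> of them already lie under
  \<open>a n\<close> eventually, and both sides are false.\<close>

lemma nhits_left_limit:
  assumes less: "\<And>n. a n < m" and lim: "a \<longlonglongrightarrow> m"
  shows "eventually (\<lambda>n. nhits (a n) k x \<longleftrightarrow> nhits m k x) sequentially"
proof -
  have sub: "hits (a n) x \<subseteq> hits m x" for n
    using less[of n] by (auto simp: hits_def)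
  have ev: "eventually (\<lambda>n. B \<subseteq> hits (a n) x) sequentially" if B: "finite B" "B \<subseteq> hits m x" for B
  proof -
    have "eventually (\<lambda>n. \<forall>i\<in>B. snd x i + arr x i < a n) sequentially"
      using B by (intro eventually_ball_finite ballI order_tendstoD[OF lim]) (auto simp: hits_def)
    thus ?thesis by eventually_elim (auto simp: hits_def)
  qed
  show ?thesis
  proof (cases "finite (hits m x)")
    case True
    from ev[OF True] show ?thesis
    proof (rule eventually_mono)
      fix n assume "hits m x \<subseteq> hits (a n) x"
      hence "hits (a n) x = hits m x" using sub[of n] by blast
      thus "nhits (a n) k x \<longleftrightarrow> nhits m k x" by (simp add: nhits_def)
    qed simp
  next
    case False
    then obtain B where B: "finite B" "card B = Suc k" "B \<subseteq> hits m x"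
      using infinite_arbitrarily_large by blast
    from ev[OF B(1,3)] show ?thesis
    proof (rule eventually_mono)
      fix n assume "B \<subseteq> hits (a n) x"
      hence "\<not> nhits (a n) k x"
        using B(2) card_mono[of "hits (a n) x" B] by (auto simp: nhits_def)
      thus "nhits (a n) k x \<longleftrightarrow> nhits m k x" using False by (simp add: nhits_def)
    qed
  qed
qed

lemma grid_event_sets [measurable]:
  "{x. nhits a k x \<and> below b x \<and> \<not> below a x} \<in> sets (marked_poisson \<rho>)"
proof -
  have "{x \<in> space (marked_poisson \<rho>). nhits a k x \<and> below b x \<and> \<not> below a x} \<in> sets (marked_poisson \<rho>)"
    by measurable
  thus ?thesis by simp
qed

lemma nu_meas [measurable]: "nu \<in> borel_measurable borel"
  by (rule borel_measurable_continuous_onI[OF nu_cont])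

lemma pois_nu_meas [measurable]: "(\<lambda>r. pois (nu r) k) \<in> borel_measurable borel"
  unfolding pois_def by measurable

text \<open>Each cell contributes a Poisson weight times its \<open>\<rho>\<close>-mass, so the sum
  over all cells is the integral of a step function against \<open>\<rho>\<close>.\<close>

lemma grid_event_prob:
  "C.prob (\<Union>l. {x. nhits (grid n l) k x \<and> below (grid n (l + 1)) x \<and> \<not> below (grid n l) x})
   = (\<integral>r. pois (nu (grid n (cell n r))) k \<partial>\<rho>)"
proof -
  let ?A = "\<lambda>l. {x. nhits (grid n l) k x \<and> below (grid n (l + 1)) x \<and> \<not> below (grid n l) x}"
  have mono: "l \<le> l' \<Longrightarrow> grid n l \<le> grid n l'" for l l'
    by (simp add: grid_def divide_right_mono)
  have disj: "disjoint_family ?A"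
    unfolding disjoint_family_on_def
  proof (intro ballI impI)
    fix l l' :: int assume "l \<noteq> l'"
    have *: "?A i \<inter> ?A j = {}" if "i < j" for i j
      using below_mono[OF _ mono[of "i + 1" j]] that by auto
    show "?A l \<inter> ?A l' = {}"
    proof (cases "l < l'")
      case False
      hence "l' < l" using \<open>l \<noteq> l'\<close> by simp
      from *[OF this] show ?thesis by (simp only: Int_commute)
    qed (rule *)
  qed
  have "emeasure (marked_poisson \<rho>) (\<Union>l. ?A l) = (\<integral>\<^sup>+l. emeasure (marked_poisson \<rho>) (?A l) \<partial>count_space UNIV)"
    by (rule emeasure_UN_countable) (use disj in auto)
  also have "\<dots> = (\<integral>\<^sup>+l. (\<integral>\<^sup>+r. ennreal (pois (nu (grid n l)) k) * indicator {grid n l<..grid n (l + 1)} r \<partial>\<rho>) \<partial>count_space UNIV)"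
  proof (rule nn_integral_cong)
    fix l :: int
    have "emeasure (marked_poisson \<rho>) (?A l) = ennreal (pois (nu (grid n l)) k * (F (grid n (l + 1)) - F (grid n l)))"
      using mono[of l "l + 1"] by (simp add: C.emeasure_eq_measure prob_hits_between mult.commute)
    also have "\<dots> = ennreal (pois (nu (grid n l)) k) * emeasure \<rho> {grid n l<..grid n (l + 1)}"
      using mono[of l "l + 1"]
      by (simp add: rho.emeasure_eq_measure prob_rho_Ioc ennreal_mult F_mono pois_nonneg)
    finally show "emeasure (marked_poisson \<rho>) (?A l) =
        (\<integral>\<^sup>+r. ennreal (pois (nu (grid n l)) k) * indicator {grid n l<..grid n (l + 1)} r \<partial>\<rho>)"
      by (simp add: nn_integral_cmult_indicator)
  qed
  also have "\<dots> = (\<integral>\<^sup>+r. (\<integral>\<^sup>+l. ennreal (pois (nu (grid n l)) k) * indicator {grid n l<..grid n (l + 1)} r \<partial>count_space UNIV) \<partial>\<rho>)"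
    by (rule nn_integral_count_space_nn_integral[symmetric]) auto
  also have "\<dots> = (\<integral>\<^sup>+r. ennreal (pois (nu (grid n (cell n r))) k) \<partial>\<rho>)"
  proof (rule nn_integral_cong)
    fix r
    have "indicator {grid n l<..grid n (l + 1)} r = (indicator {cell n r} l :: ennreal)" for l
      using cell_iff[of n l r] by (auto simp: indicator_def)
    thus "(\<integral>\<^sup>+l. ennreal (pois (nu (grid n l)) k) * indicator {grid n l<..grid n (l + 1)} r \<partial>count_space UNIV)
        = ennreal (pois (nu (grid n (cell n r))) k)"
      by (simp add: nn_integral_indicator_singleton)
  qed
  also have "\<dots> = ennreal (\<integral>r. pois (nu (grid n (cell n r))) k \<partial>\<rho>)"
    by (intro nn_integral_eq_integral rho.integrable_const_bound[where B=1] AE_I2)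
       (auto simp: pois_nonneg pois_le_1)
  finally show ?thesis
    by (simp add: C.emeasure_eq_measure Bochner_Integration.integral_nonneg pois_nonneg)
qed

text \<open>Both sides are limits of the grid identity as the mesh tends to 0: the event side by
  left continuity of the count, the integral side by continuity of \<open>nu\<close>.\<close>

lemma prob_nhits_mval:
  "C.prob {x. nhits (mval x) k x} = (\<integral>r. pois (nu r) k \<partial>\<rho>)"
proof -
  define G where "G n = (\<Union>l. {x. nhits (grid n l) k x \<and> below (grid n (l + 1)) x \<and> \<not> below (grid n l) x})" for n
  have Gs [measurable]: "G n \<in> sets (marked_poisson \<rho>)" for n
    unfolding G_def by measurable
  have Hs: "{x. nhits (mval x) k x} \<in> sets (marked_poisson \<rho>)"
  proof -
    have "{x \<in> space (marked_poisson \<rho>). nhits (mval x) k x} \<in> sets (marked_poisson \<rho>)"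
      unfolding nhits_iff of_bool_def by measurable
    thus ?thesis by simp
  qed
  have "(\<lambda>n. \<integral>x. indicat_real (G n) x \<partial>marked_poisson \<rho>) \<longlonglongrightarrow>
      (\<integral>x. indicat_real {x. nhits (mval x) k x} x \<partial>marked_poisson \<rho>)"
  proof (rule integral_dominated_convergence[where w = "\<lambda>_. 1"])
    show "AE x in marked_poisson \<rho>. (\<lambda>n. indicat_real (G n) x) \<longlonglongrightarrow> indicat_real {x. nhits (mval x) k x} x"
      using AE_Mval
    proof eventually_elim
      case (elim x)
      have "x \<in> G n \<longleftrightarrow> (\<exists>l. nhits (grid n l) k x \<and> grid n l < mval x \<and> mval x \<le> grid n (l + 1))" for n
        using elim by (auto simp: G_def below_iff not_le)
      hence "x \<in> G n \<longleftrightarrow> nhits (grid n (cell n (mval x))) k x" for n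
        unfolding cell_iff by simp
      moreover have "eventually (\<lambda>n. nhits (grid n (cell n (mval x))) k x \<longleftrightarrow> nhits (mval x) k x) sequentially"
        by (intro nhits_left_limit grid_cell_less grid_cell_tendsto)
      ultimately have "eventually (\<lambda>n. indicat_real (G n) x = indicat_real {x. nhits (mval x) k x} x) sequentially"
        by (auto simp: indicator_def elim!: eventually_mono)
      thus ?case by (rule tendsto_eventually)
    qed
  qed (use Hs in auto)
  hence "(\<lambda>n. \<integral>r. pois (nu (grid n (cell n r))) k \<partial>\<rho>) \<longlonglongrightarrow> C.prob {x. nhits (mval x) k x}"
    using Hs Gs by (simp add: G_def grid_event_prob)
  moreover have "(\<lambda>n. \<integral>r. pois (nu (grid n (cell n r))) k \<partial>\<rho>) \<longlonglongrightarrow> (\<integral>r. pois (nu r) k \<partial>\<rho>)"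
  proof (rule integral_dominated_convergence[where w = "\<lambda>_. 1"])
    show "AE r in \<rho>. (\<lambda>n. pois (nu (grid n (cell n r))) k) \<longlonglongrightarrow> pois (nu r) k"
    proof (rule AE_I2)
      fix r
      have "isCont nu r" using nu_cont by (simp add: continuous_on_eq_continuous_at)
      hence "isCont (\<lambda>r. pois (nu r) k) r" by (rule isCont_o2[OF _ isCont_pois])
      thus "(\<lambda>n. pois (nu (grid n (cell n r))) k) \<longlonglongrightarrow> pois (nu r) k"
        by (rule isCont_tendsto_compose[OF _ grid_cell_tendsto])
    qed
  qed (auto simp: pois_nonneg pois_le_1)
  ultimately show ?thesis by (rule LIMSEQ_unique)
qed

definition N_count :: "(nat \<Rightarrow> real) \<times> (nat \<Rightarrow> real) \<Rightarrow> ennreal" where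
  "N_count x = (\<Sum>i. of_bool (ereal (snd x i + arr x i) < Mval x))"

lemma N_count_meas [measurable]: "N_count \<in> borel_measurable (marked_poisson \<rho>)"
  unfolding N_count_def of_bool_def by measurable

theorem prob_N_count:
  "C.prob {x. N_count x = of_nat k} = (\<integral>r. pois (nu r) k \<partial>\<rho>)"
proof -
  have "{x \<in> space (marked_poisson \<rho>). N_count x = of_nat k} \<in> sets (marked_poisson \<rho>)" by measurable
  moreover have "{x \<in> space (marked_poisson \<rho>). nhits (mval x) k x} \<in> sets (marked_poisson \<rho>)"
    unfolding nhits_iff of_bool_def by measurable
  moreover have "AE x in marked_poisson \<rho>. x \<in> {x. N_count x = of_nat k} \<longleftrightarrow> x \<in> {x. nhits (mval x) k x}"
    using AE_Mval by eventually_elim (simp add: N_count_def nhits_iff)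
  ultimately show ?thesis
    unfolding prob_nhits_mval[symmetric] by (intro measure_eq_AE) auto
qed

end

section \<open>Transfer to an arbitrary probability space\<close>

context prob_space
begin

lemma distr_sequence_eq_PiM:
  fixes Y :: "nat \<Rightarrow> 'a \<Rightarrow> real"
  assumes "indep_vars (\<lambda>_. borel) Y UNIV" "\<And>i. distr M borel (Y i) = \<nu>"
  shows "distr M (\<Pi>\<^sub>M i\<in>(UNIV :: nat set). borel) (\<lambda>\<omega> i. Y i \<omega>) = (\<Pi>\<^sub>M i\<in>(UNIV :: nat set). \<nu>)"
proof -
  have "random_variable borel (Y i)" for i
    using assms(1) by (simp add: indep_vars_def2)
  thus ?thesis
    using indep_vars_iff_distr_eq_PiM'[where I = UNIV and M' = "\<lambda>_. borel" and X = Y] assms by (simp add: restrict_def)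
qed

text \<open>All four claims regroup the single independent family indexed by
  \<open>nat + nat + nat\<close> into disjoint blocks of indices and then apply a measurable map to
  each block.\<close>

lemma
  fixes E L W :: "nat \<Rightarrow> 'a \<Rightarrow> real"
  assumes ind: "indep_vars (\<lambda>_. borel) (case_sum E (case_sum L W)) UNIV"
  shows indep_vars_case_sum_left: "indep_vars (\<lambda>_. borel) E UNIV"
    and indep_vars_case_sum_add_ln: "indep_vars (\<lambda>_. borel) (\<lambda>i \<omega>. L i \<omega> + ln (W i \<omega>)) UNIV"
    and indep_var_case_sum_pair: "indep_var borel (L i) borel (W i)"
    and indep_var_case_sum_sequences: "indep_var (\<Pi>\<^sub>M i\<in>(UNIV :: nat set). borel) (\<lambda>\<omega> i. E i \<omega>)
      (\<Pi>\<^sub>M i\<in>(UNIV :: nat set). borel) (\<lambda>\<omega> i. L i \<omega> + ln (W i \<omega>))"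
proof -
  let ?X = "case_sum E (case_sum L W)"
  have "indep_vars (\<lambda>j. \<Pi>\<^sub>M i\<in>{Inl j}. borel) (\<lambda>j \<omega>. restrict (\<lambda>i. ?X i \<omega>) {Inl j}) (UNIV :: nat set)"
    by (rule indep_vars_restrict[OF ind]) (auto simp: disjoint_family_on_def)
  hence "indep_vars (\<lambda>_. borel) (\<lambda>j \<omega>. (\<lambda>f. f (Inl j)) (restrict (\<lambda>i. ?X i \<omega>) {Inl j})) UNIV"
    by (rule indep_vars_compose2) (rule measurable_component_singleton, simp)
  thus "indep_vars (\<lambda>_. borel) E UNIV" by simp
  have "indep_vars (\<lambda>j. \<Pi>\<^sub>M i\<in>{Inr (Inl j), Inr (Inr j)}. borel)
      (\<lambda>j \<omega>. restrict (\<lambda>i. ?X i \<omega>) {Inr (Inl j), Inr (Inr j)}) (UNIV :: nat set)"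
    by (rule indep_vars_restrict[OF ind]) (auto simp: disjoint_family_on_def)
  hence "indep_vars (\<lambda>_. borel) (\<lambda>j \<omega>. (\<lambda>f. f (Inr (Inl j)) + ln (f (Inr (Inr j))))
      (restrict (\<lambda>i. ?X i \<omega>) {Inr (Inl j), Inr (Inr j)})) UNIV"
    by (rule indep_vars_compose2) measurable
  thus "indep_vars (\<lambda>_. borel) (\<lambda>i \<omega>. L i \<omega> + ln (W i \<omega>)) UNIV" by simp
  have "indep_var (\<Pi>\<^sub>M j\<in>{Inr (Inl i)}. borel) (\<lambda>\<omega>. restrict (\<lambda>i. ?X i \<omega>) {Inr (Inl i)})
      (\<Pi>\<^sub>M j\<in>{Inr (Inr i)}. borel) (\<lambda>\<omega>. restrict (\<lambda>i. ?X i \<omega>) {Inr (Inr i)})"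
    by (rule indep_var_restrict[OF ind]) auto
  hence "indep_var borel ((\<lambda>f. f (Inr (Inl i))) \<circ> (\<lambda>\<omega>. restrict (\<lambda>i. ?X i \<omega>) {Inr (Inl i)}))
      borel ((\<lambda>f. f (Inr (Inr i))) \<circ> (\<lambda>\<omega>. restrict (\<lambda>i. ?X i \<omega>) {Inr (Inr i)}))"
    by (rule indep_var_compose) (rule measurable_component_singleton, simp)+
  thus "indep_var borel (L i) borel (W i)" by (simp add: comp_def)
  have [measurable]: "(\<lambda>f. f (Inr (Inl i)) + ln (f (Inr (Inr i)))) \<in>
      borel_measurable (\<Pi>\<^sub>M j\<in>(range Inr :: (nat + nat + nat) set). borel :: real measure)" for i
    by measurable
  have "indep_var (\<Pi>\<^sub>M j\<in>range Inl. borel) (\<lambda>\<omega>. restrict (\<lambda>i. ?X i \<omega>) (range Inl))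
      (\<Pi>\<^sub>M j\<in>range Inr. borel) (\<lambda>\<omega>. restrict (\<lambda>i. ?X i \<omega>) (range Inr))"
    by (rule indep_var_restrict[OF ind]) auto
  hence "indep_var (\<Pi>\<^sub>M i\<in>(UNIV :: nat set). borel)
        ((\<lambda>f i. f (Inl i)) \<circ> (\<lambda>\<omega>. restrict (\<lambda>i. ?X i \<omega>) (range Inl)))
      (\<Pi>\<^sub>M i\<in>(UNIV :: nat set). borel)
        ((\<lambda>f i. f (Inr (Inl i)) + ln (f (Inr (Inr i)))) \<circ> (\<lambda>\<omega>. restrict (\<lambda>i. ?X i \<omega>) (range Inr)))"
    by (rule indep_var_compose)
       (auto intro!: measurable_PiM_single' measurable_component_singleton simp: space_PiM PiE_iff)
  thus "indep_var (\<Pi>\<^sub>M i\<in>(UNIV :: nat set). borel) (\<lambda>\<omega> i. E i \<omega>)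
      (\<Pi>\<^sub>M i\<in>(UNIV :: nat set). borel) (\<lambda>\<omega> i. L i \<omega> + ln (W i \<omega>))"
    by (simp add: comp_def)
qed

end

text \<open>Integrate over the value w > 0 of W last: given it, the Gumbel probability of being at
  most x - ln w is exp(- exp(-x) w).\<close>

lemma (in W_fixpoint) Gumbel_plus_ln_cdf:
  assumes M: "prob_space M" and ind: "prob_space.indep_var M borel L borel W"
    and L: "\<And>x. \<P>(\<omega> in M. L \<omega> \<le> x) = exp (- exp (- x))"
    and W: "distr M borel W = \<mu>"
  shows "measure (distr M borel (\<lambda>\<omega>. L \<omega> + ln (W \<omega>))) {..x} = F x"
proof -
  interpret M: prob_space M by fact
  have Lm [measurable]: "L \<in> borel_measurable M" and Wm [measurable]: "W \<in> borel_measurable M"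
    using ind by (auto dest: M.indep_var_rv1 M.indep_var_rv2)
  have joint: "distr M (borel \<Otimes>\<^sub>M borel) (\<lambda>\<omega>. (L \<omega>, W \<omega>)) = distr M borel L \<Otimes>\<^sub>M \<mu>"
    using ind by (simp add: M.indep_var_distribution_eq W)
  interpret Ld: prob_space "distr M borel L" by (rule M.prob_space_distr) simp
  interpret P: pair_prob_space "distr M borel L" \<mu> ..
  have Lcdf: "emeasure (distr M borel L) {..y} = ennreal (exp (- exp (- y)))" for y
    using L[of y] by (subst emeasure_distr) (auto simp: M.emeasure_eq_measure vimage_def Int_def conj_commute)
  have [measurable]: "{z. fst z + ln (snd z) \<le> x} \<in> sets (borel \<Otimes>\<^sub>M borel :: (real \<times> real) measure)"
  proof -
    have "{z \<in> space (borel \<Otimes>\<^sub>M borel :: (real \<times> real) measure). fst z + ln (snd z) \<le> x}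
        \<in> sets (borel \<Otimes>\<^sub>M borel)" by measurable
    thus ?thesis by (simp add: space_pair_measure)
  qed
  have "emeasure (distr M borel (\<lambda>\<omega>. L \<omega> + ln (W \<omega>))) {..x}
      = emeasure (distr M (borel \<Otimes>\<^sub>M borel) (\<lambda>\<omega>. (L \<omega>, W \<omega>))) {z. fst z + ln (snd z) \<le> x}"
    by (subst (1 2) emeasure_distr) (auto intro!: arg_cong[where f = "emeasure M"])
  also have "\<dots> = (\<integral>\<^sup>+w. emeasure (distr M borel L) ((\<lambda>l. (l, w)) -` {z. fst z + ln (snd z) \<le> x}) \<partial>\<mu>)"
    unfolding joint by (rule P.emeasure_pair_measure_alt2) simp
  also have "\<dots> = (\<integral>\<^sup>+w. ennreal (exp (- exp (- x) * w)) \<partial>\<mu>)"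
  proof (rule nn_integral_cong_AE)
    show "AE w in \<mu>. emeasure (distr M borel L) ((\<lambda>l. (l, w)) -` {z. fst z + ln (snd z) \<le> x})
        = ennreal (exp (- exp (- x) * w))"
      using AE_pos
    proof eventually_elim
      case (elim w)
      have "(\<lambda>l. (l, w)) -` {z. fst z + ln (snd z) \<le> x} = {..x - ln w}" by auto
      moreover have "exp (- (x - ln w)) = exp (- x) * w" using elim by (simp add: exp_diff exp_minus field_simps)
      ultimately show ?case by (simp add: Lcdf)
    qed
  qed
  also have "\<dots> = ennreal (F x)"
    unfolding F_def phi_def by (intro nn_integral_eq_integral exp_W_integrable) auto
  finally show ?thesis
    by (simp add: measure_def)
qed

text \<open>The pair (gaps, marks) has law \<open>marked_poisson \<rho>\<close>, and
  \<open>Dhat\<close> is one plus \<open>N_count\<close> of that pair; the leading one accounts for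
  \<open>Suc k\<close>.\<close>

lemma (in W_fixpoint) Dhat_law:
  fixes E L W :: "nat \<Rightarrow> 'a \<Rightarrow> real"
  assumes M: "prob_space M"
    and ind: "prob_space.indep_vars M (\<lambda>_. borel) (case_sum E (case_sum L W)) (UNIV :: (nat + nat + nat) set)"
    and E: "\<And>i. distributed M lborel (E i) (exponential_density 1)"
    and L: "\<And>i x. \<P>(\<omega> in M. L i \<omega> \<le> x) = exp (- exp (- x))"
    and W: "\<And>i. distr M borel (W i) = \<mu>"
  obtains \<rho> where "poisson_marks s \<mu> \<rho>"
    "\<And>k. \<P>(\<omega> in M. Dhat s (arrival s (\<lambda>j. E j \<omega>)) (\<lambda>i. L i \<omega>) (\<lambda>i. W i \<omega>) = of_nat (Suc k))
        = (\<integral>r. pois (nu r) k \<partial>\<rho>)"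
proof -
  interpret M: prob_space M by fact
  let ?G = "\<lambda>i \<omega>. L i \<omega> + ln (W i \<omega>)"
  let ?B = "\<Pi>\<^sub>M i\<in>(UNIV :: nat set). borel :: real measure"
  have Gm [measurable]: "?G i \<in> borel_measurable M" for i
    using M.indep_vars_case_sum_add_ln[OF ind] by (simp add: M.indep_vars_def2)
  have Em [measurable]: "E i \<in> borel_measurable M" for i
    using M.indep_vars_case_sum_left[OF ind] by (simp add: M.indep_vars_def2)
  define \<rho> where "\<rho> = distr M borel (?G 0)"
  have rd: "real_distribution (distr M borel (?G i))" for i
    by (rule M.real_distribution_distr) simp
  have cdf: "measure (distr M borel (?G i)) {..x} = F x" for i x
    by (rule Gumbel_plus_ln_cdf[OF M M.indep_var_case_sum_pair[OF ind] L W])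
  have G_law: "distr M borel (?G i) = \<rho>" for i
    unfolding \<rho>_def by (intro cdf_unique rd) (simp add: cdf_def fun_eq_iff cdf)
  have E_law: "distr M borel (E i) = exp_law" for i
  proof -
    have "distr M borel (E i) = distr M lborel (E i)" by (rule distr_cong) auto
    thus ?thesis using E[of i] by (simp add: distributed_def exp_law_def)
  qed
  interpret pm: poisson_marks s \<mu> \<rho>
    by (intro poisson_marks.intro W_fixpoint_axioms poisson_marks_axioms.intro)
       (simp_all only: \<rho>_def rd cdf)
  let ?Z = "\<lambda>\<omega>. ((\<lambda>i. E i \<omega>), (\<lambda>i. ?G i \<omega>))"
  have Zm [measurable]: "?Z \<in> measurable M (?B \<Otimes>\<^sub>M ?B)"
    by (intro measurable_Pair measurable_PiM_single') auto
  have Z: "distr M (?B \<Otimes>\<^sub>M ?B) ?Z = marked_poisson \<rho>"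
    using M.indep_var_case_sum_sequences[OF ind]
    by (simp add: M.indep_var_distribution_eq marked_poisson_def M.distr_sequence_eq_PiM[OF M.indep_vars_case_sum_left[OF ind] E_law]
        M.distr_sequence_eq_PiM[OF M.indep_vars_case_sum_add_ln[OF ind] G_law])
  have Dhat: "Dhat s (arrival s (\<lambda>j. E j \<omega>)) (\<lambda>i. L i \<omega>) (\<lambda>i. W i \<omega>) = 1 + pm.N_count (?Z \<omega>)" for \<omega>
    by (simp add: Dhat_def pm.N_count_def pm.arr_def pm.Mval_def max_val_def arrival_def kap_def)
  have "\<P>(\<omega> in M. Dhat s (arrival s (\<lambda>j. E j \<omega>)) (\<lambda>i. L i \<omega>) (\<lambda>i. W i \<omega>) = of_nat (Suc k))
        = (\<integral>r. pois (nu r) k \<partial>\<rho>)" for k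
  proof -
    have "1 + x = of_nat (Suc k) \<longleftrightarrow> x = of_nat k" for x :: ennreal
      by (simp add: ennreal_add_left_cancel)
    hence "\<P>(\<omega> in M. Dhat s (arrival s (\<lambda>j. E j \<omega>)) (\<lambda>i. L i \<omega>) (\<lambda>i. W i \<omega>) = of_nat (Suc k))
        = \<P>(\<omega> in M. ?Z \<omega> \<in> {x. pm.N_count x = of_nat k})"
      unfolding Dhat by simp
    also have "\<dots> = measure (distr M (?B \<Otimes>\<^sub>M ?B) ?Z) {x. pm.N_count x = of_nat k}"
    proof (subst measure_distr)
      have "{x \<in> space (marked_poisson \<rho>). pm.N_count x = of_nat k} \<in> sets (marked_poisson \<rho>)" by measurable
      thus "{x. pm.N_count x = of_nat k} \<in> sets (?B \<Otimes>\<^sub>M ?B)"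
        by (simp add: sets_marked_poisson \<rho>_def)
    qed (auto simp: vimage_def Int_def conj_commute)
    finally show ?thesis unfolding Z by (simp add: pm.prob_N_count)
  qed
  thus ?thesis using that pm.poisson_marks_axioms by blast
qed

section \<open>The mixed Poisson probabilities\<close>

lemma lam_1 [simp]: "lam 1 = 1"
  using Gamma_fact[of 1, where 'a = real] by (simp add: lam_def)

context W_fixpoint
begin

lemma tau_at_top: "filterlim tau at_top at_top"
proof -
  have "filterlim (\<lambda>m. (m / c) powr (1 / s)) at_top at_top" if "c > 0" for c
    using that s_pos by real_asymp
  from this[OF lam_s_pos] show ?thesis unfolding tau_def .
qed

lemma kap_1: "s = 1 \<Longrightarrow> kap t = \<bar>t\<bar>"
proof -
  assume s: "s = 1"
  have "lam s = 1" using s by simp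
  moreover have "t powr s = \<bar>t\<bar>" using abs_powr[of t 1] s by simp
  ultimately show ?thesis by (simp only: kap_def mult_1)
qed

lemma F_lim_at_bot: "((\<lambda>t. F (m - t)) \<longlongrightarrow> 0) at_top"
proof (rule tendsto_sandwich[OF _ _ tendsto_const])
  have "filterlim (\<lambda>t. t - m) at_top at_top" by real_asymp
  hence "filterlim (\<lambda>t. tau (t - m)) at_top at_top"
    by (rule filterlim_compose[OF tau_at_top])
  moreover have "1 - F 0 > 0" by simp
  ultimately show "((\<lambda>t. exp (- (1 - F 0) * tau (t - m))) \<longlongrightarrow> 0) at_top"
    by (intro filterlim_compose[OF exp_at_bot] filterlim_tendsto_neg_mult_at_bot[OF tendsto_const]) auto
  show "eventually (\<lambda>t. F (m - t) \<le> exp (- (1 - F 0) * tau (t - m))) at_top"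
    using eventually_ge_at_top[of m]
  proof eventually_elim
    case (elim t)
    thus ?case using F_decay[of "t - m"] by simp
  qed
qed (auto intro!: always_eventually)

end

context poisson_marks
begin

lemma nu_upper_tau: obtains C where "C \<ge> 0" "\<And>m. m \<ge> 0 \<Longrightarrow> nu m \<le> 2 * tau m + C"
  using nu_upper[of 1] by auto

text \<open>The probability of \<open>k\<close> counted points, hence of degree
  \<open>k + 1\<close>.\<close>

definition q :: "nat \<Rightarrow> real" where
  "q k = (\<integral>r. pois (nu r) k \<partial>\<rho>)"

lemma pois_integrable: "integrable \<rho> (\<lambda>r. pois (nu r) k)"
  by (rule rho.integrable_const_bound[where B=1]) (auto simp: pois_nonneg pois_le_1)

text \<open>Split at level \<open>m\<close>: above it the weight is at most 1 and the mass at most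
  \<open>exp (- m)\<close>; below it the mean \<open>nu r\<close> is at most
  \<open>nu m\<close>.\<close>

lemma q_le:
  assumes "\<And>v. 0 \<le> v \<Longrightarrow> v \<le> nu m \<Longrightarrow> pois v k \<le> B"
  shows "q k \<le> exp (- m) + B"
proof -
  have B: "B \<ge> 0" using assms[of "nu m"] pois_nonneg[of "nu m" k] by simp
  have "q k \<le> (\<integral>r. indicator {m<..} r + B \<partial>\<rho>)"
    unfolding q_def
  proof (rule integral_mono[OF pois_integrable])
    show "integrable \<rho> (\<lambda>r. indicator {m<..} r + B)"
      by (intro Bochner_Integration.integrable_add) (auto simp: rho.emeasure_eq_measure)
    show "pois (nu r) k \<le> indicator {m<..} r + B" for r
      using assms[of "nu r"] nu_mono[of r m] pois_le_1[of "nu r" k] B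
      by (cases "r \<le> m") (auto simp: not_le)
  qed
  also have "\<dots> = measure \<rho> {m<..} + B"
    using rho.prob_space by (subst Bochner_Integration.integral_add) (auto simp: rho.emeasure_eq_measure)
  also have "{m<..} = space \<rho> - {..m}" by auto
  also have "measure \<rho> (space \<rho> - {..m}) = 1 - F m"
    by (subst rho.prob_compl) (auto simp: cdf_rho)
  finally show ?thesis using F_ge[of m] by linarith
qed

lemma q_ge:
  assumes "m \<le> m'" "\<And>v. nu m \<le> v \<Longrightarrow> v \<le> nu m' \<Longrightarrow> B \<le> pois v k"
  shows "B * (F m' - F m) \<le> q k"
proof -
  have "B * (F m' - F m) = (\<integral>r. indicator {m<..m'} r * B \<partial>\<rho>)"
    by (simp add: prob_rho_Ioc assms(1))
  also have "\<dots> \<le> q k"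
    unfolding q_def
  proof (rule integral_mono[OF _ pois_integrable])
    show "integrable \<rho> (\<lambda>r. indicator {m<..m'} r * B)"
      by (intro integrable_mult_left) (auto simp: rho.emeasure_eq_measure)
    show "indicator {m<..m'} r * B \<le> pois (nu r) k" for r
      using assms(2)[of "nu r"] nu_mono[of m r] nu_mono[of r m'] by (auto simp: indicator_def pois_nonneg)
  qed
  finally show ?thesis .
qed

section \<open>The case s = 1\<close>

text \<open>For s = 1 the shift by \<open>kap t\<close> is a time shift, so
  \<open>F (m0 + u)\<close> is \<open>void_prob\<close> of \<open>F (m0 + kap t)\<close> and
  inherits its differential equation. Taking \<open>m0 = m - 1\<close> places the point at u = 1,
  away from the kink of \<open>kap\<close> at 0.\<close>

lemma F_deriv:
  assumes "s = 1"
  shows "(F has_real_derivative F m * (1 - F m)) (at m)"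
proof -
  note kap = kap_1[OF assms]
  define m0 where "m0 = m - 1"
  define H where "H t = F (m0 + kap t)" for t
  have shift: "F (m0 + u) = void_prob H u" if "u \<ge> 0" for u
  proof -
    have "(LBINT t:{u..}. 1 - H t) = (LBINT t. indicator {u..} (u + t) *\<^sub>R (1 - H (u + t)))"
      unfolding set_lebesgue_integral_def
      using lborel_integral_real_affine[of 1 "\<lambda>t. indicator {u..} t *\<^sub>R (1 - H t)" u] by simp
    also have "\<dots> = (LBINT t:{0..}. 1 - F (m0 + u + kap t))"
      unfolding set_lebesgue_integral_def
      by (rule Bochner_Integration.integral_cong) (use that in \<open>auto simp: H_def kap indicator_def add.assoc\<close>)
    finally show ?thesis unfolding void_prob_def by (subst F_fix) simp
  qed
  have H: "0 \<le> H t" "H t \<le> 1" for t by (simp_all add: H_def)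
  have cont: "continuous_on UNIV H"
    unfolding H_def by (intro continuous_on_compose2[OF F_cont[of UNIV]] continuous_intros kap_cont) auto
  have int: "integrable lborel (\<lambda>t. 1 - H t)"
    unfolding H_def by (rule one_minus_F_integrable)
  have "(void_prob H has_real_derivative (1 - H 1) * void_prob H 1) (at (m - m0))"
    using void_prob_deriv[OF cont H int, of 1] by (simp add: m0_def)
  hence "((\<lambda>x. void_prob H (x - m0)) has_real_derivative (1 - H 1) * void_prob H 1) (at m)"
    by (rule DERIV_chain2[THEN DERIV_cong]) (auto intro!: derivative_eq_intros)
  moreover have "(1 - H 1) * void_prob H 1 = F m * (1 - F m)"
    using shift[of 1] by (simp add: H_def kap m0_def)
  moreover have "eventually (\<lambda>x. void_prob H (x - m0) = F x) (nhds m)"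
  proof (rule eventually_nhds_in_open[of "{m0<..}", THEN eventually_mono])
    show "void_prob H (x - m0) = F x" if "x \<in> {m0<..}" for x
      using shift[of "x - m0"] that by simp
  qed (auto simp: m0_def)
  ultimately show ?thesis
    using DERIV_cong_ev[OF refl _ refl] by metis
qed

text \<open>By the logistic equation for \<open>F\<close>, \<open>ln (1 - F (m - t))\<close> is an
  antiderivative of \<open>F (m - t)\<close>.\<close>

lemma exp_nu:
  assumes "s = 1"
  shows "exp (- nu m) = 1 - F m"
proof -
  note kap = kap_1[OF assms]
  have "(\<integral>\<^sup>+t. ennreal (F (m - t)) * indicator {0..} t \<partial>lborel) = ennreal (0 - ln (1 - F (m - 0)))"
  proof (rule nn_integral_FTC_atLeast)
    show "((\<lambda>t. ln (1 - F (m - t))) has_real_derivative F (m - x)) (at x)" for x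
      by (auto intro!: derivative_eq_intros DERIV_chain2[OF F_deriv[OF assms]] simp: less_imp_neq[OF F_less_1])
    have "((\<lambda>t. ln (1 - F (m - t))) \<longlongrightarrow> ln (1 - 0)) at_top"
      by (intro tendsto_intros F_lim_at_bot) auto
    thus "((\<lambda>t. ln (1 - F (m - t))) \<longlongrightarrow> 0) at_top" by simp
  qed auto
  moreover have "nu m = enn2real (\<integral>\<^sup>+t. ennreal (F (m - t)) * indicator {0..} t \<partial>lborel)"
    unfolding nu_def set_lebesgue_integral_def
    by (subst integral_eq_nn_integral)
       (auto intro!: arg_cong[where f = enn2real] nn_integral_cong simp: kap indicator_def)
  ultimately have "nu m = - ln (1 - F m)" by (simp add: ln_le_zero_iff)
  thus ?thesis by simp
qed

text \<open>Since \<open>nu = - ln (1 - F)\<close> and \<open>F\<close> is continuous and strictly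
  increasing, the event \<open>nu r \<le> a\<close> is a half-line up to the point where
  \<open>F\<close> equals \<open>1 - exp (- a)\<close>. For a = 0 there is no such point and the
  event is empty.\<close>

lemma nu_exponential:
  assumes "s = 1"
  shows "distributed \<rho> lborel nu (exponential_density 1)"
proof (rule exponential_distributedI)
  fix a :: real assume a: "0 \<le> a"
  have iff: "nu r \<le> a \<longleftrightarrow> F r \<le> 1 - exp (- a)" for r
  proof -
    have "nu r \<le> a \<longleftrightarrow> exp (- a) \<le> exp (- nu r)" by simp
    thus ?thesis by (simp only: exp_nu[OF assms]) linarith
  qed
  have "emeasure \<rho> {r \<in> space \<rho>. nu r \<le> a} = ennreal (1 - exp (- a))"
  proof (cases "a = 0")
    case True
    have "\<not> nu r \<le> a" for r
      unfolding iff using True F_pos[of r] by (simp del: F_pos)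
    hence "{r. nu r \<le> a} = {}" by simp
    thus ?thesis using True by simp
  next
    case False
    hence a: "0 < 1 - exp (- a)" "1 - exp (- a) < 1" using a by auto
    have "eventually (\<lambda>t. F t > 1 - exp (- a)) at_top"
      using F_lim a(2) by (rule order_tendstoD(1))
    then obtain y where y: "F y > 1 - exp (- a)"
      by (auto simp: eventually_at_top_linorder)
    have "eventually (\<lambda>t. F (0 - t) < 1 - exp (- a)) at_top"
      using F_lim_at_bot a(1) by (rule order_tendstoD(2))
    then obtain x where x: "F (- x) < 1 - exp (- a)"
      by (auto simp: eventually_at_top_linorder)
    have "- x \<le> y" using x y F_mono[of y "- x"] by linarith
    then obtain r0 where r0: "F r0 = 1 - exp (- a)"
      using IVT'[of F "- x" "1 - exp (- a)" y] x y F_cont by auto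
    have inc: "F r0 < F r" if "r0 < r" for r
    proof (rule DERIV_pos_imp_increasing[OF that])
      show "\<exists>y. (F has_real_derivative y) (at x) \<and> 0 < y" for x
        using F_deriv[OF assms, of x] by (intro exI[of _ "F x * (1 - F x)"]) auto
    qed
    have "nu r \<le> a \<longleftrightarrow> r \<le> r0" for r
      unfolding iff r0[symmetric] using inc[of r] F_mono[of r r0] by linarith
    hence "{r. nu r \<le> a} = {..r0}" by auto
    thus ?thesis by (simp add: rho.emeasure_eq_measure cdf_rho r0)
  qed
  also have "\<dots> = 1 - ennreal (exp (- a * 1))"
    by (simp add: ennreal_minus flip: ennreal_1)
  finally show "emeasure \<rho> {r \<in> space \<rho>. nu r \<le> a} = 1 - ennreal (exp (- a * 1))" .
qed auto

text \<open>The exponential density times the Poisson weight is \<open>(1 / 2) ^ Suc k\<close> times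
  an Erlang density of rate 2.\<close>

lemma q_geometric:
  assumes "s = 1"
  shows "q k = (1 / 2) ^ Suc k"
proof -
  have "q k = (\<integral>v. exponential_density 1 v * pois v k \<partial>lborel)"
    unfolding q_def
    by (rule distributed_integral[symmetric, OF nu_exponential[OF assms]])
       (auto simp: pois_def exponential_density_def)
  also have "\<dots> = (\<integral>v. (1 / 2) ^ Suc k * erlang_density k 2 v \<partial>lborel)"
    by (rule Bochner_Integration.integral_cong)
       (auto simp: exponential_density_def erlang_density_def pois_def power_divide mult_exp_exp field_simps)
  also have "\<dots> = (1 / 2) ^ Suc k * (\<integral>v. erlang_density k 2 v \<partial>lborel)" by simp
  also have "(\<integral>v. erlang_density k 2 v \<partial>lborel) = 1"
    using nn_integral_erlang_ith_moment[of 2 k 0] by (subst integral_eq_nn_integral) auto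
  finally show ?thesis by simp
qed

end

section \<open>Estimates for Poisson weights\<close>

lemma power_self_div_fact_le: "real n ^ n / fact n \<le> exp (real n)"
proof -
  have "exp (real n) * pois (real n) n \<le> exp (real n) * 1"
    by (intro mult_left_mono pois_le_1) auto
  thus ?thesis by (simp add: pois_def exp_minus field_simps)
qed

text \<open>A crude bound, dropping \<open>exp (- v)\<close>; it is sharp enough when the mean is
  much smaller than \<open>n\<close>, as for s > 1.\<close>

lemma pois_le_power:
  assumes "0 \<le> v" "v \<le> b" "n > 0"
  shows "pois v n \<le> (b * exp 1 / real n) ^ n"
proof -
  have "pois v n \<le> 1 * v ^ n / fact n"
    unfolding pois_def using assms by (intro divide_right_mono mult_right_mono) auto
  also have "\<dots> \<le> b ^ n / fact n"
    using assms by (intro divide_right_mono) (auto intro!: power_mono)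
  also have "\<dots> = (b / real n) ^ n * (real n ^ n / fact n)"
    using assms by (simp add: power_divide)
  also have "\<dots> \<le> (b / real n) ^ n * exp (real n)"
    using assms by (intro mult_left_mono power_self_div_fact_le) auto
  also have "exp (real n) = exp 1 ^ n" by (simp flip: exp_of_nat_mult)
  finally show ?thesis by (simp add: power_mult_distrib power_divide)
qed

text \<open>Below its mode \<open>n\<close> the Poisson weight is largest at the right end \<open>v = r n\<close>.\<close>

lemma pois_le_exp:
  assumes "0 \<le> v" "v \<le> r * real n" "0 < r" "r \<le> 1" "n > 0"
  shows "pois v n \<le> exp (- (r - 1 - ln r) * real n)"
proof -
  \<comment> \<open>Since x \<le> 1 and r \<le> 1, x^n \<le> exp(n (x - 1)) \<le> exp(r n (x - 1)) =
    exp(v - r n), which cancels \<open>exp (- v)\<close>.\<close>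
  define x where "x = v / (r * real n)"
  have x: "0 \<le> x" using assms by (simp add: x_def)
  have v: "v = x * (r * real n)" using assms by (simp add: x_def)
  have "x \<le> 1" using assms by (simp add: x_def)
  have "x ^ n \<le> exp (x - 1) ^ n"
    using x exp_ge_add_one_self[of "x - 1"] by (intro power_mono) auto
  also have "\<dots> = exp (real n * (x - 1))" by (simp add: exp_of_nat_mult)
  also have "real n * (x - 1) \<le> (r * real n) * (x - 1)"
    using assms \<open>x \<le> 1\<close> by (intro mult_right_mono_neg) (auto simp: mult_left_le_one_le)
  hence "exp (real n * (x - 1)) \<le> exp (v - r * real n)" by (simp add: v algebra_simps)
  finally have xn: "x ^ n \<le> exp (v - r * real n)" .
  have rn: "r ^ n = exp (real n * ln r)" using assms by (simp add: exp_of_nat_mult)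
  have "pois v n = exp (- v) * x ^ n * r ^ n * (real n ^ n / fact n)"
    by (simp add: pois_def v power_mult_distrib)
  also have "\<dots> \<le> exp (- v) * exp (v - r * real n) * r ^ n * exp (real n)"
    using assms x by (intro mult_mono xn power_self_div_fact_le mult_nonneg_nonneg) auto
  also have "\<dots> = exp (- (r - 1 - ln r) * real n)"
    unfolding rn by (simp add: mult_exp_exp algebra_simps)
  finally show ?thesis .
qed

text \<open>The induction step is (1 - 1/(n+1))^(n+1) \<le> 1/e.\<close>

lemma fact_le_stirling:
  assumes "n > 0"
  shows "fact n \<le> exp 1 * real n * (real n / exp 1) ^ n"
  using assms
proof (induction n rule: nat_induct_non_zero)
  case 1
  show ?case by simp
next
  case (Suc n)
  let ?x = "1 / real (Suc n)"
  have "1 - ?x \<le> exp (- ?x)" using exp_ge_add_one_self[of "- ?x"] by simp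
  hence "(1 - ?x) ^ Suc n \<le> exp (- ?x) ^ Suc n" by (intro power_mono) auto
  also have "\<dots> = exp (real (Suc n) * (- ?x))" by (simp only: exp_of_nat_mult)
  also have "real (Suc n) * (- ?x) = - 1" by (simp add: field_simps)
  also have "1 - ?x = real n / real (Suc n)" by (simp add: field_simps)
  finally have "real n ^ Suc n \<le> exp (- 1) * real (Suc n) ^ Suc n"
    by (simp only: power_divide) (simp add: pos_divide_le_eq)
  hence le: "real n ^ Suc n * exp 1 \<le> real (Suc n) ^ Suc n"
    by (simp add: exp_minus field_simps)
  have "fact (Suc n) = real (Suc n) * fact n" by simp
  also have "\<dots> \<le> real (Suc n) * (exp 1 * real n * (real n / exp 1) ^ n)"
    by (intro mult_left_mono Suc.IH) auto
  also have "\<dots> = exp 1 * real (Suc n) * (real n ^ Suc n * exp 1) / exp 1 ^ Suc n"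
    by (simp add: power_divide field_simps)
  also have "\<dots> \<le> exp 1 * real (Suc n) * real (Suc n) ^ Suc n / exp 1 ^ Suc n"
    by (intro divide_right_mono mult_left_mono le) auto
  finally show ?case by (simp add: power_divide)
qed

text \<open>At mean \<open>n\<close> the weight loses only a factor linear in \<open>n\<close>;
  raising the mean by at most \<open>b\<close> costs at most \<open>exp (- b)\<close>.\<close>

lemma pois_ge:
  assumes "n > 0" "real n \<le> v" "v \<le> real n + b"
  shows "exp (- b) / (exp 1 * real n) \<le> pois v n"
proof -
  have "1 / (exp 1 * real n) \<le> exp (- real n) * real n ^ n / fact n"
  proof -
    have "exp (real n) * fact n \<le> exp (real n) * (exp 1 * real n * (real n / exp 1) ^ n)"
      by (intro mult_left_mono fact_le_stirling assms) auto
    also have "\<dots> = exp 1 * real n * real n ^ n"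
      by (simp add: power_divide flip: exp_of_nat_mult)
    finally show ?thesis using assms by (simp add: exp_minus field_simps)
  qed
  hence "exp (- b) * (1 / (exp 1 * real n)) \<le> exp (- b) * (exp (- real n) * real n ^ n / fact n)"
    by (intro mult_left_mono) auto
  also have "\<dots> = exp (- (real n + b)) * real n ^ n / fact n"
    by (simp add: mult_exp_exp algebra_simps)
  also have "\<dots> \<le> pois v n"
    unfolding pois_def using assms by (intro divide_right_mono mult_mono power_mono) auto
  finally show ?thesis by simp
qed

section \<open>Growth of \<open>nu\<close> and positivity of \<open>q\<close>\<close>

context poisson_marks
begin

lemma tau_scale: "x \<ge> 0 \<Longrightarrow> tau (lam s * x powr s) = x"
  using s_pos by (simp add: tau_def powr_powr less_imp_neq[OF lam_s_pos, symmetric])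

lemma tau_le_iff:
  assumes "0 \<le> a" "0 \<le> x"
  shows "tau a \<le> x \<longleftrightarrow> a \<le> lam s * x powr s"
proof -
  have "strict_mono_on {0..} tau"
    unfolding strict_mono_on_def tau_def using s_pos
    by (auto intro!: powr_less_mono2 divide_strict_right_mono divide_nonneg_pos)
  hence "tau a \<le> tau (lam s * x powr s) \<longleftrightarrow> a \<le> lam s * x powr s"
    using assms by (intro strict_mono_on_less_eq) (auto simp: less_imp_le)
  thus ?thesis using assms by (simp add: tau_scale)
qed

text \<open>The loss \<open>r\<close> is shared equally: one factor \<open>sqrt r\<close> shortens
  the time range in \<open>nu_lower\<close>, the other bounds the value of \<open>F\<close>
  there.\<close>

lemma nu_lower_eventually:
  assumes "0 < r" "r < 1"
  obtains A where "A \<ge> 0" "\<And>a. a \<ge> A \<Longrightarrow> r * tau a \<le> nu a"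
proof -
  let ?r = "sqrt r"
  have r: "0 < ?r" "?r < 1" "?r * ?r = r" using assms by auto
  have "?r powr s < 1" using powr_less_mono2[of s ?r 1] r s_pos by simp
  hence "filterlim (\<lambda>a. a * (1 - ?r powr s)) at_top at_top"
    by (intro filterlim_at_top_mult_tendsto_pos[OF tendsto_const] filterlim_ident) auto
  hence "eventually (\<lambda>a. F (a * (1 - ?r powr s)) > ?r) at_top"
    using r(2) by (intro order_tendstoD(1)[OF filterlim_compose[OF F_lim]])
  then obtain A where A: "\<And>a. a \<ge> A \<Longrightarrow> F (a * (1 - ?r powr s)) > ?r"
    by (auto simp: eventually_at_top_linorder)
  have "r * tau a \<le> nu a" if "a \<ge> max 0 A" for a
  proof -
    have "r * tau a = ?r * tau a * ?r" using r(3) by (simp add: mult.commute mult.left_commute)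
    also have "\<dots> \<le> ?r * tau a * F (a * (1 - ?r powr s))"
      using A[of a] that r by (intro mult_left_mono) auto
    also have "\<dots> \<le> nu a" using that r by (intro nu_lower) auto
    finally show ?thesis .
  qed
  thus ?thesis using that[of "max 0 A"] by simp
qed

lemma nu_at_top: "filterlim nu at_top at_top"
proof -
  obtain A where A: "A \<ge> 0" "\<And>a. a \<ge> A \<Longrightarrow> (1 / 2) * tau a \<le> nu a"
    by (rule nu_lower_eventually[of "1 / 2"]) auto
  have "filterlim (\<lambda>a. (1 / 2) * tau a) at_top at_top"
    by (rule filterlim_tendsto_pos_mult_at_top[OF tendsto_const _ tau_at_top]) simp
  moreover have "eventually (\<lambda>a. (1 / 2) * tau a \<le> nu a) at_top"
    using A by (auto simp: eventually_at_top_linorder)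
  ultimately show ?thesis by (rule filterlim_at_top_mono)
qed


text \<open>Makes \<open>ln (q k)\<close> a genuine logarithm. A window with
  \<open>nu m \<ge> 1\<close> is convenient because then \<open>v ^ k \<ge> 1\<close>.\<close>

lemma q_pos: "q k > 0"
proof -
  obtain c where c: "c > 0"
    "\<And>m \<delta>. m \<ge> 0 \<Longrightarrow> \<delta> \<ge> 0 \<Longrightarrow> F (m + \<delta>) - F m \<ge> c * (exp (- m) - exp (- (m + \<delta>)))"
    using F_incr_lower by blast
  have "eventually (\<lambda>m. nu m \<ge> 1 \<and> m \<ge> 0) at_top"
    using nu_at_top by (intro eventually_conj eventually_ge_at_top) (simp add: filterlim_at_top)
  then obtain m where m: "nu m \<ge> 1" "m \<ge> 0"
    by (auto simp: eventually_at_top_linorder)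
  have "0 < exp (- nu (m + 1)) / fact k * (c * (exp (- m) - exp (- (m + 1))))"
    using c(1) by simp
  also have "\<dots> \<le> exp (- nu (m + 1)) / fact k * (F (m + 1) - F m)"
    using c(2)[of m 1] m by (intro mult_left_mono) auto
  also have "\<dots> \<le> q k"
  proof (rule q_ge)
    fix v assume v: "nu m \<le> v" "v \<le> nu (m + 1)"
    have "1 \<le> v ^ k" using v m by (intro one_le_power) auto
    hence "exp (- nu (m + 1)) * 1 \<le> exp (- v) * v ^ k" using v by (intro mult_mono) auto
    thus "exp (- nu (m + 1)) / fact k \<le> pois v k"
      by (simp add: pois_def divide_right_mono)
  qed simp
  finally show ?thesis .
qed

section \<open>The case s < 1\<close>

text \<open>Split at \<open>m = lam s * \<theta> * real j powr s\<close>. Below it the means stay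
  under \<open>r * real j\<close> with r < 1, so the Poisson weight is exponentially small in
  \<open>j\<close>; the tail \<open>exp (- m)\<close> dominates.\<close>

lemma ln_q_upper_less:
  assumes s: "s < 1" and \<theta>: "0 < \<theta>" "\<theta> < 1"
  shows "eventually (\<lambda>j. ln (q j) \<le> ln 2 - lam s * \<theta> * real j powr s) sequentially"
proof -
  \<comment> \<open>Then \<open>tau m\<close> is \<open>r\<^sup>2 * real j\<close>; one of the two
    factors \<open>r\<close> pays for the passage from \<open>tau\<close> to \<open>nu\<close>, the
    other keeps the mean below \<open>j\<close>.\<close>
  define r where "r = \<theta> powr (1 / (2 * s))"
  have r: "0 < r" "r < 1"
    using powr_less_mono2[of "1 / (2 * s)" \<theta> 1] \<theta> s_pos by (auto simp: r_def)
  have r2: "(r\<^sup>2 * x) powr s = \<theta> * x powr s" if "x \<ge> 0" for x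
    using that \<theta> s_pos
    by (simp add: powr_mult r_def powr_powr power2_eq_square flip: powr_add)
  \<comment> \<open>\<open>1 + \<epsilon>\<close> is the midpoint of 1 and 1/r, so
    \<open>(1 + \<epsilon>) * r\<^sup>2 < r\<close> with a linear margin that absorbs
    \<open>C\<close>.\<close>
  define \<epsilon> where "\<epsilon> = (1 / r - 1) / 2"
  have \<epsilon>: "\<epsilon> > 0" using r by (simp add: \<epsilon>_def)
  have \<epsilon>r: "(1 + \<epsilon>) * (r\<^sup>2 * x) = r * x - r * (1 - r) / 2 * x" for x
    using r by (simp add: \<epsilon>_def power2_eq_square field_simps)
  obtain C where C: "C \<ge> 0" "\<And>m. m \<ge> 0 \<Longrightarrow> nu m \<le> (1 + \<epsilon>) * tau m + C"
    using nu_upper[OF \<epsilon>] by blast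
  define c where "c = r - 1 - ln r"
  have "ln r \<noteq> r - 1" using r ln_eq_minus_one[of r] by auto
  hence c: "c > 0" using ln_le_minus_one[of r] r by (simp add: c_def)
  define l where "l = lam s * \<theta>"
  have l: "l > 0" using \<theta> by (simp add: l_def)
  have pos: "r * (1 - r) / 2 > 0" using r by simp
  define d where "d = r * (1 - r) / 2"
  have "d > 0" using pos by (simp add: d_def)
  hence ev1: "eventually (\<lambda>j. C \<le> d * real j) sequentially" by real_asymp
  \<comment> \<open>Here s < 1 is decisive: the level is sublinear in \<open>j\<close>.\<close>
  have ev2: "eventually (\<lambda>j. l * real j powr s \<le> c * real j) sequentially"
    using l c s s_pos by real_asymp
  from ev1 ev2 eventually_gt_at_top[of 0] show ?thesis
  proof eventually_elim
    case (elim j)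
    define m where "m = lam s * (r\<^sup>2 * real j) powr s"
    have tau_m: "tau m = r\<^sup>2 * real j" unfolding m_def by (rule tau_scale) simp
    have m: "m = l * real j powr s" by (simp add: m_def r2 l_def)
    have "nu m \<le> (1 + \<epsilon>) * (r\<^sup>2 * real j) + C"
      using C(2)[of m] tau_m l by (simp add: m)
    also have "\<dots> \<le> r * real j" using elim(1) unfolding \<epsilon>r d_def by simp
    finally have nu: "nu m \<le> r * real j" .
    have "q j \<le> exp (- m) + exp (- c * real j)"
    proof (rule q_le)
      show "pois v j \<le> exp (- c * real j)" if "0 \<le> v" "v \<le> nu m" for v
        unfolding c_def using that nu r elim by (intro pois_le_exp) auto
    qed
    also have "exp (- c * real j) \<le> exp (- m)" using elim(2) by (simp add: m)
    finally have "q j \<le> 2 * exp (- m)" by simp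
    hence "ln (q j) \<le> ln (2 * exp (- m))" using q_pos[of j] by simp
    also have "\<dots> = ln 2 - m" by (simp add: ln_mult)
    finally show ?case by (simp add: m l_def)
  qed
qed

text \<open>The window \<open>a \<le> m \<le> a + 1/j\<close> above the point \<open>a\<close> with \<open>nu a = j\<close> is short enough for
  \<open>nu m - j\<close> to stay bounded, yet its probability is only polynomially smaller than \<open>exp (- a)\<close>.\<close>

lemma ln_q_lower_window:
  obtains C where
    "eventually (\<lambda>j. \<exists>a\<ge>0. nu a = real j \<and> - a - C - 2 * ln (real j) \<le> ln (q j)) sequentially"
proof -
  obtain c where c: "c > 0"
    "\<And>m \<delta>. m \<ge> 0 \<Longrightarrow> \<delta> \<ge> 0 \<Longrightarrow> F (m + \<delta>) - F m \<ge> c * (exp (- m) - exp (- (m + \<delta>)))"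
    using F_incr_lower by blast
  obtain A where A: "A \<ge> 0" "\<And>a. a \<ge> A \<Longrightarrow> (1 / 2) * tau a \<le> nu a"
    by (rule nu_lower_eventually[of "1 / 2"]) auto
  obtain D where D: "D \<ge> 0" "\<And>m. m \<ge> 0 \<Longrightarrow> nu m \<le> 2 * tau m + D"
    using nu_upper_tau by blast
  \<comment> \<open>With a \<ge> 2 one has a + 2 \<le> 2a, so \<open>tau (a + 2)\<close> is at most
    \<open>2 powr (1 / s) * tau a\<close>, and \<open>tau a \<le> 2 * real j\<close>. Hence
    \<open>nu (a + 2) \<le> K * real j\<close>.\<close>
  define a0 where "a0 = max A 2"
  define K where "K = 4 * 2 powr (1 / s) + D"
  have K: "K > 0" using D(1) by (simp add: K_def add_pos_nonneg)
  \<comment> \<open>\<open>exp (- 2 * K)\<close> and \<open>exp 1\<close> come from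
    \<open>pois_ge\<close>, \<open>c\<close> and the 2 from the mass of the window; each of the two
    bounds also contributes one factor 1/j.\<close>
  define c' where "c' = exp (- 2 * K) * c / (2 * exp 1)"
  have c': "c' > 0" using c(1) by (simp add: c'_def)
  have "eventually (\<lambda>j. nu a0 \<le> real j) sequentially" by real_asymp
  from this eventually_ge_at_top[of 2]
  have "eventually (\<lambda>j. \<exists>a\<ge>0. nu a = real j \<and> - a - (- ln c') - 2 * ln (real j) \<le> ln (q j)) sequentially"
  proof eventually_elim
    case (elim j)
    obtain y where y: "a0 \<le> y" "real j \<le> nu y"
    proof -
      have "eventually (\<lambda>y. real j \<le> nu y \<and> a0 \<le> y) at_top"
        using nu_at_top by (intro eventually_conj eventually_ge_at_top) (simp add: filterlim_at_top)
      thus ?thesis using that by (auto simp: eventually_at_top_linorder)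
    qed
    obtain a where a: "a0 \<le> a" "nu a = real j"
      using IVT'[of nu a0 "real j" y] y elim continuous_on_subset[OF nu_cont] by auto
    have a2: "a \<ge> 2" "a \<ge> A" using a(1) by (auto simp: a0_def)
    define \<delta> where "\<delta> = 1 / real j"
    have \<delta>: "0 < \<delta>" "\<delta> \<le> 1 / 2" using elim(2) by (auto simp: \<delta>_def field_simps)
    have "tau (a + 2) \<le> tau (2 * a)"
      unfolding tau_def using a2 s_pos by (intro powr_mono2 divide_right_mono) (auto simp: less_imp_le)
    also have "\<dots> = 2 powr (1 / s) * tau a"
      using a2 by (simp add: tau_def powr_mult powr_divide less_imp_le)
    finally have tau2: "tau (a + 2) \<le> 2 powr (1 / s) * tau a" .
    have "tau a \<le> 2 * real j" using A(2)[OF a2(2)] a(2) by simp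
    hence "2 powr (1 / s) * tau a \<le> 2 powr (1 / s) * (2 * real j)" by (intro mult_left_mono) auto
    moreover have "D * 1 \<le> D * real j" using D(1) elim(2) by (intro mult_left_mono) auto
    moreover have "K * real j = 2 * (2 powr (1 / s) * (2 * real j)) + D * real j"
      by (simp add: K_def distrib_right)
    moreover have "nu (a + 2) \<le> 2 * tau (a + 2) + D" using a2 by (intro D(2)) auto
    ultimately have nu2: "nu (a + 2) \<le> K * real j" using tau2 by linarith
    have ln2: "ln 2 \<le> (1 :: real)" using ln_le_minus_one[of "2 :: real"] by simp
    have "nu (a + \<delta>) - nu a \<le> (exp \<delta> - 1) * nu (a + \<delta> + ln 2)"
      using \<delta> by (intro nu_incr) auto
    also have "\<dots> \<le> (2 * \<delta>) * nu (a + 2)"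
    proof (intro mult_mono nu_mono)
      show "exp \<delta> - 1 \<le> 2 * \<delta>" using exp_bound_lemma[of \<delta>] \<delta> by simp
      show "a + \<delta> + ln 2 \<le> a + 2" using \<delta> ln2 by linarith
    qed (use \<delta> in auto)
    also have "\<dots> \<le> (2 * \<delta>) * (K * real j)" using nu2 \<delta> by (intro mult_left_mono) auto
    also have "\<dots> = 2 * K" using elim(2) by (simp add: \<delta>_def)
    finally have nu\<delta>: "nu (a + \<delta>) \<le> real j + 2 * K" using a(2) by simp
    have "\<delta> / 2 \<le> 1 - exp (- \<delta>)"
    proof -
      have "exp (- \<delta>) * (1 + \<delta>) \<le> exp (- \<delta>) * exp \<delta>"
        using exp_ge_add_one_self[of \<delta>] by (intro mult_left_mono) auto
      hence "exp (- \<delta>) \<le> 1 / (1 + \<delta>)" using \<delta> by (simp add: mult_exp_exp field_simps)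
      also have "\<dots> \<le> 1 - \<delta> / 2"
      proof -
        have "1 \<le> (1 - \<delta> / 2) * (1 + \<delta>)" using \<delta> mult_right_mono[of \<delta> 1 \<delta>] by (simp add: algebra_simps)
        thus ?thesis using \<delta> by (simp add: pos_divide_le_eq)
      qed
      finally show ?thesis by simp
    qed
    hence "exp (- a) * (\<delta> / 2) \<le> exp (- a) * (1 - exp (- \<delta>))" by (intro mult_left_mono) auto
    also have "\<dots> = exp (- a) - exp (- (a + \<delta>))" by (simp add: right_diff_distrib mult_exp_exp)
    finally have "c * (exp (- a) * (\<delta> / 2)) \<le> c * (exp (- a) - exp (- (a + \<delta>)))"
      using c(1) by (intro mult_left_mono) auto
    also have "\<dots> \<le> F (a + \<delta>) - F a" using a2 \<delta> by (intro c(2)) auto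
    finally have "exp (- (2 * K)) / (exp 1 * real j) * (c * (exp (- a) * (\<delta> / 2)))
        \<le> exp (- (2 * K)) / (exp 1 * real j) * (F (a + \<delta>) - F a)"
      by (intro mult_left_mono) auto
    also have "\<dots> \<le> q j"
      using elim(2) a(2) nu\<delta> \<delta> by (intro q_ge pois_ge) auto
    finally have "c' * exp (- a) / real j ^ 2 \<le> q j"
      by (simp add: c'_def \<delta>_def power2_eq_square mult_ac)
    moreover have "0 < c' * exp (- a) / real j ^ 2" using c' elim(2) by simp
    ultimately have "ln (c' * exp (- a) / real j ^ 2) \<le> ln (q j)" by simp
    moreover have "ln (c' * exp (- a) / real j ^ 2) = ln c' - a - 2 * ln (real j)"
      using c' elim(2) by (simp add: ln_div ln_mult ln_realpow)
    ultimately show ?case using a(2) a2 by (intro exI[of _ a]) auto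
  qed
  thus ?thesis by (rule that)
qed

text \<open>The level with \<open>nu a = real j\<close> satisfies
  \<open>r * tau a \<le> real j\<close> for large \<open>j\<close>; inverting \<open>tau\<close>
  with \<open>r powr s = \<theta>\<close> bounds it.\<close>

lemma ln_q_lower_less:
  obtains C where
    "\<And>\<theta>. 0 < \<theta> \<Longrightarrow> \<theta> < 1 \<Longrightarrow>
      eventually (\<lambda>j. - (lam s / \<theta>) * real j powr s - C - 2 * ln (real j) \<le> ln (q j)) sequentially"
proof -
  obtain C where C:
    "eventually (\<lambda>j. \<exists>a\<ge>0. nu a = real j \<and> - a - C - 2 * ln (real j) \<le> ln (q j)) sequentially"
    by (rule ln_q_lower_window)
  show ?thesis
  proof (rule that)
    fix \<theta> :: real assume \<theta>: "0 < \<theta>" "\<theta> < 1"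
    define r where "r = \<theta> powr (1 / s)"
    have r: "0 < r" "r < 1" using powr_less_mono2[of "1 / s" \<theta> 1] \<theta> s_pos by (auto simp: r_def)
    have rs: "r powr s = \<theta>" using \<theta> s_pos by (simp add: r_def powr_powr)
    obtain A where A: "A \<ge> 0" "\<And>a. a \<ge> A \<Longrightarrow> r * tau a \<le> nu a"
      by (rule nu_lower_eventually[OF r]) blast
    have "eventually (\<lambda>j. nu A < real j) sequentially" by real_asymp
    from C this show "eventually (\<lambda>j. - (lam s / \<theta>) * real j powr s - C - 2 * ln (real j) \<le> ln (q j)) sequentially"
    proof eventually_elim
      case (elim j)
      then obtain a where a: "a \<ge> 0" "nu a = real j" "- a - C - 2 * ln (real j) \<le> ln (q j)" by blast
      have "A \<le> a" using nu_mono[of a A] elim(2) a(2) by linarith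
      hence "tau a \<le> real j / r" using A(2)[of a] a(2) r by (simp add: field_simps)
      hence "a \<le> lam s * (real j / r) powr s" using a(1) r by (subst (asm) tau_le_iff) auto
      also have "\<dots> = lam s / \<theta> * real j powr s" using r by (simp add: powr_divide rs)
      finally show ?case using a(3) by simp
    qed
  qed
qed

theorem ln_q_asymp_less:
  assumes s: "s < 1"
  shows "(\<lambda>j. ln (q j)) \<sim>[sequentially] (\<lambda>j. - lam s * real (Suc j) powr s)"
proof (rule asymp_equivI', rule order_tendstoI)
  let ?T = "\<lambda>j. lam s * real (Suc j) powr s"
  have ratio: "ln (q j) / (- ?T j) = - ln (q j) / ?T j" for j by simp
  have pos: "?T j > 0" for j by simp
  {
    fix a :: real assume a: "a < 1"
    \<comment> \<open>Any value in (0, 1) above \<open>a\<close> works; the maximum covers negative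
      \<open>a\<close>. Since the quotient has a negative denominator, its lower bound comes from
      the upper bound on \<open>ln (q j)\<close>.\<close>
    define \<theta> where "\<theta> = (max a 0 + 1) / 2"
    have \<theta>: "0 < \<theta>" "\<theta> < 1" "a < \<theta>" using a by (auto simp: \<theta>_def max_def field_simps)
    have lim: "((\<lambda>j. (l * \<theta> * real j powr s - ln 2) / (l * real (Suc j) powr s)) \<longlongrightarrow> \<theta>) sequentially"
      if "l > 0" for l :: real
      using that \<theta> s_pos by real_asymp
    from order_tendstoD(1)[OF lim[OF lam_s_pos] \<theta>(3)] ln_q_upper_less[OF s \<theta>(1,2)]
    show "eventually (\<lambda>j. a < ln (q j) / (- lam s * real (Suc j) powr s)) sequentially"
    proof eventually_elim
      case (elim j)
      note elim(1)
      also have "(lam s * \<theta> * real j powr s - ln 2) / ?T j \<le> - ln (q j) / ?T j"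
        by (rule divide_right_mono) (use elim(2) pos[of j] in linarith)+
      finally show ?case by simp
    qed
  next
    fix b :: real assume b: "b > 1"
    define \<theta> where "\<theta> = (1 / b + 1) / 2"
    have ib: "1 / b < 1" "0 < 1 / b" using b by auto
    have \<theta>: "0 < \<theta>" "\<theta> < 1" "1 / b < \<theta>" using ib by (auto simp: \<theta>_def field_simps)
    have \<theta>b: "1 / \<theta> < b" using \<theta>(1,3) b by (simp add: field_simps)
    obtain C where C: "\<And>\<theta>. 0 < \<theta> \<Longrightarrow> \<theta> < 1 \<Longrightarrow>
      eventually (\<lambda>j. - (lam s / \<theta>) * real j powr s - C - 2 * ln (real j) \<le> ln (q j)) sequentially"
      using ln_q_lower_less by blast
    have lim: "((\<lambda>j. (l / \<theta> * real j powr s + C + 2 * ln (real j)) / (l * real (Suc j) powr s)) \<longlongrightarrow> 1 / \<theta>) sequentially"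
      if "l > 0" for l :: real
      using that \<theta> s_pos by real_asymp
    from order_tendstoD(2)[OF lim[OF lam_s_pos] \<theta>b] C[OF \<theta>(1,2)]
    show "eventually (\<lambda>j. ln (q j) / (- lam s * real (Suc j) powr s) < b) sequentially"
    proof eventually_elim
      case (elim j)
      have "- ln (q j) / ?T j \<le> (lam s / \<theta> * real j powr s + C + 2 * ln (real j)) / ?T j"
        by (rule divide_right_mono) (use elim(2) pos[of j] in linarith)+
      also note elim(1)
      finally show ?case by simp
    qed
  }
qed

section \<open>The case s > 1\<close>

text \<open>The window of levels from j to j + 1 costs only a factor of order exp(-j), while its
  means are of order at least j^(1/s). The leading term comes from j^(j/s) / j^j.\<close>

lemma ln_q_lower_greater:
  assumes s: "s > 1"
  obtains C D where
    "eventually (\<lambda>j. - (1 - 1 / s) * real j * ln (real j) - C * real j - D \<le> ln (q j)) sequentially"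
proof -
  obtain c where c: "c > 0"
    "\<And>m \<delta>. m \<ge> 0 \<Longrightarrow> \<delta> \<ge> 0 \<Longrightarrow> F (m + \<delta>) - F m \<ge> c * (exp (- m) - exp (- (m + \<delta>)))"
    using F_incr_lower by blast
  obtain A where A: "A \<ge> 0" "\<And>a. a \<ge> A \<Longrightarrow> (1 / 2) * tau a \<le> nu a"
    by (rule nu_lower_eventually[of "1 / 2"]) auto
  obtain D where D: "D \<ge> 0" "\<And>m. m \<ge> 0 \<Longrightarrow> nu m \<le> 2 * tau m + D"
    using nu_upper_tau by blast
  define d where "d = 1 / 2 * (1 / lam s) powr (1 / s)"
  have d: "d > 0" by (simp add: d_def less_imp_neq[OF lam_s_pos, symmetric])
  have tau_nat: "1 / 2 * tau (real j) = d * real j powr (1 / s)" for j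
    by (simp add: tau_def d_def powr_divide less_imp_neq[OF lam_s_pos, symmetric])
  define c' where "c' = c * (1 - exp (- 1))"
  have c': "c' > 0" using c(1) by (simp add: c'_def)
  \<comment> \<open>As s > 1, \<open>tau\<close> is sublinear, so the means in the window stay below
    \<open>j\<close> and \<open>exp (- v) \<ge> exp (- real j)\<close>.\<close>
  have "eventually (\<lambda>j. 2 * ((real j + 1) / l) powr (1 / s) + D \<le> real j) sequentially" if "l > 0" for l
    using that s by real_asymp
  from this[OF lam_s_pos] have ev1: "eventually (\<lambda>j. 2 * tau (real j + 1) + D \<le> real j) sequentially"
    unfolding tau_def .
  have "eventually (\<lambda>j. A \<le> real j) sequentially" by real_asymp
  from this ev1 eventually_gt_at_top[of 0]
  have "eventually (\<lambda>j. - (1 - 1 / s) * real j * ln (real j) - (2 - ln d) * real j - (- ln c') \<le> ln (q j)) sequentially"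
  proof eventually_elim
    case (elim j)
    define B where "B = exp (- real j) * (d * real j powr (1 / s)) ^ j / real j ^ j"
    have jp: "real j powr (1 / s) > 0" using elim(3) by simp
    have B: "B > 0" using d jp elim(3) by (simp add: B_def)
    have "B * (c' * exp (- real j)) = B * (c * (exp (- real j) - exp (- (real j + 1))))"
      by (simp add: c'_def algebra_simps mult_exp_exp)
    also have "\<dots> \<le> B * (F (real j + 1) - F (real j))"
      using B by (intro mult_left_mono c(2)) auto
    also have "\<dots> \<le> q j"
    proof (rule q_ge)
      fix v assume v: "nu (real j) \<le> v" "v \<le> nu (real j + 1)"
      have "d * real j powr (1 / s) \<le> v"
        using A(2)[OF elim(1)] v(1) by (simp only: tau_nat)
      moreover have "0 \<le> v" using order.trans[OF nu_nonneg v(1)] .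
      moreover have "v \<le> real j" using v(2) D(2)[of "real j + 1"] elim(2) by simp
      moreover have "fact j \<le> real j ^ j" using fact_le_power[of j, where 'a = real] by simp
      ultimately show "B \<le> pois v j"
        unfolding B_def pois_def using d jp
        by (intro frac_le mult_mono power_mono mult_nonneg_nonneg) auto
    qed simp
    finally have le: "B * (c' * exp (- real j)) \<le> q j" .
    have "ln (B * (c' * exp (- real j))) = - real j + real j * (ln d + ln (real j) / s) - real j * ln (real j) + (ln c' - real j)"
      using d jp c' elim(3) by (simp add: B_def ln_mult ln_div ln_realpow ln_powr)
    moreover have "ln (B * (c' * exp (- real j))) \<le> ln (q j)"
      using B c' q_pos[of j] by (intro ln_mono le) auto
    ultimately show ?case by (simp add: algebra_simps)
  qed
  thus ?thesis by (rule that)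
qed

text \<open>Splitting at \<alpha> j ln j makes the tail already of the target size. Below this level
  the means are O((j ln j)^(1/s)), and \<open>pois_le_power\<close> gives the same exponent up to an
  error of order j ln ln j.\<close>

lemma ln_q_upper_greater:
  assumes s: "s > 1"
  obtains C where
    "eventually (\<lambda>j. ln (q j) \<le> ln 2 - (1 - 1 / s) * real j * ln (real j) + real j * (C + ln (ln (real j)) / s)) sequentially"
proof -
  obtain D where D: "D \<ge> 0" "\<And>m. m \<ge> 0 \<Longrightarrow> nu m \<le> 2 * tau m + D"
    using nu_upper_tau by blast
  define \<alpha> where "\<alpha> = 1 - 1 / s"
  have \<alpha>: "\<alpha> > 0" using s by (simp add: \<alpha>_def)
  \<comment> \<open>The summand 1 absorbs the additive constant \<open>D\<close>.\<close>
  define K where "K = 2 * (\<alpha> / lam s) powr (1 / s) + 1"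
  have K: "K > 0" by (simp add: K_def add_nonneg_pos)
  \<comment> \<open>The absolute value makes the error \<open>R\<close> nonnegative, so the tail is
    bounded by the same expression as the Poisson term.\<close>
  define C where "C = \<bar>ln K + 1\<bar>"
  have ev1: "eventually (\<lambda>j. D \<le> (real j * ln (real j)) powr (1 / s)) sequentially"
    using s by real_asymp
  have ev2: "eventually (\<lambda>j. ln (ln (real j)) \<ge> 0) sequentially" by real_asymp
  from ev1 ev2 eventually_ge_at_top[of 2]
  have "eventually (\<lambda>j. ln (q j) \<le> ln 2 - \<alpha> * real j * ln (real j) + real j * (C + ln (ln (real j)) / s)) sequentially"
  proof eventually_elim
    case (elim j)
    have lj: "ln (real j) > 0" using elim(3) by simp
    define m where "m = \<alpha> * (real j * ln (real j))"
    define b where "b = K * (real j * ln (real j)) powr (1 / s)"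
    have m: "m \<ge> 0" using \<alpha> lj by (simp add: m_def)
    have b: "b > 0" using K lj elim(3) by (simp add: b_def)
    have "tau m = (\<alpha> / lam s) powr (1 / s) * (real j * ln (real j)) powr (1 / s)"
      using \<alpha> lj by (simp add: tau_def m_def flip: powr_mult)
    hence nu: "nu m \<le> b" using D(2)[OF m] elim(1) by (simp add: b_def K_def algebra_simps)
    define R where "R = real j * (C + ln (ln (real j)) / s)"
    have R: "R \<ge> 0" using elim(2) s by (simp add: R_def C_def)
    have "q j \<le> exp (- m) + (b * exp 1 / real j) ^ j"
      using nu elim(3) by (intro q_le pois_le_power) auto
    also have "(b * exp 1 / real j) ^ j = exp (real j * ln (b * exp 1 / real j))"
      using b elim(3) by (simp add: exp_of_nat_mult)
    also have "ln (b * exp 1 / real j) = ln K + (ln (real j) + ln (ln (real j))) / s + 1 - ln (real j)"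
      using b K lj elim(3) by (simp add: b_def ln_mult ln_div ln_powr)
    also have "real j * \<dots> \<le> - m + R"
    proof -
      have "real j * (ln K + 1) \<le> real j * C" by (intro mult_left_mono) (auto simp: C_def)
      thus ?thesis by (simp add: m_def R_def \<alpha>_def algebra_simps add_divide_distrib)
    qed
    finally have "q j \<le> exp (- m) + exp (- m + R)" by simp
    also have "exp (- m) \<le> exp (- m + R)" using R by simp
    finally have "q j \<le> 2 * exp (- m + R)" by simp
    hence "ln (q j) \<le> ln (2 * exp (- m + R))" using q_pos[of j] by simp
    also have "\<dots> = ln 2 - m + R" by (simp add: ln_mult)
    finally show ?case by (simp add: m_def R_def algebra_simps)
  qed
  thus ?thesis using that by (simp add: \<alpha>_def)
qed

text \<open>The errors of order j and j ln ln j, and the shift from \<open>j\<close> to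
  \<open>Suc j\<close>, are negligible against j ln j.\<close>

theorem ln_q_asymp_greater:
  assumes s: "s > 1"
  shows "(\<lambda>j. ln (q j)) \<sim>[sequentially] (\<lambda>j. - (1 - 1 / s) * real (Suc j) * ln (real (Suc j)))"
proof -
  obtain C D where l:
    "eventually (\<lambda>j. - (1 - 1 / s) * real j * ln (real j) - C * real j - D \<le> ln (q j)) sequentially"
    by (rule ln_q_lower_greater[OF s])
  obtain C' where u:
    "eventually (\<lambda>j. ln (q j) \<le> ln 2 - (1 - 1 / s) * real j * ln (real j) + real j * (C' + ln (ln (real j)) / s)) sequentially"
    by (rule ln_q_upper_greater[OF s])
  define \<alpha> where "\<alpha> = 1 - 1 / s"
  have \<alpha>: "\<alpha> > 0" using s by (simp add: \<alpha>_def)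
  have "(\<lambda>j. - \<alpha> * real j * ln (real j) - C * real j - D) \<sim>[sequentially] (\<lambda>j. - \<alpha> * real (Suc j) * ln (real (Suc j)))"
    using \<alpha> by real_asymp
  moreover have "(\<lambda>j. ln 2 - \<alpha> * real j * ln (real j) + real j * (C' + ln (ln (real j)) / s))
      \<sim>[sequentially] (\<lambda>j. - \<alpha> * real (Suc j) * ln (real (Suc j)))"
    using \<alpha> s by real_asymp
  moreover have "eventually (\<lambda>j. ln (q j) \<in> {- \<alpha> * real j * ln (real j) - C * real j - D..
      ln 2 - \<alpha> * real j * ln (real j) + real j * (C' + ln (ln (real j)) / s)}) sequentially"
    using l u unfolding \<alpha>_def by eventually_elim simp
  ultimately show ?thesis
    unfolding \<alpha>_def by (rule asymp_equiv_sandwich_real)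
qed

end

lemma asymp_equiv_sequentially_Suc:
  fixes f g :: "nat \<Rightarrow> real"
  assumes "(\<lambda>n. f (Suc n)) \<sim>[sequentially] (\<lambda>n. g (Suc n))"
  shows "f \<sim>[sequentially] g"
  using assms unfolding asymp_equiv_def by (rule filterlim_sequentially_Suc[THEN iffD1])

theorem theorem2p2:
  fixes s :: real and M :: "'a measure" and \<mu> :: "real measure"
    and E X L W :: "nat \<Rightarrow> 'a \<Rightarrow> real"
    and p :: "nat \<Rightarrow> real"
  assumes s: "s > 0"
    and M: "prob_space M"
    and indep: "prob_space.indep_vars M (\<lambda>_. borel) (case_sum E (case_sum L W)) (UNIV :: (nat + nat + nat) set)"
    and E: "\<And>i. distributed M lborel (E i) (exponential_density 1)"
    and X: "\<And>i \<omega>. X i \<omega> = arrival s (\<lambda>j. E j \<omega>) i"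
    and L: "\<And>i x. \<P>(\<omega> in M. L i \<omega> \<le> x) = exp (- exp (- x))"
    and mu: "W_law s \<mu>"
    and W: "\<And>i. distr M borel (W i) = \<mu>"
    and p: "\<And>k. p k = \<P>(\<omega> in M. Dhat s (\<lambda>i. X i \<omega>) (\<lambda>i. L i \<omega>) (\<lambda>i. W i \<omega>) = of_nat k)"
  shows "(s = 1 \<longrightarrow> (\<forall>k\<ge>1. p k = (1 / 2) ^ k)) \<and>
         (s < 1 \<longrightarrow> (\<lambda>k. ln (p k)) \<sim>[sequentially] (\<lambda>k. - lam s * real k powr s)) \<and>
         (s > 1 \<longrightarrow> (\<lambda>k. ln (p k)) \<sim>[sequentially] (\<lambda>k. - (1 - 1 / s) * real k * ln (real k)))"
proof -
  interpret W_fixpoint s \<mu> using s mu by unfold_locales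
  obtain \<rho> where "poisson_marks s \<mu> \<rho>" and law:
    "\<And>k. \<P>(\<omega> in M. Dhat s (arrival s (\<lambda>j. E j \<omega>)) (\<lambda>i. L i \<omega>) (\<lambda>i. W i \<omega>) = of_nat (Suc k))
        = (\<integral>r. pois (nu r) k \<partial>\<rho>)"
    using Dhat_law[OF M indep E L W] by blast
  then interpret poisson_marks s \<mu> \<rho> by simp
  have pq: "p (Suc k) = q k" for k
    unfolding p X law[symmetric] q_def by (rule refl)
  show ?thesis
  proof (intro conjI impI allI)
    fix k :: nat assume "s = 1" "1 \<le> k"
    thus "p k = (1 / 2) ^ k" using pq[of "k - 1"] q_geometric[of "k - 1"] by simp
  next
    assume "s < 1"
    show "(\<lambda>k. ln (p k)) \<sim>[sequentially] (\<lambda>k. - lam s * real k powr s)"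
      by (rule asymp_equiv_sequentially_Suc) (simp only: pq ln_q_asymp_less[OF \<open>s < 1\<close>])
  next
    assume "s > 1"
    show "(\<lambda>k. ln (p k)) \<sim>[sequentially] (\<lambda>k. - (1 - 1 / s) * real k * ln (real k))"
      by (rule asymp_equiv_sequentially_Suc) (simp only: pq ln_q_asymp_greater[OF \<open>s > 1\<close>])
  qed
qed

end
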